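(* Let $k\ge 2$ and, for each $n$, let $y_{i1}(t),\dots,y_{in_i}(t)$, $i=1,\dots,k$, $t\in\mathcal T=[a,b]$, be $k$ independent functional samples with $y_{ij}(t)=\eta_i(t)+v_{ij}(t)$, where $\eta_i\in L^2(\mathcal T)$ and $v_{i1},\dots,v_{in_i}$ are i.i.d. stochastic processes with mean function $0$ and covariance function $\gamma_i(s,t)$, $\mathrm{tr}(\gamma_i)=\int_{\mathcal T}\gamma_i(t,t)\,dt<\infty$. Assume: (A1) the $k$ samples are Gaussian; (A2) as $n=\sum_{i=1}^k n_i\to\infty$, $n_i/n\to\tau_i\in(0,1)$ for $i=1,\dots,k$; (A3) the $\gamma_i$ are uniformly bounded. Suppose the local alternative $$\gamma_i(s,t)=\gamma(s,t)+(n_i-1)^{-1/2}d_i(s,t),\qquad i=1,\dots,k,$$ holds, where $d_1,\dots,d_k$ are fixed bivariate functions independent of $n$ and $\gamma$ is a covariance function. With $T_n$, $\lambda_r$, $m$ and $\delta_r^2$ as defined in the context, as $n\to\infty$ we have $T_n\xrightarrow{d}T_1$ with $$T_1\stackrel{d}{=}\sum_{r=1}^m\lambda_rA_r+\sum_{r=m+1}^\infty\delta_r^2,$$ where $A_r\sim\chi^2_{k-1}(\lambda_r^{-1}\delta_r^2)$, $r=1,\dots,m$, are independent (noncentral chi-squared with $k-1$ degrees of freedom and noncentrality parameter $\lambda_r^{-1}\delta_r^2$).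
   Context: $-\infty<a<b<\infty$. The covariance functions $\gamma_i$ depend on $n$ through the local alternative; "uniformly bounded" in (A3) is uniform in $i$, $n$ and the arguments. Statistic: $\bar y_i(t)=n_i^{-1}\sum_{j}y_{ij}(t)$, $\hat\gamma_i(s,t)=(n_i-1)^{-1}\sum_{j=1}^{n_i}[y_{ij}(s)-\bar y_i(s)][y_{ij}(t)-\bar y_i(t)]$, $\hat\gamma(s,t)=\sum_{i=1}^k(n_i-1)\hat\gamma_i(s,t)/(n-k)$, and $$T_n=\sum_{i=1}^k(n_i-1)\int_{\mathcal T}\int_{\mathcal T}[\hat\gamma_i(s,t)-\hat\gamma(s,t)]^2\,ds\,dt.$$ Spectral quantities: let $\varpi[(s_1,t_1),(s_2,t_2)]=\gamma(s_1,s_2)\gamma(t_1,t_2)+\gamma(s_1,t_2)\gamma(s_2,t_1)$, the kernel of an integral operator on $L^2(\mathcal T^2)$. Let $\lambda_r$ be its eigenvalues (with multiplicity) and $\phi_r(s,t)$ the associated orthonormal eigenfunctions, together forming an orthonormal basis of $L^2(\mathcal T^2)$, indexed so that exactly $\lambda_1,\dots,\lambda_m$ are positive; indices $r>m$ enumerate the eigenfunctions with eigenvalue $0$ (if $m=\infty$, "$r=m+1,m+2,\dots$" is understood as an enumeration of an orthonormal basis of the kernel). Let $\mathbf b=[\sqrt{\tau_1},\dots,\sqrt{\tau_k}]^T$ and $\mathbf W=\mathbf I_k-\mathbf b\mathbf b^T$, an idempotent matrix of rank $k-1$, with decomposition $\mathbf W=\mathbf U\,\mathrm{diag}(\mathbf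 I_{k-1},0)\,\mathbf U^T$, $\mathbf U$ orthogonal with columns eigenvectors of $\mathbf W$. Put $\mathbf d(s,t)=[d_1(s,t),\dots,d_k(s,t)]^T$, $\tilde{\mathbf d}(s,t)=[\mathbf I_{k-1},\mathbf 0]\mathbf U^T\mathbf d(s,t)\in\mathbb R^{k-1}$, and $$\delta_r^2=\Big\|\int_{\mathcal T}\int_{\mathcal T}\tilde{\mathbf d}(s,t)\phi_r(s,t)\,ds\,dt\Big\|^2.$$ *)

theory Defs
  imports
    "HOL-Probability.Probability"
    "HOL-Library.Extended_Nat"
    "Jordan_Normal_Form.Matrix"
begin

subsection \<open>The interval, its square and their L2 spaces\<close>

definition interval_measure_on :: "real \<Rightarrow> real \<Rightarrow> real measure" where
  "interval_measure_on a b = restrict_space lborel {a..b}"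

definition square_measure :: "real \<Rightarrow> real \<Rightarrow> (real \<times> real) measure" where
  "square_measure a b = interval_measure_on a b \<Otimes>\<^sub>M interval_measure_on a b"

definition L2 :: "'a measure \<Rightarrow> ('a \<Rightarrow> real) \<Rightarrow> bool" where
  "L2 M f \<longleftrightarrow> f \<in> borel_measurable M \<and> integrable M (\<lambda>x. (f x)\<^sup>2)"

definition orthonormal_basis :: "'a measure \<Rightarrow> 'i set \<Rightarrow> ('i \<Rightarrow> 'a \<Rightarrow> real) \<Rightarrow> bool" where
  "orthonormal_basis M I e \<longleftrightarrow>
     (\<forall>i\<in>I. L2 M (e i)) \<and>
     (\<forall>i\<in>I. \<forall>j\<in>I. (\<integral>x. e i x * e j x \<partial>M) = (if i = j then 1 else 0)) \<and>
     (\<forall>f. L2 M f \<longrightarrow> (\<forall>i\<in>I. (\<integral>x. f x * e i x \<partial>M) = 0) \<longrightarrow> (AE x in M. f x = 0))"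

definition eigenfunction ::
  "'a measure \<Rightarrow> ('a \<Rightarrow> 'a \<Rightarrow> real) \<Rightarrow> real \<Rightarrow> ('a \<Rightarrow> real) \<Rightarrow> bool" where
  "eigenfunction M K l f \<longleftrightarrow> L2 M f \<and> \<not> (AE x in M. f x = 0) \<and>
     (AE x in M. (\<integral>y. K x y * f y \<partial>M) = l * f x)"


subsection \<open>Stochastic processes\<close>

text \<open>A process is a family \<open>X t \<omega>\<close> with \<open>t\<close> in an index set \<open>T\<close>. Its law is the
  distribution of its path, restricted to \<open>T\<close>, on the product space.\<close>

definition sample_path :: "real set \<Rightarrow> (real \<Rightarrow> 'w \<Rightarrow> real) \<Rightarrow> 'w \<Rightarrow> real \<Rightarrow> real" where
  "sample_path T X \<omega> = (\<lambda>t\<in>T. X t \<omega>)"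

definition process_law :: "'w measure \<Rightarrow> real set \<Rightarrow> (real \<Rightarrow> 'w \<Rightarrow> real) \<Rightarrow> (real \<Rightarrow> real) measure" where
  "process_law M T X = distr M (PiM T (\<lambda>_. borel)) (sample_path T X)"

definition has_mean_cov ::
  "'w measure \<Rightarrow> real set \<Rightarrow> (real \<Rightarrow> 'w \<Rightarrow> real) \<Rightarrow> (real \<Rightarrow> real) \<Rightarrow> (real \<Rightarrow> real \<Rightarrow> real) \<Rightarrow> bool" where
  "has_mean_cov M T X m c \<longleftrightarrow>
     (\<forall>t\<in>T. L2 M (X t) \<and> (\<integral>\<omega>. X t \<omega> \<partial>M) = m t) \<and>
     (\<forall>s\<in>T. \<forall>t\<in>T. (\<integral>\<omega>. (X s \<omega> - m s) * (X t \<omega> - m t) \<partial>M) = c s t)"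

text \<open>The covariance function of some square-integrable process. Taking the coordinate process
  under a measure on paths is no restriction, since any process may be replaced by its law.\<close>

definition covariance_function :: "real set \<Rightarrow> (real \<Rightarrow> real \<Rightarrow> real) \<Rightarrow> bool" where
  "covariance_function T c \<longleftrightarrow>
     (\<exists>(Q :: (real \<Rightarrow> real) measure) m. prob_space Q \<and> has_mean_cov Q T (\<lambda>t x. x t) m c)"

definition normal_distribution :: "real \<Rightarrow> real \<Rightarrow> real measure" where
  "normal_distribution \<mu> \<sigma> =
     (if \<sigma> = 0 then return borel \<mu> else density lborel (\<lambda>x. ennreal (normal_density \<mu> \<sigma> x)))"

definition gaussian_process :: "'w measure \<Rightarrow> real set \<Rightarrow> (real \<Rightarrow> 'w \<Rightarrow> real) \<Rightarrow> bool" where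
  "gaussian_process M T X \<longleftrightarrow>
     (\<forall>t\<in>T. X t \<in> borel_measurable M) \<and>
     (\<forall>J c. finite J \<and> J \<subseteq> T \<longrightarrow>
        (\<exists>\<mu> \<sigma>. \<sigma> \<ge> 0 \<and> distr M borel (\<lambda>\<omega>. \<Sum>t\<in>J. c t * X t \<omega>) = normal_distribution \<mu> \<sigma>))"


subsection \<open>The test statistic\<close>

text \<open>Samples are numbered \<open>i < k\<close>, the observations in sample \<open>i\<close> by \<open>j < n i\<close>.\<close>

definition sample_mean :: "nat \<Rightarrow> (nat \<Rightarrow> real \<Rightarrow> real) \<Rightarrow> real \<Rightarrow> real" where
  "sample_mean n y t = (\<Sum>j<n. y j t) / real n"

definition sample_cov :: "nat \<Rightarrow> (nat \<Rightarrow> real \<Rightarrow> real) \<Rightarrow> real \<Rightarrow> real \<Rightarrow> real" where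
  "sample_cov n y s t =
     (\<Sum>j<n. (y j s - sample_mean n y s) * (y j t - sample_mean n y t)) / (real n - 1)"

definition pooled_cov ::
  "nat \<Rightarrow> (nat \<Rightarrow> nat) \<Rightarrow> (nat \<Rightarrow> nat \<Rightarrow> real \<Rightarrow> real) \<Rightarrow> real \<Rightarrow> real \<Rightarrow> real" where
  "pooled_cov k n y s t =
     (\<Sum>i<k. (real (n i) - 1) * sample_cov (n i) (y i) s t) / (real (\<Sum>i<k. n i) - real k)"

definition T_statistic ::
  "real \<Rightarrow> real \<Rightarrow> nat \<Rightarrow> (nat \<Rightarrow> nat) \<Rightarrow> (nat \<Rightarrow> nat \<Rightarrow> real \<Rightarrow> real) \<Rightarrow> real" where
  "T_statistic a b k n y =
     (\<Sum>i<k. (real (n i) - 1) *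
        (\<integral>s. (\<integral>t. (sample_cov (n i) (y i) s t - pooled_cov k n y s t)\<^sup>2
           \<partial>interval_measure_on a b) \<partial>interval_measure_on a b))"


subsection \<open>Spectral quantities\<close>

definition varpi :: "(real \<Rightarrow> real \<Rightarrow> real) \<Rightarrow> real \<times> real \<Rightarrow> real \<times> real \<Rightarrow> real" where
  "varpi c = (\<lambda>(s1, t1) (s2, t2). c s1 s2 * c t1 t2 + c s1 t2 * c s2 t1)"

definition pos_indices :: "enat \<Rightarrow> nat set" where
  "pos_indices m = {r. 1 \<le> r \<and> enat r \<le> m}"

text \<open>\<open>lam r\<close>, \<open>\<phi> r\<close> for \<open>1 \<le> r \<le> m\<close> are the positive eigenvalues with their eigenfunctions, and
  \<open>\<psi> q\<close> is the eigenfunction for the eigenvalue 0 that would carry the index \<open>m + 1 + q\<close>; the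
  two families are kept apart because \<open>m\<close> may be infinite. The kernel of \<open>varpi c\<close> is always
  infinite-dimensional (it contains all antisymmetric functions), so it is indexed by all of
  \<open>nat\<close>.\<close>

definition varpi_eigenbasis ::
  "real \<Rightarrow> real \<Rightarrow> (real \<Rightarrow> real \<Rightarrow> real) \<Rightarrow> enat \<Rightarrow> (nat \<Rightarrow> real) \<Rightarrow>
   (nat \<Rightarrow> real \<times> real \<Rightarrow> real) \<Rightarrow> (nat \<Rightarrow> real \<times> real \<Rightarrow> real) \<Rightarrow> bool" where
  "varpi_eigenbasis a b c m lam \<phi> \<psi> \<longleftrightarrow>
     (\<forall>r\<in>pos_indices m. lam r > 0 \<and> eigenfunction (square_measure a b) (varpi c) (lam r) (\<phi> r)) \<and>
     (\<forall>q. eigenfunction (square_measure a b) (varpi c) 0 (\<psi> q)) \<and>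
     orthonormal_basis (square_measure a b) (pos_indices m <+> (UNIV :: nat set))
       (case_sum \<phi> \<psi>)"


subsection \<open>The matrix W and the noncentrality parameters\<close>

definition W_matrix :: "nat \<Rightarrow> (nat \<Rightarrow> real) \<Rightarrow> real mat" where
  "W_matrix k \<tau> = 1\<^sub>m k - mat k k (\<lambda>(i, j). sqrt (\<tau> i) * sqrt (\<tau> j))"

definition W_decomposition :: "nat \<Rightarrow> (nat \<Rightarrow> real) \<Rightarrow> real mat \<Rightarrow> bool" where
  "W_decomposition k \<tau> U \<longleftrightarrow> U \<in> carrier_mat k k \<and> U\<^sup>T * U = 1\<^sub>m k \<and> U * U\<^sup>T = 1\<^sub>m k \<and>
     W_matrix k \<tau> = U * mat k k (\<lambda>(i, j). if i = j \<and> i < k - 1 then 1 else 0) * U\<^sup>T"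

text \<open>The leading matrix is \<open>[I, 0]\<close> with \<open>k - 1\<close> rows and \<open>k\<close> columns.\<close>

definition d_tilde ::
  "nat \<Rightarrow> real mat \<Rightarrow> (nat \<Rightarrow> real \<Rightarrow> real \<Rightarrow> real) \<Rightarrow> real \<Rightarrow> real \<Rightarrow> real vec" where
  "d_tilde k U d s t =
     mat (k - 1) k (\<lambda>(i, j). if i = j then 1 else 0) *\<^sub>v
       (U\<^sup>T *\<^sub>v Matrix.vec k (\<lambda>i. d i s t))"

definition delta_sq ::
  "real \<Rightarrow> real \<Rightarrow> nat \<Rightarrow> real mat \<Rightarrow> (nat \<Rightarrow> real \<Rightarrow> real \<Rightarrow> real) \<Rightarrow>
   (real \<times> real \<Rightarrow> real) \<Rightarrow> real" where
  "delta_sq a b k U d f =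
     (\<Sum>l<k - 1. (\<integral>s. (\<integral>t. vec_index (d_tilde k U d s t) l * f (s, t)
        \<partial>interval_measure_on a b) \<partial>interval_measure_on a b)\<^sup>2)"

text \<open>The law of \<open>Z 0 ^ 2 + ... + Z (p - 1) ^ 2\<close> for independent normal \<open>Z l\<close> of unit variance
  with means \<open>sqrt nc, 0, ..., 0\<close>. By rotation invariance any mean vector of squared length
  \<open>nc\<close> gives the same law. Intended for \<open>p \<ge> 1\<close> and \<open>nc \<ge> 0\<close>.\<close>

definition noncentral_chi_square :: "nat \<Rightarrow> real \<Rightarrow> real measure" where
  "noncentral_chi_square p nc =
     distr (PiM {..<p} (\<lambda>l. normal_distribution (if l = 0 then sqrt nc else 0) 1)) borel
       (\<lambda>z. \<Sum>l<p. (z l)\<^sup>2)"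

end

theory Submission
  imports Defs
begin

text \<open>
  Gaussianity enters only through Isserlis' formula, which gives the covariance kernel \<open>varpi\<close> of
  \<open>v \<otimes> v\<close>, and through bounded eighth moments. Up to a remainder vanishing in probability, the
  centred sample covariances are normalized sums of the independent fields \<open>v \<otimes> v - \<gamma>\<^sub>i\<close> plus
  the drift \<open>d\<^sub>i\<close>, and the statistic is the squared \<open>L2\<close> norm of their image under a projection
  that converges to \<open>W\<close>. By Parseval it is a series of squares of coordinates in the eigenbasis.

  Weak convergence of nonnegative variables follows from convergence of Laplace transforms. For a
  finite truncation of the series, a Gaussian randomization turns the Laplace transform of the
  quadratic form into an average of characteristic functions of linear forms, to which a central
  limit theorem for triangular arrays applies. The truncation error is uniform in the sample size,
  since the variances of the coordinates are quadratic polynomials in \<open>(n\<^sub>i - 1) powr (-1/2)\<close> whose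
  coefficients are summable over the eigenbasis.
\<close>

section \<open>Square-integrable functions\<close>

text \<open>The obstacle is regularity: neither paths nor covariance functions are assumed
  continuous. Independence and Gaussianity refer to the product sigma-algebra, the statistic to
  integrals over the square, and an integral of a path is not a function on the product space of
  paths; it is exchanged for its conditional expectation given the path, which agrees with it almost
  surely. Mercer's theorem would need continuity too: the eigenvalues of
  \<open>varpi \<gamma>\<close> are summable because Bessel's inequality holds for the random paths
  and survives taking expectations. The functions \<open>d i\<close> come without measurability or
  bounds; both are recovered by solving the alternative at two sample sizes. The other kernels in
  the variance expansion need not be positive, so their diagonal sums are reached by interpolation
  in the sample size. Laplace transforms suit a nonnegative statistic: the integrands stay in
  [0, 1], so that first moments of the remainder norms suffice.\<close>

lemma L2_measurable [measurable_dest]: "L2 M f \<Longrightarrow> f \<in> borel_measurable M"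
  by (simp add: L2_def)

lemma L2_power2_integrable: "L2 M f \<Longrightarrow> integrable M (\<lambda>x. (f x)\<^sup>2)"
  by (simp add: L2_def)

lemma L2_mult_integrable:
  assumes "L2 M f" "L2 M g"
  shows "integrable M (\<lambda>x. f x * g x)"
proof (rule Bochner_Integration.integrable_bound)
  show "integrable M (\<lambda>x. (f x)\<^sup>2 + (g x)\<^sup>2)"
    using assms by (simp add: L2_def)
  show "(\<lambda>x. f x * g x) \<in> borel_measurable M"
    using assms by (auto simp: L2_def)
  have "\<bar>u * v\<bar> \<le> \<bar>u\<^sup>2 + v\<^sup>2\<bar>" for u v :: real
  proof -
    have "0 \<le> (\<bar>u\<bar> - \<bar>v\<bar>)\<^sup>2" "0 \<le> \<bar>u\<bar> * \<bar>v\<bar>" by simp_all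
    then have "\<bar>u\<bar> * \<bar>v\<bar> \<le> u\<^sup>2 + v\<^sup>2"
      unfolding power2_diff power2_abs by linarith
    then show ?thesis by (simp add: abs_mult)
  qed
  then show "AE x in M. norm (f x * g x) \<le> norm ((f x)\<^sup>2 + (g x)\<^sup>2)"
    by simp
qed

lemma L2_add:
  assumes "L2 M f" "L2 M g"
  shows "L2 M (\<lambda>x. f x + g x)"
proof -
  have "integrable M (\<lambda>x. (f x)\<^sup>2 + (g x)\<^sup>2 + 2 * (f x * g x))"
    using assms L2_mult_integrable[OF assms] by (simp add: L2_def)
  then show ?thesis
    using assms by (auto simp: L2_def power2_sum algebra_simps)
qed

lemma L2_cmult: "L2 M f \<Longrightarrow> L2 M (\<lambda>x. c * f x)"
  by (auto simp: L2_def power_mult_distrib)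

lemma L2_diff:
  assumes "L2 M f" "L2 M g"
  shows "L2 M (\<lambda>x. f x - g x)"
  using L2_add[OF assms(1) L2_cmult[OF assms(2), of "-1"]] by simp

lemma L2_zero: "L2 M (\<lambda>x. 0)"
  by (simp add: L2_def)

lemma L2_sum: "(\<And>j. j \<in> J \<Longrightarrow> L2 M (f j)) \<Longrightarrow> L2 M (\<lambda>x. \<Sum>j\<in>J. f j x)"
  by (induction J rule: infinite_finite_induct) (auto intro: L2_add L2_zero)

lemma (in finite_measure) L2_bounded:
  assumes [measurable]: "f \<in> borel_measurable M" and "\<And>x. x \<in> space M \<Longrightarrow> \<bar>f x\<bar> \<le> (C::real)"
  shows "L2 M f"
  unfolding L2_def
proof
  show "integrable M (\<lambda>x. (f x)\<^sup>2)"
  proof (rule integrable_const_bound[of _ "C\<^sup>2"])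
    show "AE x in M. norm ((f x)\<^sup>2) \<le> C\<^sup>2"
      using assms(2) by (intro AE_I2) (metis abs_le_square_iff abs_ge_self norm_power order_trans power2_abs real_norm_def)
  qed simp
qed simp

lemma (in finite_measure) L2_integrable: "L2 M f \<Longrightarrow> integrable M f"
  by (simp add: L2_def square_integrable_imp_integrable)

lemma L2_Cauchy_Schwarz:
  assumes "L2 M f" "L2 M g"
  shows "(\<integral>x. f x * g x \<partial>M)\<^sup>2 \<le> (\<integral>x. (f x)\<^sup>2 \<partial>M) * (\<integral>x. (g x)\<^sup>2 \<partial>M)"
proof -
  note int = L2_mult_integrable[OF assms] L2_power2_integrable[OF assms(1)] L2_power2_integrable[OF assms(2)]
  define A where "A = (\<integral>x. (f x)\<^sup>2 \<partial>M)"
  define B where "B = (\<integral>x. f x * g x \<partial>M)"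
  define C where "C = (\<integral>x. (g x)\<^sup>2 \<partial>M)"
  have C0: "C \<ge> 0" unfolding C_def by simp
  \<comment> \<open>The multiple \<open>B / C\<close> minimizes the norm of \<open>f - t g\<close>;
    here the denominator is cleared, and the surplus factor \<open>C\<close> is why
    \<open>C = 0\<close> is treated separately.\<close>
  have "0 \<le> (\<integral>x. (C * f x - B * g x)\<^sup>2 \<partial>M)" by simp
  also have "\<dots> = (\<integral>x. C\<^sup>2 * (f x)\<^sup>2 - 2 * C * B * (f x * g x) + B\<^sup>2 * (g x)\<^sup>2 \<partial>M)"
    by (simp add: power2_eq_square algebra_simps)
  also have "\<dots> = C\<^sup>2 * A - 2 * C * B * B + B\<^sup>2 * C"
    using int by (simp add: A_def B_def C_def)
  also have "\<dots> = C * (A * C - B\<^sup>2)"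
    by (simp add: power2_eq_square algebra_simps)
  finally have *: "0 \<le> C * (A * C - B\<^sup>2)" .
  show ?thesis
  proof (cases "C = 0")
    case True
    then have "AE x in M. (g x)\<^sup>2 = 0"
      using integral_nonneg_eq_0_iff_AE[OF int(3)] by (simp add: C_def)
    then have "B = (\<integral>x. 0 \<partial>M)"
      unfolding B_def using assms by (intro integral_cong_AE) (auto simp: L2_def)
    with True show ?thesis by (simp add: A_def B_def C_def)
  next
    case False
    with * C0 have "0 \<le> A * C - B\<^sup>2" by (simp add: zero_le_mult_iff)
    then show ?thesis by (simp add: A_def B_def C_def)
  qed
qed

lemma (in finite_measure) integral_power2_le:
  assumes "L2 M f"
  shows "(\<integral>x. f x \<partial>M)\<^sup>2 \<le> measure M (space M) * (\<integral>x. (f x)\<^sup>2 \<partial>M)"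
  using L2_Cauchy_Schwarz[OF assms L2_bounded[of "\<lambda>x. 1" 1]] by (simp add: mult.commute)

lemma integral_linear_combination:
  fixes f :: "'i \<Rightarrow> 'a \<Rightarrow> real"
  assumes "\<And>j. j \<in> A \<Longrightarrow> integrable M (f j)"
  shows "integrable M (\<lambda>x. \<Sum>j\<in>A. c j * f j x)"
    and "(\<integral>x. (\<Sum>j\<in>A. c j * f j x) \<partial>M) = (\<Sum>j\<in>A. c j * (\<integral>x. f j x \<partial>M))"
  using assms by (auto simp: Bochner_Integration.integral_sum)

subsection \<open>Orthonormal systems\<close>

lemma orthonormal_basisD:
  assumes "orthonormal_basis M I e"
  shows "i \<in> I \<Longrightarrow> L2 M (e i)"
    and "i \<in> I \<Longrightarrow> j \<in> I \<Longrightarrow> (\<integral>x. e i x * e j x \<partial>M) = (if i = j then 1 else 0)"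
    and "L2 M f \<Longrightarrow> (\<And>i. i \<in> I \<Longrightarrow> (\<integral>x. f x * e i x \<partial>M) = 0) \<Longrightarrow> AE x in M. f x = 0"
  using assms unfolding orthonormal_basis_def by blast+

lemma orthonormal_inner_sum:
  assumes e: "orthonormal_basis M I e" and J: "J \<subseteq> I" "finite J" and i: "i \<in> I"
  shows "(\<integral>x. (\<Sum>j\<in>J. c j * e j x) * e i x \<partial>M) = (if i \<in> J then c i else 0)"
proof -
  have "(\<integral>x. (\<Sum>j\<in>J. c j * e j x) * e i x \<partial>M) = (\<integral>x. (\<Sum>j\<in>J. c j * (e j x * e i x)) \<partial>M)"
    by (simp add: sum_distrib_right mult.assoc)
  also have "\<dots> = (\<Sum>j\<in>J. c j * (\<integral>x. e j x * e i x \<partial>M))"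
    using J i by (subst Bochner_Integration.integral_sum)
      (auto intro!: L2_mult_integrable orthonormal_basisD(1)[OF e])
  also have "\<dots> = (\<Sum>j\<in>J. if j = i then c i else 0)"
    using J i by (intro sum.cong) (auto simp: orthonormal_basisD(2)[OF e])
  also have "\<dots> = (if i \<in> J then c i else 0)"
    using J by simp
  finally show ?thesis .
qed

text \<open>Pythagoras: the inner product of \<open>f\<close> with its partial expansion and the
  squared norm of that expansion are the same sum of squares, so one copy of it survives.\<close>

lemma orthonormal_norm_diff_sum:
  assumes e: "orthonormal_basis M I e" and J: "J \<subseteq> I" "finite J" and f: "L2 M f"
  shows "(\<integral>x. (f x - (\<Sum>j\<in>J. (\<integral>x. f x * e j x \<partial>M) * e j x))\<^sup>2 \<partial>M)
    = (\<integral>x. (f x)\<^sup>2 \<partial>M) - (\<Sum>j\<in>J. (\<integral>x. f x * e j x \<partial>M)\<^sup>2)"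
proof -
  define c where "c j = (\<integral>x. f x * e j x \<partial>M)" for j
  define s where "s x = (\<Sum>j\<in>J. c j * e j x)" for x
  have s: "L2 M s" unfolding s_def
    using J by (auto intro!: L2_sum L2_cmult orthonormal_basisD(1)[OF e])
  have eL: "j \<in> J \<Longrightarrow> L2 M (e j)" for j using J orthonormal_basisD(1)[OF e] by auto
  have fs: "(\<integral>x. f x * s x \<partial>M) = (\<Sum>j\<in>J. (c j)\<^sup>2)"
  proof -
    have "(\<integral>x. f x * s x \<partial>M) = (\<integral>x. (\<Sum>j\<in>J. c j * (f x * e j x)) \<partial>M)"
      unfolding s_def by (simp add: sum_distrib_left algebra_simps)
    also have "\<dots> = (\<Sum>j\<in>J. c j * c j)"
      unfolding c_def using eL
      by (subst Bochner_Integration.integral_sum) (auto intro!: L2_mult_integrable f)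
    finally show ?thesis by (simp add: power2_eq_square)
  qed
  have ss: "(\<integral>x. s x * s x \<partial>M) = (\<Sum>j\<in>J. (c j)\<^sup>2)"
  proof -
    have "(\<integral>x. s x * s x \<partial>M) = (\<integral>x. (\<Sum>j\<in>J. c j * (s x * e j x)) \<partial>M)"
      by (subst (2) s_def) (simp add: sum_distrib_left algebra_simps)
    also have "\<dots> = (\<Sum>j\<in>J. c j * (\<integral>x. s x * e j x \<partial>M))"
      using eL by (subst Bochner_Integration.integral_sum) (auto intro!: L2_mult_integrable s)
    also have "\<dots> = (\<Sum>j\<in>J. c j * c j)"
      unfolding s_def using J by (intro sum.cong) (auto simp: orthonormal_inner_sum[OF e J] subset_iff)
    finally show ?thesis by (simp add: power2_eq_square)
  qed
  have "(\<integral>x. (f x - s x)\<^sup>2 \<partial>M) = (\<integral>x. (f x)\<^sup>2 - 2 * (f x * s x) + s x * s x \<partial>M)"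
    by (simp add: power2_eq_square algebra_simps)
  also have "\<dots> = (\<integral>x. (f x)\<^sup>2 \<partial>M) - (\<Sum>j\<in>J. (c j)\<^sup>2)"
    using L2_mult_integrable[OF f s] L2_mult_integrable[OF s s] L2_power2_integrable[OF f]
    by (simp add: fs ss)
  finally show ?thesis by (simp add: s_def c_def)
qed

lemma orthonormal_Bessel:
  assumes e: "orthonormal_basis M I e" and J: "J \<subseteq> I" "finite J" and f: "L2 M f"
  shows "(\<Sum>j\<in>J. (\<integral>x. f x * e j x \<partial>M)\<^sup>2) \<le> (\<integral>x. (f x)\<^sup>2 \<partial>M)"
proof -
  have "0 \<le> (\<integral>x. (f x - (\<Sum>j\<in>J. (\<integral>x. f x * e j x \<partial>M) * e j x))\<^sup>2 \<partial>M)" by simp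
  then show ?thesis unfolding orthonormal_norm_diff_sum[OF assms] by simp
qed

text \<open>Maximality of the system gives completeness through Riesz--Fischer: the partial sums are
  Cauchy in \<open>L1\<close>, hence converge almost everywhere along a subsequence, and \<open>f\<close> minus the limit
  is orthogonal to the system.\<close>

lemma (in finite_measure) orthonormal_Parseval:
  assumes e: "orthonormal_basis M I e" and f: "L2 M f"
    and J: "\<And>R. J R \<subseteq> I" "\<And>R::nat. finite (J R)" "incseq J" "(\<Union>R. J R) = I"
  shows "(\<lambda>R. \<Sum>j\<in>J R. (\<integral>x. f x * e j x \<partial>M)\<^sup>2) \<longlonglongrightarrow> (\<integral>x. (f x)\<^sup>2 \<partial>M)"
proof -
  define c where "c j = (\<integral>x. f x * e j x \<partial>M)" for j
  define S where "S R = (\<Sum>j\<in>J R. (c j)\<^sup>2)" for R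
  define s where "s R x = (\<Sum>j\<in>J R. c j * e j x)" for R x
  have eL: "j \<in> I \<Longrightarrow> L2 M (e j)" for j using orthonormal_basisD(1)[OF e] .
  have sL: "L2 M (s R)" for R unfolding s_def
    using J(1)[of R] by (auto intro!: L2_sum L2_cmult eL)
  note [measurable] = L2_measurable[OF sL] L2_measurable[OF f]
  have Jmono: "R \<le> R' \<Longrightarrow> J R \<subseteq> J R'" for R R' using J(3) by (auto simp: incseq_def)
  have Smono: "incseq S"
    unfolding incseq_def S_def using J(2) Jmono by (intro allI impI sum_mono2) auto
  have Sbound: "S R \<le> (\<integral>x. (f x)\<^sup>2 \<partial>M)" for R
    unfolding S_def c_def by (rule orthonormal_Bessel[OF e J(1,2) f])
  obtain L where L: "S \<longlonglongrightarrow> L" "\<And>R. S R \<le> L"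
    using incseq_convergent[OF Smono] Sbound by blast
  have s_inner: "(\<integral>x. s R' x * e j x \<partial>M) = (if j \<in> J R' then c j else 0)" if "j \<in> I" for R' j
    unfolding s_def by (rule orthonormal_inner_sum[OF e J(1,2) that])
  have dist: "(\<integral>x. (s R' x - s R x)\<^sup>2 \<partial>M) = S R' - S R" if "R \<le> R'" for R R'
  proof -
    have "(\<Sum>j\<in>J R'. (\<integral>x. s R' x * e j x \<partial>M)\<^sup>2) = S R'"
      unfolding S_def using J(1)[of R'] by (intro sum.cong) (auto simp: s_inner subset_iff)
    moreover have "(\<integral>x. (s R' x)\<^sup>2 \<partial>M) = S R'"
    proof -
      have "(\<Sum>j\<in>J R'. (\<integral>x. s R' x * e j x \<partial>M) * e j x) = s R' x" for x
        using J(1)[of R'] by (subst (2) s_def) (auto intro!: sum.cong simp: s_inner subset_iff)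
      then have "0 = (\<integral>x. (s R' x)\<^sup>2 \<partial>M) - S R'"
        using orthonormal_norm_diff_sum[OF e J(1)[of R'] J(2) sL[of R']] calculation by simp
      then show ?thesis by simp
    qed
    moreover have "(\<Sum>j\<in>J R. (\<integral>x. s R' x * e j x \<partial>M)\<^sup>2) = S R"
      unfolding S_def using J(1)[of R] Jmono[OF that] by (intro sum.cong) (auto simp: s_inner subset_iff)
    moreover have "(\<Sum>j\<in>J R. (\<integral>x. s R' x * e j x \<partial>M) * e j x) = s R x" for x
      using J(1)[of R] Jmono[OF that] by (subst (2) s_def) (auto intro!: sum.cong simp: s_inner subset_iff)
    ultimately show ?thesis
      using orthonormal_norm_diff_sum[OF e J(1)[of R] J(2) sL[of R']] by simp
  qed
  have dist_sym: "(\<integral>x. (s i x - s j x)\<^sup>2 \<partial>M) \<le> L - S (min i j)" for i j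
  proof (cases "i \<le> j")
    case True
    then show ?thesis using dist[OF True] L(2)[of j] by (simp add: power2_commute min_def)
  next
    case False
    then have "j \<le> i" by simp
    from dist[OF this] L(2)[of i] show ?thesis using False by (simp add: min_def)
  qed
  \<comment> \<open>The squared distance is turned into an \<open>L1\<close> distance, since almost
    everywhere convergence along a subsequence is extracted from an \<open>L1\<close> Cauchy
    sequence.\<close>
  have distL: "(\<integral>x. \<bar>s i x - s j x\<bar> \<partial>M) \<le> sqrt (measure M (space M) * (L - S (min i j)))" for i j
  proof (rule real_le_rsqrt)
    have "(\<integral>x. \<bar>s i x - s j x\<bar> \<partial>M)\<^sup>2 \<le> measure M (space M) * (\<integral>x. \<bar>s i x - s j x\<bar>\<^sup>2 \<partial>M)"
      using L2_diff[OF sL[of i] sL[of j]] by (intro integral_power2_le) (auto simp: L2_def)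
    also have "\<dots> \<le> measure M (space M) * (L - S (min i j))"
      using dist_sym by (intro mult_left_mono) simp_all
    finally show "(\<integral>x. \<bar>s i x - s j x\<bar> \<partial>M)\<^sup>2 \<le> measure M (space M) * (L - S (min i j))" .
  qed
  have tail0: "(\<lambda>i. L - S i) \<longlonglongrightarrow> 0"
    using tendsto_diff[OF tendsto_const L(1), of L] by simp
  obtain r where r: "strict_mono r" "AE x in M. Cauchy (\<lambda>i. s (r i) x)"
  proof (rule cauchy_L1_AE_cauchy_subseq[of M s])
    show "integrable M (s n)" for n by (rule L2_integrable[OF sL])
    fix ep :: real assume "ep > 0"
    have "(\<lambda>i. sqrt (measure M (space M) * (L - S i))) \<longlonglongrightarrow> sqrt (measure M (space M) * 0)"
      by (intro tendsto_intros tail0)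
    then have "(\<lambda>i. sqrt (measure M (space M) * (L - S i))) \<longlonglongrightarrow> 0" by simp
    then obtain N where N: "\<And>i. i \<ge> N \<Longrightarrow> sqrt (measure M (space M) * (L - S i)) < ep"
      using order_tendstoD(2)[of _ 0 sequentially ep] \<open>ep > 0\<close> unfolding eventually_sequentially by blast
    have "(\<integral>x. norm (s i x - s j x) \<partial>M) < ep" if "i \<ge> N" "j \<ge> N" for i j
      using distL[of i j] N[of "min i j"] that by simp
    then show "\<exists>N. \<forall>i\<ge>N. \<forall>j\<ge>N. (\<integral>x. norm (s i x - s j x) \<partial>M) < ep" by blast
  qed blast
  define h where "h x = lim (\<lambda>i. s (r i) x)" for x
  have [measurable]: "h \<in> borel_measurable M" unfolding h_def by measurable
  have h: "AE x in M. (\<lambda>i. s (r i) x) \<longlonglongrightarrow> h x"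
    using r(2) by eventually_elim (simp add: h_def Cauchy_convergent_iff convergent_LIMSEQ_iff)
  \<comment> \<open>Fatou transfers the Cauchy estimate to the pointwise limit: square integrability
    of \<open>s (r i) - h\<close> and its rate come together, before anything is known about
    \<open>h\<close> itself.\<close>
  have nn: "(\<integral>\<^sup>+x. ennreal ((s (r i) x - h x)\<^sup>2) \<partial>M) \<le> ennreal (L - S (r i))" for i
  proof -
    have "(\<integral>\<^sup>+x. ennreal ((s (r i) x - h x)\<^sup>2) \<partial>M)
        = (\<integral>\<^sup>+x. liminf (\<lambda>k. ennreal ((s (r i) x - s (r k) x)\<^sup>2)) \<partial>M)"
    proof (rule nn_integral_cong_AE)
      show "AE x in M. ennreal ((s (r i) x - h x)\<^sup>2) = liminf (\<lambda>k. ennreal ((s (r i) x - s (r k) x)\<^sup>2))"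
        using h
      proof eventually_elim
        case (elim x)
        then have "(\<lambda>k. ennreal ((s (r i) x - s (r k) x)\<^sup>2)) \<longlonglongrightarrow> ennreal ((s (r i) x - h x)\<^sup>2)"
          by (intro tendsto_intros tendsto_ennrealI)
        then show ?case by (intro lim_imp_Liminf[symmetric]) auto
      qed
    qed
    also have "\<dots> \<le> liminf (\<lambda>k. \<integral>\<^sup>+x. ennreal ((s (r i) x - s (r k) x)\<^sup>2) \<partial>M)"
      by (intro nn_integral_liminf) simp
    also have "\<dots> \<le> limsup (\<lambda>k. \<integral>\<^sup>+x. ennreal ((s (r i) x - s (r k) x)\<^sup>2) \<partial>M)"
      by (intro Liminf_le_Limsup) simp
    also have "\<dots> \<le> ennreal (L - S (r i))"
    proof (rule Limsup_bounded)
      show "\<forall>\<^sub>F k in sequentially. (\<integral>\<^sup>+x. ennreal ((s (r i) x - s (r k) x)\<^sup>2) \<partial>M) \<le> ennreal (L - S (r i))"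
      proof (rule eventually_sequentiallyI)
        fix k assume "i \<le> k"
        then have "r i \<le> r k" using r(1) by (simp add: strict_mono_less_eq)
        have "(\<integral>\<^sup>+x. ennreal ((s (r i) x - s (r k) x)\<^sup>2) \<partial>M) = ennreal (\<integral>x. (s (r i) x - s (r k) x)\<^sup>2 \<partial>M)"
          by (intro nn_integral_eq_integral L2_power2_integrable L2_diff sL) simp
        also have "\<dots> \<le> ennreal (L - S (r i))"
          using dist_sym[of "r i" "r k"] \<open>r i \<le> r k\<close> by (intro ennreal_leI) (simp add: min_def)
        finally show "(\<integral>\<^sup>+x. ennreal ((s (r i) x - s (r k) x)\<^sup>2) \<partial>M) \<le> ennreal (L - S (r i))" .
      qed
    qed
    finally show ?thesis .
  qed
  have dL: "L2 M (\<lambda>x. s (r i) x - h x)" for i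
    unfolding L2_def
  proof
    show "integrable M (\<lambda>x. (s (r i) x - h x)\<^sup>2)"
      by (rule integrableI_nonneg) (use nn[of i] in \<open>auto intro: le_less_trans\<close>)
  qed simp
  have dn: "(\<integral>x. (s (r i) x - h x)\<^sup>2 \<partial>M) \<le> L - S (r i)" for i
  proof -
    have "ennreal (\<integral>x. (s (r i) x - h x)\<^sup>2 \<partial>M) = (\<integral>\<^sup>+x. ennreal ((s (r i) x - h x)\<^sup>2) \<partial>M)"
      by (intro nn_integral_eq_integral[symmetric] L2_power2_integrable dL) simp
    with nn[of i] have "ennreal (\<integral>x. (s (r i) x - h x)\<^sup>2 \<partial>M) \<le> ennreal (L - S (r i))" by simp
    with L(2)[of "r i"] show ?thesis by (subst (asm) ennreal_le_iff) auto
  qed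
  have hL: "L2 M h" using L2_diff[OF sL dL[of 0], of "r 0"] by simp
  have tr: "(\<lambda>i. L - S (r i)) \<longlonglongrightarrow> 0"
    using LIMSEQ_subseq_LIMSEQ[OF tail0 r(1)] by (simp add: comp_def)
  have "AE x in M. f x - h x = 0"
  proof (rule orthonormal_basisD(3)[OF e L2_diff[OF f hL]])
    fix j assume j: "j \<in> I"
    then obtain R where R: "j \<in> J R" using J(4) by auto
    \<comment> \<open>Once \<open>j\<close> belongs to \<open>J (r i)\<close>, both \<open>f\<close>
      and \<open>s (r i)\<close> have the coefficient \<open>c j\<close>, so \<open>f\<close> may be
      exchanged for \<open>s (r i)\<close>, whose distance to \<open>h\<close> tends to 0.\<close>
    have eq: "(\<integral>x. (f x - h x) * e j x \<partial>M) = (\<integral>x. (s (r i) x - h x) * e j x \<partial>M)" if "i \<ge> R" for i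
    proof -
      have "R \<le> r i" using that seq_suble[OF r(1), of i] by simp
      then have ji: "j \<in> J (r i)" using Jmono R by auto
      have "(\<integral>x. (f x - h x) * e j x \<partial>M)
        = (\<integral>x. f x * e j x - s (r i) x * e j x + (s (r i) x - h x) * e j x \<partial>M)"
        by (simp add: algebra_simps)
      also have "\<dots> = c j - c j + (\<integral>x. (s (r i) x - h x) * e j x \<partial>M)"
        using L2_mult_integrable[OF f eL[OF j]] L2_mult_integrable[OF sL[of "r i"] eL[OF j]]
          L2_mult_integrable[OF dL[of i] eL[OF j]] s_inner[OF j, of "r i"] ji
        by (simp add: c_def)
      finally show ?thesis by simp
    qed
    have "(\<integral>x. (f x - h x) * e j x \<partial>M)\<^sup>2 \<le> L - S (r i)" if "i \<ge> R" for i
    proof -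
      have "(\<integral>x. (s (r i) x - h x) * e j x \<partial>M)\<^sup>2 \<le> (\<integral>x. (s (r i) x - h x)\<^sup>2 \<partial>M) * (\<integral>x. (e j x)\<^sup>2 \<partial>M)"
        by (rule L2_Cauchy_Schwarz[OF dL eL[OF j]])
      also have "(\<integral>x. (e j x)\<^sup>2 \<partial>M) = 1"
        using orthonormal_basisD(2)[OF e j j] by (simp add: power2_eq_square)
      finally show ?thesis using dn[of i] eq[OF that] by simp
    qed
    then have "(\<integral>x. (f x - h x) * e j x \<partial>M)\<^sup>2 \<le> 0"
      by (intro LIMSEQ_le_const[OF tr]) blast
    then show "(\<integral>x. (f x - h x) * e j x \<partial>M) = 0" by simp
  qed
  then have fh: "AE x in M. f x = h x" by simp
  \<comment> \<open>Since \<open>f = h\<close> almost everywhere, the Bessel defect of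
    \<open>f\<close> is a squared distance to \<open>h\<close>, already bounded by the tail;
    cancelling \<open>S (r i)\<close> bounds the norm by \<open>L\<close>.\<close>
  have "(\<integral>x. (f x)\<^sup>2 \<partial>M) - S (r i) \<le> L - S (r i)" for i
  proof -
    have "(\<integral>x. (f x)\<^sup>2 \<partial>M) - S (r i) = (\<integral>x. (f x - s (r i) x)\<^sup>2 \<partial>M)"
      unfolding S_def s_def c_def by (rule orthonormal_norm_diff_sum[OF e J(1,2) f, symmetric])
    also have "\<dots> = (\<integral>x. (s (r i) x - h x)\<^sup>2 \<partial>M)"
      using fh by (intro integral_cong_AE) (auto simp: power2_commute)
    finally show ?thesis using dn[of i] by simp
  qed
  then have "(\<integral>x. (f x)\<^sup>2 \<partial>M) \<le> L" by simp
  moreover have "L \<le> (\<integral>x. (f x)\<^sup>2 \<partial>M)"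
    by (rule LIMSEQ_le_const2[OF L(1)]) (use Sbound in auto)
  ultimately have "L = (\<integral>x. (f x)\<^sup>2 \<partial>M)" by simp
  with L(1) show ?thesis by (simp add: S_def[abs_def] c_def)
qed

section \<open>Laplace transforms and weak convergence\<close>

text \<open>In the variable \<open>u = exp (- t)\<close> the test functions become continuous functions on \<open>[0, 1]\<close>
  and are approximated by polynomials in \<open>u\<close>.\<close>

lemma weak_conv_m_if_laplace_converges:
  assumes \<mu>: "\<And>n. real_distribution (\<mu> n)" and \<mu>': "real_distribution \<mu>'"
    and nn: "\<And>n. AE x in \<mu> n. 0 \<le> x" "AE x in \<mu>'. 0 \<le> x"
    and lim: "\<And>p::nat. p > 0 \<Longrightarrow>
      (\<lambda>n. \<integral>x. exp (- (real p * x)) \<partial>\<mu> n) \<longlonglongrightarrow> (\<integral>x. exp (- (real p * x)) \<partial>\<mu>')"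
  shows "weak_conv_m \<mu> \<mu>'"
proof (rule integral_cts_step_conv_imp_weak_conv[OF \<mu> \<mu>'])
  fix x y :: real assume xy: "x < y"
  \<comment> \<open>The step function in the variable \<open>u = exp (- z)\<close>. The value 0 for
    \<open>u \<le> 0\<close> is the continuous extension, because \<open>cts_step x y\<close>
    vanishes from \<open>y\<close> on, that is for \<open>u\<close> below
    \<open>exp (- y)\<close>.\<close>
  define h where "h u = (if u \<le> 0 then 0 else cts_step x y (- ln u))" for u :: real
  have "isCont h u" for u
  proof (cases "u > 0")
    case True
    have "isCont (\<lambda>u. cts_step x y (- ln u)) u"
    proof (rule isCont_o2[where g = "cts_step x y"])
      show "isCont (\<lambda>u. - ln u) u" using True by (intro continuous_intros) simp
      show "isCont (cts_step x y) (- ln u)"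
        using uniformly_continuous_imp_continuous[OF cts_step_uniformly_continuous[OF xy]]
        by (simp add: continuous_on_eq_continuous_at)
    qed
    moreover have "\<forall>\<^sub>F w in nhds u. h w = cts_step x y (- ln w)"
      using eventually_nhds_in_open[of "{0<..}" u] True
      by (auto simp: h_def elim!: eventually_mono)
    ultimately show ?thesis using isCont_cong[of h "\<lambda>u. cts_step x y (- ln u)" u] by blast
  next
    case False
    have "h w = 0" if "w < exp (- y)" for w
    proof (cases "w \<le> 0")
      case False
      then have "ln w < - y" using that by (metis exp_less_cancel_iff exp_ln not_le)
      then show ?thesis using xy by (simp add: h_def cts_step_def)
    qed (simp add: h_def)
    moreover have "u < exp (- y)" using False by (meson exp_gt_zero le_less_trans not_le)
    ultimately have "\<forall>\<^sub>F w in nhds u. h w = 0"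
      using eventually_nhds_in_open[of "{..<exp (- y)}" u] by (auto elim!: eventually_mono)
    then have "isCont h u \<longleftrightarrow> isCont (\<lambda>w. 0::real) u" by (intro isCont_cong)
    then show ?thesis by simp
  qed
  then have h_cont: "continuous_on {0..1} h" by (simp add: continuous_at_imp_continuous_on)
  have h_exp: "h (exp (- z)) = cts_step x y z" for z by (simp add: h_def)
  show "(\<lambda>n. integral\<^sup>L (\<mu> n) (cts_step x y)) \<longlonglongrightarrow> integral\<^sup>L \<mu>' (cts_step x y)"
  proof (rule LIMSEQ_I)
    fix ep :: real assume "0 < ep"
    then have "ep / 3 > 0" by simp
    from Stone_Weierstrass_real_polynomial_function[OF compact_Icc h_cont this] obtain g
      where g: "real_polynomial_function g" "\<And>u. u \<in> {0..1} \<Longrightarrow> \<bar>h u - g u\<bar> < ep / 3" by blast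
    from g(1) obtain c d where cd: "g = (\<lambda>u. \<Sum>i\<le>d. c i * u ^ i)"
      unfolding real_polynomial_function_iff_sum by blast
    \<comment> \<open>A monomial in \<open>u\<close> is a Laplace integrand at an integer point,
      which is why convergence at natural numbers is enough.\<close>
    have g_exp: "g (exp (- z)) = (\<Sum>i\<le>d. c i * exp (- (real i * z)))" for z
      unfolding cd by (intro sum.cong refl) (metis exp_of_nat_mult mult_minus_right)
    have int_exp: "integrable \<rho> (\<lambda>z. exp (- (real i * z)))"
      if "real_distribution \<rho>" "AE z in \<rho>. 0 \<le> z" for \<rho> i
    proof -
      interpret real_distribution \<rho> by fact
      show ?thesis
      proof (rule integrable_const_bound[of _ 1])
        show "AE z in \<rho>. norm (exp (- (real i * z))) \<le> 1"
          using that(2) by eventually_elim simp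
      qed simp
    qed
    have near: "\<bar>(\<integral>z. cts_step x y z \<partial>\<rho>) - (\<Sum>i\<le>d. c i * (\<integral>z. exp (- (real i * z)) \<partial>\<rho>))\<bar> \<le> ep / 3"
      if \<rho>: "real_distribution \<rho>" "AE z in \<rho>. 0 \<le> z" for \<rho>
    proof -
      interpret real_distribution \<rho> by fact
      have int: "integrable \<rho> (\<lambda>z. g (exp (- z)))"
        unfolding g_exp using int_exp[OF \<rho>] by simp
      have "(\<integral>z. cts_step x y z \<partial>\<rho>) - (\<Sum>i\<le>d. c i * (\<integral>z. exp (- (real i * z)) \<partial>\<rho>))
        = (\<integral>z. cts_step x y z - g (exp (- z)) \<partial>\<rho>)"
        using int integrable_cts_step[OF xy] int_exp[OF \<rho>] unfolding g_exp by simp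
      also have "\<bar>\<dots>\<bar> \<le> (\<integral>z. \<bar>cts_step x y z - g (exp (- z))\<bar> \<partial>\<rho>)"
        by (rule integral_abs_bound)
      also have "\<dots> \<le> (\<integral>z. ep / 3 \<partial>\<rho>)"
      proof (rule integral_mono_AE)
        show "AE z in \<rho>. \<bar>cts_step x y z - g (exp (- z))\<bar> \<le> ep / 3"
          using \<rho>(2)
        proof eventually_elim
          case (elim z)
          then show ?case using g(2)[of "exp (- z)"] by (simp add: h_exp)
        qed
      qed (use int integrable_cts_step[OF xy] in auto)
      finally show ?thesis using prob_space by simp
    qed
    have "(\<lambda>n. \<Sum>i\<le>d. c i * (\<integral>z. exp (- (real i * z)) \<partial>\<mu> n))
        \<longlonglongrightarrow> (\<Sum>i\<le>d. c i * (\<integral>z. exp (- (real i * z)) \<partial>\<mu>'))"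
    proof (intro tendsto_intros)
      fix i
      show "(\<lambda>n. \<integral>z. exp (- (real i * z)) \<partial>\<mu> n) \<longlonglongrightarrow> (\<integral>z. exp (- (real i * z)) \<partial>\<mu>')"
      proof (cases "i = 0")
        \<comment> \<open>The constant term is the total mass, which \<open>lim\<close> does not
          cover.\<close>
        case True
        have "prob_space (\<mu> n)" for n using \<mu>[of n] by (simp add: real_distribution_def)
        moreover have "prob_space \<mu>'" using \<mu>' by (simp add: real_distribution_def)
        ultimately show ?thesis using True by (simp add: prob_space.prob_space)
      qed (simp add: lim)
    qed
    from LIMSEQ_D[OF this \<open>ep / 3 > 0\<close>] obtain N where N: "\<And>n. n \<ge> N \<Longrightarrow>
      \<bar>(\<Sum>i\<le>d. c i * (\<integral>z. exp (- (real i * z)) \<partial>\<mu> n)) - (\<Sum>i\<le>d. c i * (\<integral>z. exp (- (real i * z)) \<partial>\<mu>'))\<bar> < ep / 3"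
      unfolding real_norm_def by blast
    have "norm (integral\<^sup>L (\<mu> n) (cts_step x y) - integral\<^sup>L \<mu>' (cts_step x y)) < ep" if "n \<ge> N" for n
      using N[OF that] near[OF \<mu>[of n] nn(1)[of n]] near[OF \<mu>' nn(2)] unfolding real_norm_def by linarith
    then show "\<exists>N. \<forall>n\<ge>N. norm (integral\<^sup>L (\<mu> n) (cts_step x y) - integral\<^sup>L \<mu>' (cts_step x y)) < ep"
      by blast
  qed
qed

section \<open>Moments of Gaussian processes\<close>

lemma sets_normal_distribution [simp]: "sets (normal_distribution \<mu> \<sigma>) = sets borel"
  by (simp add: normal_distribution_def)

lemma prob_space_normal_distribution: "\<sigma> \<ge> 0 \<Longrightarrow> prob_space (normal_distribution \<mu> \<sigma>)"
  by (auto simp: normal_distribution_def intro: prob_space_return prob_space_normal_density)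

lemma integrable_normal_distribution_moment:
  assumes "\<sigma> \<ge> 0"
  shows "integrable (normal_distribution \<mu> \<sigma>) (\<lambda>x. (x - \<mu>) ^ k)"
proof (cases "\<sigma> = 0")
  case True
  interpret prob_space "return borel \<mu>" by (rule prob_space_return) simp
  have "integrable (return borel \<mu>) (\<lambda>x. (x - \<mu>) ^ k)"
    by (rule integrable_const_bound[of _ "\<bar>0 ^ k\<bar>"]) (auto simp: AE_return)
  then show ?thesis using True by (simp add: normal_distribution_def)
next
  case False
  then show ?thesis using assms integrable_normal_moment[of \<sigma> \<mu> k]
    by (simp add: normal_distribution_def integrable_density)
qed

lemma normal_distribution_mean:
  assumes "\<sigma> \<ge> 0"
  shows "(\<integral>x. x \<partial>normal_distribution \<mu> \<sigma>) = \<mu>"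
proof (cases "\<sigma> = 0")
  case True
  then show ?thesis by (simp add: normal_distribution_def integral_return)
next
  case False
  then show ?thesis using assms integral_normal_moment_nz_1[of \<sigma> \<mu>]
    by (simp add: normal_distribution_def integral_density)
qed

text \<open>The formula covers the point mass too: for \<open>\<sigma> = 0\<close> the convention
  \<open>x / 0 = 0\<close> makes the right-hand side 0 when \<open>k > 0\<close>.\<close>

lemma normal_distribution_even_moment:
  assumes "\<sigma> \<ge> 0" "k > 0"
  shows "(\<integral>x. (x - \<mu>) ^ (2 * k) \<partial>normal_distribution \<mu> \<sigma>) = fact (2 * k) / ((2 / \<sigma>\<^sup>2) ^ k * fact k)"
proof (cases "\<sigma> = 0")
  case True
  then show ?thesis using assms(2) by (simp add: normal_distribution_def integral_return zero_power)
next
  case False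
  then show ?thesis using assms integral_normal_moment_even[of \<sigma> \<mu> k]
    by (simp add: normal_distribution_def integral_density)
qed

text \<open>Being normal with unknown parameters suffices: the mean 0 fixes \<open>\<mu>\<close>,
  and \<open>\<sigma>\<close> enters only through the second moment, so the even moments are
  expressed by it. The factors are the double factorials 3 = 3 * 1 and 105 = 7 * 5 * 3 * 1.\<close>

lemma centred_gaussian_moments:
  fixes Z :: "'w \<Rightarrow> real"
  assumes [measurable]: "Z \<in> borel_measurable M"
    and Z: "distr M borel Z = normal_distribution \<mu> \<sigma>" "\<sigma> \<ge> 0"
    and mean: "(\<integral>\<omega>. Z \<omega> \<partial>M) = 0"
  shows "integrable M (\<lambda>\<omega>. Z \<omega> ^ k)"
    and "(\<integral>\<omega>. Z \<omega> ^ 4 \<partial>M) = 3 * (\<integral>\<omega>. (Z \<omega>)\<^sup>2 \<partial>M)\<^sup>2"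
    and "(\<integral>\<omega>. Z \<omega> ^ 8 \<partial>M) = 105 * (\<integral>\<omega>. (Z \<omega>)\<^sup>2 \<partial>M) ^ 4"
proof -
  have "(\<integral>\<omega>. Z \<omega> \<partial>M) = (\<integral>x. x \<partial>distr M borel Z)" by (simp add: integral_distr)
  then have [simp]: "\<mu> = 0" using Z mean normal_distribution_mean by simp
  have "integrable (distr M borel Z) (\<lambda>x. x ^ k)"
    unfolding Z(1) using integrable_normal_distribution_moment[OF Z(2), of 0 k] by simp
  then show "integrable M (\<lambda>\<omega>. Z \<omega> ^ k)" by (simp add: integrable_distr_eq)
  have mom: "(\<integral>\<omega>. Z \<omega> ^ (2 * j) \<partial>M) = fact (2 * j) / ((2 / \<sigma>\<^sup>2) ^ j * fact j)" if "j > 0" for j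
  proof -
    have "(\<integral>\<omega>. Z \<omega> ^ (2 * j) \<partial>M) = (\<integral>x. x ^ (2 * j) \<partial>distr M borel Z)"
      by (simp add: integral_distr)
    then show ?thesis
      unfolding Z(1) using normal_distribution_even_moment[OF Z(2) that, of 0] by simp
  qed
  show "(\<integral>\<omega>. Z \<omega> ^ 4 \<partial>M) = 3 * (\<integral>\<omega>. (Z \<omega>)\<^sup>2 \<partial>M)\<^sup>2"
    using mom[of 1] mom[of 2]
    by (cases "\<sigma> = 0") (simp_all add: fact_numeral field_simps power2_eq_square power4_eq_xxxx)
  show "(\<integral>\<omega>. Z \<omega> ^ 8 \<partial>M) = 105 * (\<integral>\<omega>. (Z \<omega>)\<^sup>2 \<partial>M) ^ 4"
    using mom[of 1] mom[of 4]
    by (cases "\<sigma> = 0") (simp_all add: fact_numeral field_simps eval_nat_numeral)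
qed

lemma has_mean_covD:
  assumes "has_mean_cov M T X m c"
  shows "t \<in> T \<Longrightarrow> L2 M (X t)" and "t \<in> T \<Longrightarrow> (\<integral>\<omega>. X t \<omega> \<partial>M) = m t"
    and "s \<in> T \<Longrightarrow> t \<in> T \<Longrightarrow> (\<integral>\<omega>. (X s \<omega> - m s) * (X t \<omega> - m t) \<partial>M) = c s t"
  using assms by (auto simp: has_mean_cov_def)

text \<open>The points \<open>t i\<close> need not be distinct, unlike in \<open>gaussian_process\<close>.\<close>

lemma gaussian_process_combination:
  assumes g: "gaussian_process M T X" and "finite I" "t ` I \<subseteq> T"
  shows "\<exists>\<mu> \<sigma>. \<sigma> \<ge> 0 \<and> distr M borel (\<lambda>\<omega>. \<Sum>i\<in>I. a i * X (t i) \<omega>) = normal_distribution \<mu> \<sigma>"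
proof -
  \<comment> \<open>Coefficients belonging to the same point are added up, which gives a combination
    over the set of points.\<close>
  have "(\<lambda>\<omega>. \<Sum>i\<in>I. a i * X (t i) \<omega>) = (\<lambda>\<omega>. \<Sum>s\<in>t ` I. (\<Sum>i\<in>{i \<in> I. t i = s}. a i) * X s \<omega>)"
    by (rule ext, subst sum.image_gen[OF \<open>finite I\<close>, of _ t]) (auto simp: sum_distrib_right intro!: sum.cong)
  moreover have "\<exists>\<mu> \<sigma>. \<sigma> \<ge> 0 \<and> distr M borel (\<lambda>\<omega>. \<Sum>s\<in>t ` I. (\<Sum>i\<in>{i \<in> I. t i = s}. a i) * X s \<omega>)
      = normal_distribution \<mu> \<sigma>"
    using g assms(2,3) unfolding gaussian_process_def by (elim conjE allE[of _ "t ` I"] allE) auto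
  ultimately show ?thesis by simp
qed

text \<open>Each fourth power carries the product of its three signs. Summing over the signs kills
  every monomial that is not odd in \<open>y\<close>, \<open>z\<close> and \<open>w\<close>; in
  degree four only \<open>x * y * z * w\<close> remains, with multinomial coefficient 24 in each of
  eight terms.\<close>

lemma polarization_power4:
  fixes x y z w :: real
  shows "(x + y + z + w) ^ 4 - (x + y + z - w) ^ 4 - (x + y - z + w) ^ 4 + (x + y - z - w) ^ 4
    - (x - y + z + w) ^ 4 + (x - y + z - w) ^ 4 + (x - y - z + w) ^ 4 - (x - y - z - w) ^ 4
    = 192 * (x * y * (z * w))"
  by (simp add: power4_eq_xxxx algebra_simps)

text \<open>The same signed sum for the fourth moment \<open>3 * V\<^sup>2\<close> of a centred
  Gaussian of variance \<open>V\<close>: \<open>D\<close> stands for the four variances,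
  \<open>a\<close> to \<open>f\<close> for the doubled covariances of the six pairs. Only products
  of complementary pairs survive, the three pairings of four variables.\<close>

lemma polarization_power2:
  fixes D :: real
  shows "3 * (D + a + b + c + d + e + f)\<^sup>2 - 3 * (D + a + b - c + d - e - f)\<^sup>2
    - 3 * (D + a - b + c - d + e - f)\<^sup>2 + 3 * (D + a - b - c - d - e + f)\<^sup>2
    - 3 * (D - a + b + c - d - e + f)\<^sup>2 + 3 * (D - a + b - c - d + e - f)\<^sup>2
    + 3 * (D - a - b + c + d - e - f)\<^sup>2 - 3 * (D - a - b - c + d + e + f)\<^sup>2
    = 48 * (a * f + b * e + c * d)"
  by (simp add: power2_eq_square algebra_simps)

locale centred_gaussian = prob_space M for M :: "'w measure" +
  fixes T :: "real set" and X :: "real \<Rightarrow> 'w \<Rightarrow> real" and c :: "real \<Rightarrow> real \<Rightarrow> real"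
  assumes gaussian: "gaussian_process M T X" and cov: "has_mean_cov M T X (\<lambda>_. 0) c"
begin

lemma X_L2: "t \<in> T \<Longrightarrow> L2 M (X t)"
  using has_mean_covD(1)[OF cov] .

lemma X_measurable: "t \<in> T \<Longrightarrow> X t \<in> borel_measurable M"
  by (rule L2_measurable[OF X_L2])

lemma X_mean: "t \<in> T \<Longrightarrow> (\<integral>\<omega>. X t \<omega> \<partial>M) = 0"
  using has_mean_covD(2)[OF cov] .

lemma X_cov: "s \<in> T \<Longrightarrow> t \<in> T \<Longrightarrow> (\<integral>\<omega>. X s \<omega> * X t \<omega> \<partial>M) = c s t"
  using has_mean_covD(3)[OF cov] by simp

lemma cov_sym: "s \<in> T \<Longrightarrow> t \<in> T \<Longrightarrow> c s t = c t s"
  using X_cov by (metis (no_types, lifting) Bochner_Integration.integral_cong mult.commute)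

lemma combination_moments:
  fixes a :: "'i \<Rightarrow> real" and t :: "'i \<Rightarrow> real"
  assumes "finite I" "t ` I \<subseteq> T"
  defines "Y \<equiv> \<lambda>\<omega>. \<Sum>i\<in>I. a i * X (t i) \<omega>"
  defines "V \<equiv> \<Sum>i\<in>I. \<Sum>j\<in>I. a i * a j * c (t i) (t j)"
  shows "integrable M (\<lambda>\<omega>. Y \<omega> ^ k)"
    and "(\<integral>\<omega>. Y \<omega> ^ 4 \<partial>M) = 3 * V\<^sup>2" and "(\<integral>\<omega>. Y \<omega> ^ 8 \<partial>M) = 105 * V ^ 4"
proof -
  have tT: "i \<in> I \<Longrightarrow> t i \<in> T" for i using assms(2) by auto
  have [measurable]: "Y \<in> borel_measurable M"
    unfolding Y_def using X_measurable[OF tT] by (intro borel_measurable_sum borel_measurable_times) auto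
  have mean: "(\<integral>\<omega>. Y \<omega> \<partial>M) = 0"
    unfolding Y_def using X_mean[OF tT] L2_integrable[OF X_L2[OF tT]]
    by (subst Bochner_Integration.integral_sum) auto
  have "(\<integral>\<omega>. (Y \<omega>)\<^sup>2 \<partial>M) = (\<integral>\<omega>. (\<Sum>i\<in>I. \<Sum>j\<in>I. a i * a j * (X (t i) \<omega> * X (t j) \<omega>)) \<partial>M)"
    unfolding Y_def power2_eq_square sum_product by (simp add: algebra_simps)
  also have "\<dots> = (\<Sum>i\<in>I. \<Sum>j\<in>I. a i * a j * (\<integral>\<omega>. X (t i) \<omega> * X (t j) \<omega> \<partial>M))"
    by (simp add: Bochner_Integration.integral_sum L2_mult_integrable X_L2 tT)
  also have "\<dots> = V"
    unfolding V_def using tT by (intro sum.cong refl) (simp add: X_cov)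
  finally have V: "(\<integral>\<omega>. (Y \<omega>)\<^sup>2 \<partial>M) = V" .
  obtain \<mu> \<sigma> where Y: "distr M borel Y = normal_distribution \<mu> \<sigma>" "\<sigma> \<ge> 0"
    using gaussian_process_combination[OF gaussian assms(1,2), of a] unfolding Y_def by blast
  note m = centred_gaussian_moments[OF _ Y mean, simplified V]
  show "integrable M (\<lambda>\<omega>. Y \<omega> ^ k)" "(\<integral>\<omega>. Y \<omega> ^ 4 \<partial>M) = 3 * V\<^sup>2" "(\<integral>\<omega>. Y \<omega> ^ 8 \<partial>M) = 105 * V ^ 4"
    by (rule m; measurable)+
qed

lemma X_power_integrable: "t \<in> T \<Longrightarrow> integrable M (\<lambda>\<omega>. X t \<omega> ^ k)"
  using combination_moments(1)[of "{0::nat}" "\<lambda>_. t" "\<lambda>_. 1" k] by simp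

lemma X_moment_8: "t \<in> T \<Longrightarrow> (\<integral>\<omega>. X t \<omega> ^ 8 \<partial>M) = 105 * c t t ^ 4"
  using combination_moments(3)[of "{0::nat}" "\<lambda>_. t" "\<lambda>_. 1"] by simp

text \<open>By polarization of the fourth moment of a linear combination.\<close>

lemma Isserlis:
  assumes T: "s \<in> T" "t \<in> T" "u \<in> T" "w \<in> T"
  shows "integrable M (\<lambda>\<omega>. X s \<omega> * X t \<omega> * (X u \<omega> * X w \<omega>))" (is ?int)
    and "(\<integral>\<omega>. X s \<omega> * X t \<omega> * (X u \<omega> * X w \<omega>) \<partial>M) = c s t * c u w + c s u * c t w + c s w * c t u"
      (is ?eq)
proof -
  define P where "P e f g \<omega> = (X s \<omega> + e * X t \<omega> + f * X u \<omega> + g * X w \<omega>) ^ 4" for e f g \<omega>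
  define V where "V e f g = c s s + e\<^sup>2 * c t t + f\<^sup>2 * c u u + g\<^sup>2 * c w w
     + 2 * e * c s t + 2 * f * c s u + 2 * g * c s w + 2 * e * f * c t u + 2 * e * g * c t w + 2 * f * g * c u w"
    for e f g
  note sym = cov_sym[OF T(2) T(1)] cov_sym[OF T(3) T(1)] cov_sym[OF T(4) T(1)]
    cov_sym[OF T(3) T(2)] cov_sym[OF T(4) T(2)] cov_sym[OF T(4) T(3)]
  have P: "integrable M (P e f g)" "(\<integral>\<omega>. P e f g \<omega> \<partial>M) = 3 * (V e f g)\<^sup>2" for e f g
  proof -
    define p where "p = (\<lambda>i::nat. [s, t, u, w] ! i)"
    define q where "q = (\<lambda>i::nat. [1, e, f, g] ! i)"
    have p: "p ` {..<4} \<subseteq> T" using T by (auto simp: p_def eval_nat_numeral less_Suc_eq)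
    have "(\<Sum>i<4. q i * X (p i) \<omega>) = X s \<omega> + e * X t \<omega> + f * X u \<omega> + g * X w \<omega>" for \<omega>
      by (simp add: p_def q_def eval_nat_numeral)
    moreover have "(\<Sum>i<4. \<Sum>j<4. q i * q j * c (p i) (p j)) = V e f g"
      by (simp add: p_def q_def eval_nat_numeral V_def sym algebra_simps)
    ultimately show "integrable M (P e f g)" "(\<integral>\<omega>. P e f g \<omega> \<partial>M) = 3 * (V e f g)\<^sup>2"
      using combination_moments(1,2)[OF finite_lessThan p, of q]
      unfolding P_def[abs_def] by simp_all
  qed
  have *: "X s \<omega> * X t \<omega> * (X u \<omega> * X w \<omega>) =
    (P 1 1 1 \<omega> - P 1 1 (-1) \<omega> - P 1 (-1) 1 \<omega> + P 1 (-1) (-1) \<omega>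
     - P (-1) 1 1 \<omega> + P (-1) 1 (-1) \<omega> + P (-1) (-1) 1 \<omega> - P (-1) (-1) (-1) \<omega>) / 192" for \<omega>
    using polarization_power4[of "X s \<omega>" "X t \<omega>" "X u \<omega>" "X w \<omega>"] unfolding P_def by simp
  show ?int unfolding * using P(1) by simp
  have "(\<integral>\<omega>. X s \<omega> * X t \<omega> * (X u \<omega> * X w \<omega>) \<partial>M) =
    (3 * (V 1 1 1)\<^sup>2 - 3 * (V 1 1 (-1))\<^sup>2 - 3 * (V 1 (-1) 1)\<^sup>2 + 3 * (V 1 (-1) (-1))\<^sup>2
     - 3 * (V (-1) 1 1)\<^sup>2 + 3 * (V (-1) 1 (-1))\<^sup>2 + 3 * (V (-1) (-1) 1)\<^sup>2 - 3 * (V (-1) (-1) (-1))\<^sup>2) / 192"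
    unfolding * using P by simp
  also have "\<dots> = c s t * c u w + c s u * c t w + c s w * c t u"
    using polarization_power2[of "c s s + c t t + c u u + c w w" "2 * c s t" "2 * c s u" "2 * c s w"
        "2 * c t u" "2 * c t w" "2 * c u w"]
    unfolding V_def by simp
  finally show ?eq .
qed

end

section \<open>Integrals of random fields\<close>

lemma pair_sigma_finite_finite: "finite_measure A \<Longrightarrow> finite_measure B \<Longrightarrow> pair_sigma_finite A B"
  by (simp add: pair_sigma_finite_def finite_measure.sigma_finite_measure)

text \<open>The pairing of a path with a test function. On paths for which the integrand is not
  integrable its value is 0, so it is defined on the whole sample space, while its algebraic
  properties are claimed almost surely.\<close>

definition field_integral :: "'x measure \<Rightarrow> ('x \<Rightarrow> 'w \<Rightarrow> real) \<Rightarrow> ('x \<Rightarrow> real) \<Rightarrow> 'w \<Rightarrow> real" where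
  "field_integral Q H f \<omega> = (\<integral>x. f x * H x \<omega> \<partial>Q)"

text \<open>One bound \<open>K\<close> on the fourth moments serves twice: it controls the error in
  the central limit theorem, and \<open>sqrt K\<close> bounds the variances and thereby the trace of
  \<open>\<kappa>\<close>.\<close>

locale random_field = Q: finite_measure Q + prob_space M for Q :: "'x measure" and M :: "'w measure" +
  fixes H :: "'x \<Rightarrow> 'w \<Rightarrow> real" and \<kappa> :: "'x \<Rightarrow> 'x \<Rightarrow> real" and K :: real
  assumes H_pair_measurable: "(\<lambda>(x, \<omega>). H x \<omega>) \<in> borel_measurable (Q \<Otimes>\<^sub>M M)"
    and H_power4_integrable: "x \<in> space Q \<Longrightarrow> integrable M (\<lambda>\<omega>. H x \<omega> ^ 4)"
    and H_power4_le: "x \<in> space Q \<Longrightarrow> (\<integral>\<omega>. H x \<omega> ^ 4 \<partial>M) \<le> K"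
    and H_mean: "x \<in> space Q \<Longrightarrow> (\<integral>\<omega>. H x \<omega> \<partial>M) = 0"
    and H_cov: "x \<in> space Q \<Longrightarrow> y \<in> space Q \<Longrightarrow> (\<integral>\<omega>. H x \<omega> * H y \<omega> \<partial>M) = \<kappa> x y"
begin

sublocale pair_sigma_finite Q M
  by (rule pair_sigma_finite_finite) (rule Q.finite_measure_axioms finite_measure_axioms)+

lemma H_measurable [measurable]: "x \<in> space Q \<Longrightarrow> H x \<in> borel_measurable M"
  using measurable_Pair2[OF H_pair_measurable] by simp

lemma H_measurable1: "\<omega> \<in> space M \<Longrightarrow> (\<lambda>x. H x \<omega>) \<in> borel_measurable Q"
  using measurable_Pair1[OF H_pair_measurable] by simp

lemma H_L2: assumes "x \<in> space Q" shows "L2 M (H x)" "L2 M (\<lambda>\<omega>. (H x \<omega>)\<^sup>2)"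
proof -
  show L: "L2 M (\<lambda>\<omega>. (H x \<omega>)\<^sup>2)"
    using H_power4_integrable[OF assms] H_measurable[OF assms] by (simp add: L2_def flip: power_mult)
  show "L2 M (H x)"
    using L2_integrable[OF L] H_measurable[OF assms] by (simp add: L2_def)
qed

lemma H_power2_le: assumes "x \<in> space Q" shows "(\<integral>\<omega>. (H x \<omega>)\<^sup>2 \<partial>M) \<le> sqrt K"
proof (rule real_le_rsqrt)
  have "(\<integral>\<omega>. (H x \<omega>)\<^sup>2 \<partial>M)\<^sup>2 \<le> (\<integral>\<omega>. ((H x \<omega>)\<^sup>2)\<^sup>2 \<partial>M)"
    using integral_power2_le[OF H_L2(2)[OF assms]] prob_space by simp
  also have "\<dots> \<le> K" using H_power4_le[OF assms] by (simp flip: power_mult)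
  finally show "(\<integral>\<omega>. (H x \<omega>)\<^sup>2 \<partial>M)\<^sup>2 \<le> K" .
qed

lemma integrable_power_pair:
  assumes "\<And>x. x \<in> space Q \<Longrightarrow> integrable M (\<lambda>\<omega>. H x \<omega> ^ (2 * k))"
    and "\<And>x. x \<in> space Q \<Longrightarrow> (\<integral>\<omega>. H x \<omega> ^ (2 * k) \<partial>M) \<le> D"
  shows "integrable (Q \<Otimes>\<^sub>M M) (\<lambda>(x, \<omega>). H x \<omega> ^ (2 * k))"
proof (rule Fubini_integrable)
  note [measurable] = H_pair_measurable
  show "(\<lambda>(x, \<omega>). H x \<omega> ^ (2 * k)) \<in> borel_measurable (Q \<Otimes>\<^sub>M M)" by measurable
  have "integrable Q (\<lambda>x. \<integral>\<omega>. H x \<omega> ^ (2 * k) \<partial>M)"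
  proof (rule Q.integrable_const_bound[of _ D])
    show "AE x in Q. norm (\<integral>\<omega>. H x \<omega> ^ (2 * k) \<partial>M) \<le> D"
      using assms(2) by (intro AE_I2) simp
  qed measurable
  then show "integrable Q (\<lambda>x. \<integral>\<omega>. norm (case (x, \<omega>) of (x, \<omega>) \<Rightarrow> H x \<omega> ^ (2 * k)) \<partial>M)"
    by simp
  show "AE x in Q. integrable M (\<lambda>\<omega>. case (x, \<omega>) of (x, \<omega>) \<Rightarrow> H x \<omega> ^ (2 * k))"
    using assms(1) by (intro AE_I2) simp
qed

lemma H_power4_pair: "integrable (Q \<Otimes>\<^sub>M M) (\<lambda>(x, \<omega>). H x \<omega> ^ 4)"
  using integrable_power_pair[of 2 K] H_power4_integrable H_power4_le by simp

lemma H_power2_pair: "integrable (Q \<Otimes>\<^sub>M M) (\<lambda>(x, \<omega>). (H x \<omega>)\<^sup>2)"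
  using integrable_power_pair[of 1 "sqrt K"] H_L2(1) H_power2_le by (simp add: L2_def)

lemma H_pair_L2: "L2 (Q \<Otimes>\<^sub>M M) (\<lambda>(x, \<omega>). H x \<omega>)"
  using H_power2_pair H_pair_measurable by (simp add: L2_def split_def)

lemma AE_paths: "AE \<omega> in M. L2 Q (\<lambda>x. H x \<omega>) \<and> L2 Q (\<lambda>x. (H x \<omega>)\<^sup>2)"
  using AE_integrable_snd[OF H_power4_pair] AE_integrable_snd[OF H_power2_pair] AE_space
proof eventually_elim
  case (elim \<omega>)
  then show ?case using H_measurable1[of \<omega>] by (simp add: L2_def flip: power_mult)
qed

text \<open>Expectation and integral over \<open>Q\<close> are interchanged. The expected energy of
  a path is the trace of \<open>\<kappa>\<close>, so the second bound is a trace estimate.\<close>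

lemma energy:
  shows "integrable M (\<lambda>\<omega>. \<integral>x. (H x \<omega>)\<^sup>2 \<partial>Q)"
    and "(\<integral>\<omega>. (\<integral>x. (H x \<omega>)\<^sup>2 \<partial>Q) \<partial>M) \<le> measure Q (space Q) * sqrt K"
    and "integrable M (\<lambda>\<omega>. \<integral>x. H x \<omega> ^ 4 \<partial>Q)"
    and "(\<integral>\<omega>. (\<integral>x. H x \<omega> ^ 4 \<partial>Q) \<partial>M) \<le> measure Q (space Q) * K"
proof -
  show "integrable M (\<lambda>\<omega>. \<integral>x. (H x \<omega>)\<^sup>2 \<partial>Q)" using integrable_snd[OF H_power2_pair] .
  show "integrable M (\<lambda>\<omega>. \<integral>x. H x \<omega> ^ 4 \<partial>Q)" using integrable_snd[OF H_power4_pair] .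
  have "(\<integral>\<omega>. (\<integral>x. (H x \<omega>)\<^sup>2 \<partial>Q) \<partial>M) = (\<integral>x. (\<integral>\<omega>. (H x \<omega>)\<^sup>2 \<partial>M) \<partial>Q)"
    using Fubini_integral[OF H_power2_pair] by simp
  also have "\<dots> \<le> (\<integral>x. sqrt K \<partial>Q)"
    using H_power2_le integrable_fst[OF H_power2_pair] by (intro integral_mono) auto
  finally show "(\<integral>\<omega>. (\<integral>x. (H x \<omega>)\<^sup>2 \<partial>Q) \<partial>M) \<le> measure Q (space Q) * sqrt K" by simp
  have "(\<integral>\<omega>. (\<integral>x. H x \<omega> ^ 4 \<partial>Q) \<partial>M) = (\<integral>x. (\<integral>\<omega>. H x \<omega> ^ 4 \<partial>M) \<partial>Q)"
    using Fubini_integral[OF H_power4_pair] by simp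
  also have "\<dots> \<le> (\<integral>x. K \<partial>Q)"
    using H_power4_le integrable_fst[OF H_power4_pair] by (intro integral_mono) auto
  finally show "(\<integral>\<omega>. (\<integral>x. H x \<omega> ^ 4 \<partial>Q) \<partial>M) \<le> measure Q (space Q) * K" by simp
qed

abbreviation \<xi> :: "('x \<Rightarrow> real) \<Rightarrow> 'w \<Rightarrow> real" where
  "\<xi> \<equiv> field_integral Q H"

lemma \<xi>_measurable [measurable]:
  assumes "L2 Q f" shows "\<xi> f \<in> borel_measurable M"
proof -
  note [measurable] = H_pair_measurable L2_measurable[OF assms]
  show ?thesis unfolding field_integral_def[abs_def] by measurable
qed

lemma \<xi>_power2_le:
  assumes "L2 Q f"
  shows "AE \<omega> in M. (\<xi> f \<omega>)\<^sup>2 \<le> (\<integral>x. (f x)\<^sup>2 \<partial>Q) * (\<integral>x. (H x \<omega>)\<^sup>2 \<partial>Q)"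
  using AE_paths by eventually_elim (simp add: field_integral_def L2_Cauchy_Schwarz[OF assms])

lemma \<xi>_L2: assumes "L2 Q f" shows "L2 M (\<xi> f)"
  unfolding L2_def
proof
  note [measurable] = \<xi>_measurable[OF assms]
  show "\<xi> f \<in> borel_measurable M" by measurable
  show "integrable M (\<lambda>\<omega>. (\<xi> f \<omega>)\<^sup>2)"
  proof (rule Bochner_Integration.integrable_bound)
    show "integrable M (\<lambda>\<omega>. (\<integral>x. (f x)\<^sup>2 \<partial>Q) * (\<integral>x. (H x \<omega>)\<^sup>2 \<partial>Q))" using energy(1) by simp
    show "AE \<omega> in M. norm ((\<xi> f \<omega>)\<^sup>2) \<le> norm ((\<integral>x. (f x)\<^sup>2 \<partial>Q) * (\<integral>x. (H x \<omega>)\<^sup>2 \<partial>Q))"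
      using \<xi>_power2_le[OF assms] by eventually_elim simp
  qed measurable
qed

text \<open>Cauchy--Schwarz twice: against \<open>f\<close> under the integral over
  \<open>Q\<close>, then against 1 to pass from the squared energy to the integral of the fourth
  powers.\<close>

lemma \<xi>_power4:
  assumes "L2 Q f"
  shows "integrable M (\<lambda>\<omega>. \<xi> f \<omega> ^ 4)"
    and "(\<integral>\<omega>. \<xi> f \<omega> ^ 4 \<partial>M) \<le> ((\<integral>x. (f x)\<^sup>2 \<partial>Q) * measure Q (space Q))\<^sup>2 * K"
proof -
  note [measurable] = \<xi>_measurable[OF assms]
  define m where "m = measure Q (space Q)"
  define A where "A = (\<integral>x. (f x)\<^sup>2 \<partial>Q)"
  have le: "AE \<omega> in M. \<xi> f \<omega> ^ 4 \<le> A\<^sup>2 * m * (\<integral>x. H x \<omega> ^ 4 \<partial>Q)"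
    using AE_paths \<xi>_power2_le[OF assms]
  proof eventually_elim
    case (elim \<omega>)
    have "\<xi> f \<omega> ^ 4 = ((\<xi> f \<omega>)\<^sup>2)\<^sup>2" by simp
    also have "\<dots> \<le> (A * (\<integral>x. (H x \<omega>)\<^sup>2 \<partial>Q))\<^sup>2"
      using elim(2) by (intro power_mono) (simp_all add: A_def)
    also have "\<dots> = A\<^sup>2 * (\<integral>x. (H x \<omega>)\<^sup>2 \<partial>Q)\<^sup>2" by (simp add: power_mult_distrib)
    also have "\<dots> \<le> A\<^sup>2 * (m * (\<integral>x. ((H x \<omega>)\<^sup>2)\<^sup>2 \<partial>Q))"
      unfolding m_def using elim(1) by (intro mult_left_mono Q.integral_power2_le) auto
    finally show ?case by (simp add: mult.assoc flip: power_mult)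
  qed
  have int: "integrable M (\<lambda>\<omega>. A\<^sup>2 * m * (\<integral>x. H x \<omega> ^ 4 \<partial>Q))" using energy(3) by simp
  show int4: "integrable M (\<lambda>\<omega>. \<xi> f \<omega> ^ 4)"
  proof (rule Bochner_Integration.integrable_bound[OF int])
    show "AE \<omega> in M. norm (\<xi> f \<omega> ^ 4) \<le> norm (A\<^sup>2 * m * (\<integral>x. H x \<omega> ^ 4 \<partial>Q))"
      using le by eventually_elim (simp add: power_abs[symmetric] abs_of_nonneg)
  qed measurable
  have "(\<integral>\<omega>. \<xi> f \<omega> ^ 4 \<partial>M) \<le> (\<integral>\<omega>. A\<^sup>2 * m * (\<integral>x. H x \<omega> ^ 4 \<partial>Q) \<partial>M)"
    by (rule integral_mono_AE[OF int4 int le])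
  also have "\<dots> = A\<^sup>2 * m * (\<integral>\<omega>. (\<integral>x. H x \<omega> ^ 4 \<partial>Q) \<partial>M)" by simp
  also have "\<dots> \<le> A\<^sup>2 * m * (m * K)"
    using energy(4) by (intro mult_left_mono) (simp_all add: m_def)
  finally show "(\<integral>\<omega>. \<xi> f \<omega> ^ 4 \<partial>M) \<le> (A * m)\<^sup>2 * K"
    by (simp add: power2_eq_square mult_ac)
qed

text \<open>The weight \<open>\<zeta>\<close> is arbitrary because several choices are needed: a
  constant for the mean, another coordinate for the covariance, and indicators and conditional
  probabilities for measurability in a sub-sigma-algebra.\<close>

lemma \<xi>_Fubini:
  assumes f: "L2 Q f" and \<zeta>: "L2 M \<zeta>"
  shows "(\<integral>\<omega>. \<zeta> \<omega> * \<xi> f \<omega> \<partial>M) = (\<integral>x. f x * (\<integral>\<omega>. \<zeta> \<omega> * H x \<omega> \<partial>M) \<partial>Q)"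
proof -
  note [measurable] = L2_measurable[OF f] L2_measurable[OF \<zeta>]
  \<comment> \<open>Square integrability of \<open>f x * \<zeta> \<omega>\<close> on the product
    space makes the integrand a product of two \<open>L2\<close> functions, hence
    integrable.\<close>
  have "integrable (Q \<Otimes>\<^sub>M M) (\<lambda>(x, \<omega>). (f x)\<^sup>2 * (\<zeta> \<omega>)\<^sup>2)"
  proof (rule Fubini_integrable)
    show "integrable Q (\<lambda>x. \<integral>\<omega>. norm (case (x, \<omega>) of (x, \<omega>) \<Rightarrow> (f x)\<^sup>2 * (\<zeta> \<omega>)\<^sup>2) \<partial>M)"
      using L2_power2_integrable[OF f] by (simp add: abs_mult)
  qed (use L2_power2_integrable[OF \<zeta>] in auto)
  then have "L2 (Q \<Otimes>\<^sub>M M) (\<lambda>(x, \<omega>). f x * \<zeta> \<omega>)"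
    by (simp add: L2_def split_def power_mult_distrib)
  from L2_mult_integrable[OF this H_pair_L2]
  have "integrable (Q \<Otimes>\<^sub>M M) (\<lambda>(x, \<omega>). f x * \<zeta> \<omega> * H x \<omega>)"
    by (simp add: split_def)
  from Fubini_integral[OF this]
  have "(\<integral>\<omega>. (\<integral>x. \<zeta> \<omega> * (f x * H x \<omega>) \<partial>Q) \<partial>M) = (\<integral>x. (\<integral>\<omega>. f x * (\<zeta> \<omega> * H x \<omega>) \<partial>M) \<partial>Q)"
    by (simp add: mult_ac)
  then show ?thesis by (simp add: field_integral_def)
qed

lemma \<xi>_mean: "L2 Q f \<Longrightarrow> (\<integral>\<omega>. \<xi> f \<omega> \<partial>M) = 0"
  using \<xi>_Fubini[of f "\<lambda>_. 1"] H_mean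
  by (simp add: L2_def Bochner_Integration.integral_cong[of Q Q _ "\<lambda>_. 0"])

lemma \<xi>_cov:
  assumes f: "L2 Q f" and g: "L2 Q g"
  shows "(\<integral>\<omega>. \<xi> f \<omega> * \<xi> g \<omega> \<partial>M) = (\<integral>x. g x * (\<integral>y. \<kappa> x y * f y \<partial>Q) \<partial>Q)"
proof -
  have "(\<integral>\<omega>. \<xi> f \<omega> * H x \<omega> \<partial>M) = (\<integral>y. \<kappa> x y * f y \<partial>Q)" if x: "x \<in> space Q" for x
  proof -
    have "(\<integral>\<omega>. \<xi> f \<omega> * H x \<omega> \<partial>M) = (\<integral>y. f y * (\<integral>\<omega>. H x \<omega> * H y \<omega> \<partial>M) \<partial>Q)"
      using \<xi>_Fubini[OF f H_L2(1)[OF x]] by (simp add: mult.commute)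
    also have "\<dots> = (\<integral>y. \<kappa> x y * f y \<partial>Q)"
      using x by (intro Bochner_Integration.integral_cong) (simp_all add: H_cov)
    finally show ?thesis .
  qed
  then show ?thesis
    unfolding \<xi>_Fubini[OF g \<xi>_L2[OF f]] by (intro Bochner_Integration.integral_cong) auto
qed

text \<open>Bessel's inequality for almost every path, then expectations. The diagonal sums of the
  covariance operator are thus bounded uniformly over orthonormal systems, without continuity of
  \<open>\<kappa>\<close>.\<close>

lemma \<xi>_Bessel:
  assumes e: "orthonormal_basis Q I e" and J: "J \<subseteq> I" "finite J"
  shows "(\<Sum>j\<in>J. (\<integral>\<omega>. (\<xi> (e j) \<omega>)\<^sup>2 \<partial>M)) \<le> measure Q (space Q) * sqrt K"
proof -
  have eL: "j \<in> J \<Longrightarrow> L2 Q (e j)" for j using J orthonormal_basisD(1)[OF e] by auto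
  have int: "j \<in> J \<Longrightarrow> integrable M (\<lambda>\<omega>. (\<xi> (e j) \<omega>)\<^sup>2)" for j
    by (rule L2_power2_integrable[OF \<xi>_L2[OF eL]])
  have "(\<Sum>j\<in>J. (\<integral>\<omega>. (\<xi> (e j) \<omega>)\<^sup>2 \<partial>M)) = (\<integral>\<omega>. (\<Sum>j\<in>J. (\<xi> (e j) \<omega>)\<^sup>2) \<partial>M)"
    using int by (simp add: Bochner_Integration.integral_sum)
  also have "\<dots> \<le> (\<integral>\<omega>. (\<integral>x. (H x \<omega>)\<^sup>2 \<partial>Q) \<partial>M)"
  proof (rule integral_mono_AE)
    show "AE \<omega> in M. (\<Sum>j\<in>J. (\<xi> (e j) \<omega>)\<^sup>2) \<le> (\<integral>x. (H x \<omega>)\<^sup>2 \<partial>Q)"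
      using AE_paths
    proof eventually_elim
      case (elim \<omega>)
      then show ?case using orthonormal_Bessel[OF e J, of "\<lambda>x. H x \<omega>"]
        by (simp add: field_integral_def mult.commute)
    qed
  qed (use int energy(1) in auto)
  also have "\<dots> \<le> measure Q (space Q) * sqrt K" by (rule energy(2))
  finally show ?thesis .
qed

text \<open>Joint measurability of the field does not make the integral a function of the coordinates
  pointwise, only almost surely: \<open>\<xi> f - E(\<xi> f | F)\<close> is orthogonal to every event by Fubini.\<close>

lemma \<xi>_eq_cond_exp:
  assumes f: "L2 Q f" and F: "subalgebra M F"
    and HF: "\<And>x. x \<in> space Q \<Longrightarrow> H x \<in> borel_measurable F"
  shows "AE \<omega> in M. \<xi> f \<omega> = real_cond_exp M F (\<xi> f) \<omega>"
proof -
  interpret F: finite_measure_subalgebra M F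
    by (simp add: finite_measure_subalgebra_def finite_measure_subalgebra_axioms_def F finite_measure_axioms)
  define \<eta> where "\<eta> = real_cond_exp M F (\<xi> f)"
  have \<xi>_int: "integrable M (\<xi> f)" by (rule L2_integrable[OF \<xi>_L2[OF f]])
  have \<eta>_int: "integrable M \<eta>" unfolding \<eta>_def by (rule F.real_cond_exp_int(1)[OF \<xi>_int])
  have [measurable]: "\<eta> \<in> borel_measurable F" unfolding \<eta>_def by (rule borel_measurable_cond_exp)
  note [measurable] = \<xi>_measurable[OF f]
  show ?thesis unfolding \<eta>_def[symmetric]
  proof (rule density_unique_real[OF \<xi>_int \<eta>_int])
    fix A assume A [measurable]: "A \<in> sets M"
    \<comment> \<open>The conditional probability of \<open>A\<close>. At each fixed
      \<open>x\<close> the field is measurable in \<open>F\<close>, so the indicator may be replaced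
      by \<open>p\<close>; Fubini carries this over to \<open>\<xi> f\<close>, and self-adjointness
      of conditional expectation turns the result into the integral of \<open>\<eta>\<close> over
      \<open>A\<close>.\<close>
    define p where "p = real_cond_exp M F (indicator A)"
    have iA: "integrable M (indicator A :: 'w \<Rightarrow> real)"
      by (simp add: emeasure_eq_measure)
    have p_F [measurable]: "p \<in> borel_measurable F" unfolding p_def by (rule borel_measurable_cond_exp)
    have p_M [measurable]: "p \<in> borel_measurable M" unfolding p_def by (rule borel_measurable_cond_exp2)
    have p01: "AE \<omega> in M. \<bar>p \<omega>\<bar> \<le> 1"
    proof -
      have "AE \<omega> in M. p \<omega> \<ge> 0" unfolding p_def by (rule F.real_cond_exp_ge_c[OF iA]) auto
      moreover have "AE \<omega> in M. p \<omega> \<le> 1" unfolding p_def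
        by (rule F.real_cond_exp_le_c[OF iA]) (auto split: split_indicator)
      ultimately show ?thesis by eventually_elim simp
    qed
    have pL: "L2 M p" unfolding L2_def
    proof
      show "integrable M (\<lambda>\<omega>. (p \<omega>)\<^sup>2)"
      proof (rule integrable_const_bound[of _ 1])
        show "AE \<omega> in M. norm ((p \<omega>)\<^sup>2) \<le> 1"
          using p01 by eventually_elim (simp add: abs_square_le_1)
      qed measurable
    qed measurable
    have iL: "L2 M (indicator A :: 'w \<Rightarrow> real)"
      by (rule L2_bounded[of _ 1]) (auto split: split_indicator)
    have "(\<integral>\<omega>. p \<omega> * \<xi> f \<omega> \<partial>M) = (\<integral>x. f x * (\<integral>\<omega>. p \<omega> * H x \<omega> \<partial>M) \<partial>Q)"
      by (rule \<xi>_Fubini[OF f pL])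
    also have "\<dots> = (\<integral>x. f x * (\<integral>\<omega>. indicator A \<omega> * H x \<omega> \<partial>M) \<partial>Q)"
    proof (intro Bochner_Integration.integral_cong refl)
      fix x assume x: "x \<in> space Q"
      have "(\<integral>\<omega>. H x \<omega> * p \<omega> \<partial>M) = (\<integral>\<omega>. H x \<omega> * indicator A \<omega> \<partial>M)"
        unfolding p_def using HF[OF x] L2_mult_integrable[OF H_L2(1)[OF x] iL]
        by (intro F.real_cond_exp_intg(2)) auto
      then show "f x * (\<integral>\<omega>. p \<omega> * H x \<omega> \<partial>M) = f x * (\<integral>\<omega>. indicator A \<omega> * H x \<omega> \<partial>M)"
        by (simp add: mult.commute)
    qed
    also have "\<dots> = (\<integral>\<omega>. indicator A \<omega> * \<xi> f \<omega> \<partial>M)"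
      by (rule \<xi>_Fubini[OF f iL, symmetric])
    finally have 1: "(\<integral>\<omega>. p \<omega> * \<xi> f \<omega> \<partial>M) = (\<integral>\<omega>. indicator A \<omega> * \<xi> f \<omega> \<partial>M)" .
    have pint: "integrable M (\<lambda>\<omega>. p \<omega> * \<xi> f \<omega>)" by (rule L2_mult_integrable[OF pL \<xi>_L2[OF f]])
    have 2: "(\<integral>\<omega>. p \<omega> * \<eta> \<omega> \<partial>M) = (\<integral>\<omega>. p \<omega> * \<xi> f \<omega> \<partial>M)"
      unfolding \<eta>_def by (rule F.real_cond_exp_intg(2)[OF pint]) measurable
    have "integrable M (\<lambda>\<omega>. \<eta> \<omega> * indicator A \<omega>)"
      using integrable_real_mult_indicator[OF A \<eta>_int] .
    then have 3: "(\<integral>\<omega>. \<eta> \<omega> * p \<omega> \<partial>M) = (\<integral>\<omega>. \<eta> \<omega> * indicator A \<omega> \<partial>M)"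
      unfolding p_def by (intro F.real_cond_exp_intg(2)) measurable
    show "(\<integral>\<omega>\<in>A. \<xi> f \<omega> \<partial>M) = (\<integral>\<omega>\<in>A. \<eta> \<omega> \<partial>M)"
      using 1 2 3 by (simp add: set_lebesgue_integral_def mult.commute)
  qed
qed

end

section \<open>Sums of independent random fields\<close>

text \<open>A Taylor bound compares with the quadratic polynomial, a second one compares that with
  the exponential. For \<open>s\<close> of the order of one over the root of the number of terms,
  both errors are of smaller order than one over that number and can be summed.\<close>

lemma (in prob_space) char_gaussian_approx:
  assumes X: "X \<in> borel_measurable M" "integrable M (\<lambda>\<omega>. X \<omega> ^ 4)" "(\<integral>\<omega>. X \<omega> \<partial>M) = 0"
    and L: "(\<integral>\<omega>. X \<omega> ^ 4 \<partial>M) \<le> L"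
  shows "cmod (char (distr M borel X) s - exp (- (s\<^sup>2 * (\<integral>\<omega>. (X \<omega>)\<^sup>2 \<partial>M) / 2))) \<le> \<bar>s\<bar> ^ 3 * (1 + L) + s ^ 4 * L"
proof -
  note [measurable] = X(1)
  define B where "B = (\<integral>\<omega>. (X \<omega>)\<^sup>2 \<partial>M)"
  have X2L: "L2 M (\<lambda>\<omega>. (X \<omega>)\<^sup>2)" using X(2) by (simp add: L2_def flip: power_mult)
  have X2: "integrable M (\<lambda>\<omega>. (X \<omega>)\<^sup>2)" by (rule L2_integrable[OF X2L])
  then have X1: "integrable M X" by (intro L2_integrable) (simp add: L2_def)
  have "B\<^sup>2 \<le> (\<integral>\<omega>. ((X \<omega>)\<^sup>2)\<^sup>2 \<partial>M)"
    using integral_power2_le[OF X2L] prob_space by (simp add: B_def)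
  also have "\<dots> \<le> L" using L by (simp flip: power_mult)
  finally have B2: "B\<^sup>2 \<le> L" .
  \<comment> \<open>The bound \<open>\<bar>x\<bar> ^ 3 \<le> 1 + x ^ 4\<close> removes the third
    absolute moment, so that a fourth-moment bound is all that enters.\<close>
  have le: "min (6 * x\<^sup>2) (\<bar>s\<bar> * \<bar>x\<bar> ^ 3) \<le> \<bar>s\<bar> * (1 + x ^ 4)" for x :: real
  proof -
    have "\<bar>x\<bar> ^ 3 \<le> 1 + x ^ 4"
    proof (cases "\<bar>x\<bar> \<le> 1")
      case True
      then have "\<bar>x\<bar> ^ 3 \<le> 1" by (simp add: power_le_one)
      moreover have "0 \<le> x ^ 4" by simp
      ultimately show ?thesis by linarith
    next
      case False
      then have "\<bar>x\<bar> ^ 3 \<le> \<bar>x\<bar> ^ 4" by (intro power_increasing) auto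
      then show ?thesis by simp
    qed
    then have "\<bar>s\<bar> * \<bar>x\<bar> ^ 3 \<le> \<bar>s\<bar> * (1 + x ^ 4)" by (intro mult_left_mono) auto
    then show ?thesis by simp
  qed
  have "cmod (char (distr M borel X) s - (1 - s\<^sup>2 * B / 2))
      \<le> (s\<^sup>2 / 6) * expectation (\<lambda>x. min (6 * (X x)\<^sup>2) (\<bar>s\<bar> * \<bar>X x\<bar> ^ 3))"
    by (rule char_approx3'[OF X(1) X1 X2 X(3) _ refl]) (simp add: B_def X(3))
  also have "\<dots> \<le> (s\<^sup>2 / 6) * expectation (\<lambda>x. \<bar>s\<bar> * (1 + X x ^ 4))"
  proof (intro mult_left_mono integral_mono)
    show "integrable M (\<lambda>x. min (6 * (X x)\<^sup>2) (\<bar>s\<bar> * \<bar>X x\<bar> ^ 3))"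
      by (rule Bochner_Integration.integrable_bound[of M "\<lambda>x. 6 * (X x)\<^sup>2"]) (use X2 in auto)
  qed (use X(2) le in auto)
  also have "\<dots> = (s\<^sup>2 / 6) * (\<bar>s\<bar> * (1 + (\<integral>\<omega>. X \<omega> ^ 4 \<partial>M)))"
    using X(2) prob_space by simp
  also have "\<dots> \<le> (s\<^sup>2 / 6) * (\<bar>s\<bar> * (1 + L))"
    using L by (intro mult_left_mono) auto
  also have "\<dots> = \<bar>s\<bar> ^ 3 * (1 + L) / 6"
    using power_add[of "\<bar>s\<bar>" 2 1] by simp
  also have "\<dots> \<le> \<bar>s\<bar> ^ 3 * (1 + L)"
  proof -
    have "0 \<le> L" using order_trans[OF zero_le_power2 B2] .
    then have "0 \<le> \<bar>s\<bar> ^ 3 * (1 + L)" by simp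
    then show ?thesis by linarith
  qed
  finally have 1: "cmod (char (distr M borel X) s - (1 - s\<^sup>2 * B / 2)) \<le> \<bar>s\<bar> ^ 3 * (1 + L)" .
  define u where "u = s\<^sup>2 * B / 2"
  have u0: "u \<ge> 0" by (simp add: u_def B_def)
  have "\<bar>(1 - u) - exp (- u)\<bar> \<le> u\<^sup>2"
  proof -
    have "1 - u \<le> exp (- u)" using exp_ge_add_one_self[of "- u"] by simp
    moreover have "exp (- u) \<le> 1 - u + u\<^sup>2"
    proof -
      have "1 + u \<le> exp u" by (rule exp_ge_add_one_self)
      then have "exp (- u) \<le> 1 / (1 + u)"
        using u0 by (simp add: exp_minus inverse_eq_divide frac_le)
      also have "\<dots> \<le> 1 - u + u\<^sup>2"
      proof (subst divide_le_eq, clarsimp simp: u0 add_pos_nonneg)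
        have "(1 - u + u\<^sup>2) * (1 + u) = 1 + u ^ 3"
          by (simp add: algebra_simps power2_eq_square power3_eq_cube)
        then show "1 \<le> (1 - u + u\<^sup>2) * (1 + u)" using u0 by simp
      qed
      finally show ?thesis .
    qed
    ultimately show ?thesis by simp
  qed
  also have "u\<^sup>2 \<le> s ^ 4 * L"
  proof -
    have "u\<^sup>2 = s ^ 4 * (B\<^sup>2 / 4)" by (simp add: u_def power_divide power_mult_distrib flip: power_mult)
    also have "\<dots> \<le> s ^ 4 * L" using order_trans[OF zero_le_power2 B2] B2 by (intro mult_left_mono) auto
    finally show ?thesis .
  qed
  finally have 2: "cmod (complex_of_real ((1 - u) - exp (- u))) \<le> s ^ 4 * L"
    by (simp only: norm_of_real)
  have "char (distr M borel X) s - complex_of_real (exp (- u))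
      = (char (distr M borel X) s - (1 - s\<^sup>2 * B / 2)) + complex_of_real ((1 - u) - exp (- u))"
    by (simp add: u_def)
  then have "cmod (char (distr M borel X) s - complex_of_real (exp (- u))) \<le> \<bar>s\<bar> ^ 3 * (1 + L) + s ^ 4 * L"
    using norm_triangle_le[OF add_mono[OF 1 2]] by (simp only:)
  then show ?thesis by (simp add: u_def B_def)
qed

text \<open>Independence of the sigma-algebras \<open>F p\<close> is what independence of paths in
  the product space provides. The fields are adapted at each fixed \<open>x\<close> only; nothing is
  assumed about measurability of their integrals in \<open>F p\<close>.\<close>

locale independent_fields = prob_space M for M :: "'w measure" +
  fixes Q :: "'x measure" and P :: "'p set" and H :: "'p \<Rightarrow> 'x \<Rightarrow> 'w \<Rightarrow> real"
    and \<kappa> :: "'p \<Rightarrow> 'x \<Rightarrow> 'x \<Rightarrow> real" and K :: real and F :: "'p \<Rightarrow> 'w measure"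
  assumes finite_P: "finite P"
    and fields: "p \<in> P \<Longrightarrow> random_field Q M (H p) (\<kappa> p) K"
    and subalgebras: "p \<in> P \<Longrightarrow> subalgebra M (F p)"
    and adapted: "p \<in> P \<Longrightarrow> x \<in> space Q \<Longrightarrow> H p x \<in> borel_measurable (F p)"
    and independent: "indep_sets (\<lambda>p. sets (F p)) P"
begin

abbreviation X :: "'p \<Rightarrow> ('x \<Rightarrow> real) \<Rightarrow> 'w \<Rightarrow> real" where
  "X p \<equiv> field_integral Q (H p)"

text \<open>A version of \<open>X p f\<close> that is measurable in \<open>F p\<close>, so that
  independence applies to it literally.\<close>

definition X' :: "'p \<Rightarrow> ('x \<Rightarrow> real) \<Rightarrow> 'w \<Rightarrow> real" where
  "X' p f = real_cond_exp M (F p) (X p f)"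

lemma X_eq_X': "p \<in> P \<Longrightarrow> L2 Q f \<Longrightarrow> AE \<omega> in M. X p f \<omega> = X' p f \<omega>"
  unfolding X'_def
  by (rule random_field.\<xi>_eq_cond_exp[OF fields]) (auto intro: subalgebras adapted)

lemma X'_measurable [measurable]: "X' p f \<in> borel_measurable M"
  unfolding X'_def by (rule borel_measurable_cond_exp2)

lemma X'_indep: "indep_vars (\<lambda>_. borel) (\<lambda>p. X' p (f p)) P"
  unfolding indep_vars_def2
proof (intro conjI ballI)
  show "indep_sets (\<lambda>p. {X' p (f p) -` A \<inter> space M |A. A \<in> sets borel}) P"
  proof (rule indep_sets_mono_sets[OF independent], clarify)
    fix p A assume "p \<in> P" and A: "A \<in> sets (borel :: real measure)"
    have "X' p (f p) \<in> borel_measurable (F p)" unfolding X'_def by (rule borel_measurable_cond_exp)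
    from measurable_sets[OF this A] show "X' p (f p) -` A \<inter> space M \<in> sets (F p)"
      using subalgebras[OF \<open>p \<in> P\<close>] by (simp add: subalgebra_def)
  qed
qed measurable

lemma expectation_mult_X:
  assumes "p \<in> P" "q \<in> P" "L2 Q f" "L2 Q g"
  shows "(\<integral>\<omega>. X p f \<omega> * X q g \<omega> \<partial>M) = (if p = q then \<integral>x. g x * (\<integral>y. \<kappa> p x y * f y \<partial>Q) \<partial>Q else 0)"
proof (cases "p = q")
  case True
  then show ?thesis using random_field.\<xi>_cov[OF fields[OF assms(1)] assms(3,4)] by simp
next
  case False
  interpret p: random_field Q M "H p" "\<kappa> p" K by (rule fields) fact
  interpret q: random_field Q M "H q" "\<kappa> q" K by (rule fields) fact
  \<comment> \<open>Indexing the two test functions by the field lets independence be applied to the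
    pair \<open>{p, q}\<close> as a family.\<close>
  define h where "h r = (if r = p then f else g)" for r
  have hL: "L2 Q (h r)" for r using assms by (simp add: h_def)
  have eq: "AE \<omega> in M. X r (h r) \<omega> = X' r (h r) \<omega>" if "r \<in> {p, q}" for r
    using X_eq_X'[OF _ hL] assms(1,2) that by auto
  have int: "integrable M (X' r (h r))" and mean: "(\<integral>\<omega>. X' r (h r) \<omega> \<partial>M) = 0" if "r \<in> {p, q}" for r
  proof -
    have rP: "r \<in> P" using that assms by auto
    interpret r: random_field Q M "H r" "\<kappa> r" K by (rule fields) fact
    have "integrable M (X r (h r))" by (rule L2_integrable[OF r.\<xi>_L2[OF hL]])
    then show "integrable M (X' r (h r))"
      using eq[OF that] r.\<xi>_measurable[OF hL] by (subst integrable_cong_AE[symmetric]) auto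
    have "(\<integral>\<omega>. X' r (h r) \<omega> \<partial>M) = (\<integral>\<omega>. X r (h r) \<omega> \<partial>M)"
      using eq[OF that] r.\<xi>_measurable[OF hL] by (intro integral_cong_AE) auto
    then show "(\<integral>\<omega>. X' r (h r) \<omega> \<partial>M) = 0" using r.\<xi>_mean[OF hL] by simp
  qed
  have ind: "indep_vars (\<lambda>_. borel) (\<lambda>r. X' r (h r)) {p, q}"
    by (rule indep_vars_subset[OF X'_indep]) (use assms in auto)
  have "(\<integral>\<omega>. (\<Prod>r\<in>{p, q}. X' r (h r) \<omega>) \<partial>M) = (\<Prod>r\<in>{p, q}. \<integral>\<omega>. X' r (h r) \<omega> \<partial>M)"
    by (rule indep_vars_lebesgue_integral[OF _ ind int]) auto
  then have "(\<integral>\<omega>. X' p (h p) \<omega> * X' q (h q) \<omega> \<partial>M) = 0"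
    using False mean[of p] by simp
  moreover have "(\<integral>\<omega>. X p f \<omega> * X q g \<omega> \<partial>M) = (\<integral>\<omega>. X' p (h p) \<omega> * X' q (h q) \<omega> \<partial>M)"
  proof (rule integral_cong_AE)
    show "AE \<omega> in M. X p f \<omega> * X q g \<omega> = X' p (h p) \<omega> * X' q (h q) \<omega>"
      using eq[of p] eq[of q] False by (auto simp: h_def)
  qed (use p.\<xi>_measurable[OF assms(3)] q.\<xi>_measurable[OF assms(4)] in auto)
  ultimately show ?thesis using False by simp
qed

lemma X_L2: "p \<in> P \<Longrightarrow> L2 Q f \<Longrightarrow> L2 M (X p f)"
  by (rule random_field.\<xi>_L2[OF fields])

lemma expectation_power2_sum:
  assumes "R \<subseteq> P" "L2 Q f"
  shows "(\<integral>\<omega>. (\<Sum>p\<in>R. X p f \<omega>)\<^sup>2 \<partial>M) = (\<Sum>p\<in>R. \<integral>\<omega>. (X p f \<omega>)\<^sup>2 \<partial>M)"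
proof -
  have fin: "finite R" using assms(1) finite_P finite_subset by blast
  have RP: "p \<in> R \<Longrightarrow> p \<in> P" for p using assms(1) by auto
  have "(\<integral>\<omega>. (\<Sum>p\<in>R. X p f \<omega>)\<^sup>2 \<partial>M) = (\<integral>\<omega>. (\<Sum>p\<in>R. \<Sum>q\<in>R. X p f \<omega> * X q f \<omega>) \<partial>M)"
    by (simp add: power2_eq_square sum_product)
  also have "\<dots> = (\<Sum>p\<in>R. \<Sum>q\<in>R. \<integral>\<omega>. X p f \<omega> * X q f \<omega> \<partial>M)"
    by (simp add: Bochner_Integration.integral_sum L2_mult_integrable X_L2 RP assms(2))
  also have "\<dots> = (\<Sum>p\<in>R. \<Sum>q\<in>R. if q = p then \<integral>\<omega>. (X p f \<omega>)\<^sup>2 \<partial>M else 0)"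
    using RP assms(2) expectation_mult_X[OF RP RP assms(2,2)]
    by (intro sum.cong refl) (auto simp: power2_eq_square)
  also have "\<dots> = (\<Sum>p\<in>R. \<integral>\<omega>. (X p f \<omega>)\<^sup>2 \<partial>M)" using fin by simp
  finally show ?thesis .
qed

text \<open>Characteristic functions of independent terms multiply, and products of complex numbers
  in the unit disc differ by at most the sum of the differences of their factors. Each
  \<open>p\<close> may have its own test function, since different samples carry different linear
  combinations.\<close>

lemma char_sum_approx:
  assumes f: "\<And>p. p \<in> P \<Longrightarrow> L2 Q (f p)"
    and L: "\<And>p. p \<in> P \<Longrightarrow> ((\<integral>x. (f p x)\<^sup>2 \<partial>Q) * measure Q (space Q))\<^sup>2 * K \<le> L"
  shows "cmod ((\<integral>\<omega>. iexp (\<Sum>p\<in>P. s p * X p (f p) \<omega>) \<partial>M)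
      - exp (- (\<Sum>p\<in>P. (s p)\<^sup>2 * (\<integral>\<omega>. (X p (f p) \<omega>)\<^sup>2 \<partial>M)) / 2))
    \<le> (\<Sum>p\<in>P. \<bar>s p\<bar> ^ 3 * (1 + L) + s p ^ 4 * L)"
proof -
  define Y where "Y p \<omega> = s p * X' p (f p) \<omega>" for p \<omega>
  have [measurable]: "Y p \<in> borel_measurable M" for p unfolding Y_def by measurable
  have X_meas: "p \<in> P \<Longrightarrow> X p (f p) \<in> borel_measurable M" for p
    by (rule L2_measurable[OF X_L2[OF _ f]])
  have ind: "indep_vars (\<lambda>_. borel) Y P"
    unfolding Y_def[abs_def] by (rule indep_vars_compose2[OF X'_indep]) auto
  have "(\<integral>\<omega>. iexp (\<Sum>p\<in>P. s p * X p (f p) \<omega>) \<partial>M) = (\<integral>\<omega>. iexp (\<Sum>p\<in>P. Y p \<omega>) \<partial>M)"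
  proof (rule integral_cong_AE)
    have "AE \<omega> in M. \<forall>p\<in>P. X p (f p) \<omega> = X' p (f p) \<omega>"
      using X_eq_X'[OF _ f] by (intro AE_finite_allI[OF finite_P]) auto
    then show "AE \<omega> in M. iexp (\<Sum>p\<in>P. s p * X p (f p) \<omega>) = iexp (\<Sum>p\<in>P. Y p \<omega>)"
      by eventually_elim (simp add: Y_def)
    have [measurable]: "(\<lambda>\<omega>. \<Sum>p\<in>P. s p * X p (f p) \<omega>) \<in> borel_measurable M"
      using X_meas by (intro borel_measurable_sum borel_measurable_times) auto
    show "(\<lambda>\<omega>. iexp (\<Sum>p\<in>P. s p * X p (f p) \<omega>)) \<in> borel_measurable M"
      by measurable
  qed measurable
  also have "\<dots> = char (distr M borel (\<lambda>\<omega>. \<Sum>p\<in>P. Y p \<omega>)) 1"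
    by (simp add: char_def integral_distr)
  also have "\<dots> = (\<Prod>p\<in>P. char (distr M borel (Y p)) 1)"
    by (rule char_distr_sum[OF ind])
  also have "\<dots> = (\<Prod>p\<in>P. char (distr M borel (X p (f p))) (s p))"
  proof (intro prod.cong refl)
    fix p assume p: "p \<in> P"
    have "char (distr M borel (Y p)) 1 = (\<integral>\<omega>. iexp (s p * X' p (f p) \<omega>) \<partial>M)"
      by (simp add: char_def integral_distr Y_def)
    also have "\<dots> = (\<integral>\<omega>. iexp (s p * X p (f p) \<omega>) \<partial>M)"
      using X_eq_X'[OF p f[OF p]] X_meas[OF p] by (intro integral_cong_AE) auto
    finally show "char (distr M borel (Y p)) 1 = char (distr M borel (X p (f p))) (s p)"
      using X_meas[OF p] by (simp add: char_def integral_distr)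
  qed
  finally have 1: "(\<integral>\<omega>. iexp (\<Sum>p\<in>P. s p * X p (f p) \<omega>) \<partial>M)
    = (\<Prod>p\<in>P. char (distr M borel (X p (f p))) (s p))" .
  have 2: "complex_of_real (exp (- (\<Sum>p\<in>P. (s p)\<^sup>2 * (\<integral>\<omega>. (X p (f p) \<omega>)\<^sup>2 \<partial>M)) / 2))
    = (\<Prod>p\<in>P. complex_of_real (exp (- ((s p)\<^sup>2 * (\<integral>\<omega>. (X p (f p) \<omega>)\<^sup>2 \<partial>M) / 2))))"
  proof -
    have "- (\<Sum>p\<in>P. (s p)\<^sup>2 * (\<integral>\<omega>. (X p (f p) \<omega>)\<^sup>2 \<partial>M)) / 2
      = (\<Sum>p\<in>P. - ((s p)\<^sup>2 * (\<integral>\<omega>. (X p (f p) \<omega>)\<^sup>2 \<partial>M) / 2))"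
      by (simp add: sum_negf sum_divide_distrib)
    then show ?thesis by (simp only: exp_sum[OF finite_P] of_real_prod)
  qed
  have "cmod ((\<Prod>p\<in>P. char (distr M borel (X p (f p))) (s p))
      - (\<Prod>p\<in>P. complex_of_real (exp (- ((s p)\<^sup>2 * (\<integral>\<omega>. (X p (f p) \<omega>)\<^sup>2 \<partial>M) / 2)))))
    \<le> (\<Sum>p\<in>P. cmod (char (distr M borel (X p (f p))) (s p)
        - complex_of_real (exp (- ((s p)\<^sup>2 * (\<integral>\<omega>. (X p (f p) \<omega>)\<^sup>2 \<partial>M) / 2)))))"
  proof (rule norm_prod_diff)
    fix p assume p: "p \<in> P"
    interpret d: real_distribution "distr M borel (X p (f p))"
      using X_meas[OF p] by (rule real_distribution_distr)
    show "cmod (char (distr M borel (X p (f p))) (s p)) \<le> 1" by (rule d.cmod_char_le_1)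
  qed simp
  also have "\<dots> \<le> (\<Sum>p\<in>P. \<bar>s p\<bar> ^ 3 * (1 + L) + s p ^ 4 * L)"
  proof (rule sum_mono)
    fix p assume p: "p \<in> P"
    interpret p: random_field Q M "H p" "\<kappa> p" K by (rule fields[OF p])
    show "cmod (char (distr M borel (X p (f p))) (s p)
        - complex_of_real (exp (- ((s p)\<^sup>2 * (\<integral>\<omega>. (X p (f p) \<omega>)\<^sup>2 \<partial>M) / 2))))
      \<le> \<bar>s p\<bar> ^ 3 * (1 + L) + s p ^ 4 * L"
      using char_gaussian_approx[OF X_meas[OF p] p.\<xi>_power4(1)[OF f[OF p]] p.\<xi>_mean[OF f[OF p]]
        order_trans[OF p.\<xi>_power4(2)[OF f[OF p]] L[OF p]], of "s p"] by simp
  qed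
  finally show ?thesis unfolding 1 2 .
qed

end

section \<open>Gaussian integrals\<close>

text \<open>Replacing \<open>x\<close> by \<open>c * x\<close> with
  \<open>c = sqrt (1 + 2 * w)\<close> absorbs the damping factor into the density and leaves the
  standard normal characteristic function at \<open>s / c\<close>.\<close>

lemma integral_gaussian_iexp:
  assumes "0 \<le> w"
  shows "(\<integral>g. exp (- (w * g\<^sup>2)) * iexp (s * g) \<partial>std_normal_distribution)
    = complex_of_real (exp (- (s\<^sup>2 / (2 * (1 + 2 * w)))) / sqrt (1 + 2 * w))"
proof -
  define c where "c = sqrt (1 + 2 * w)"
  have c: "c > 0" "c\<^sup>2 = 1 + 2 * w" using assms by (simp_all add: c_def)
  have dens: "std_normal_density (c * x) = std_normal_density x * exp (- (w * x\<^sup>2))" for x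
  proof -
    have "- ((c * x)\<^sup>2 / 2) = - (x\<^sup>2 / 2) + - (w * x\<^sup>2)"
      by (simp add: power_mult_distrib c(2) algebra_simps)
    then show ?thesis by (simp add: std_normal_density_def exp_add[symmetric])
  qed
  have "(\<integral>g. exp (- (w * g\<^sup>2)) * iexp (s * g) \<partial>std_normal_distribution)
    = (\<integral>x. std_normal_density x *\<^sub>R (exp (- (w * x\<^sup>2)) * iexp (s * x)) \<partial>lborel)"
    by (subst integral_density) auto
  also have "\<dots> = (\<integral>x. std_normal_density (c * x) *\<^sub>R iexp (s / c * (c * x)) \<partial>lborel)"
    using c(1) by (intro Bochner_Integration.integral_cong refl) (simp add: dens scaleR_conv_of_real)
  also have "\<dots> = (1 / c) *\<^sub>R (\<integral>x. std_normal_density x *\<^sub>R iexp (s / c * x) \<partial>lborel)"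
    using lborel_integral_real_affine[of c "\<lambda>x. std_normal_density x *\<^sub>R iexp (s / c * x)" 0] c(1)
    by simp
  also have "(\<integral>x. std_normal_density x *\<^sub>R iexp (s / c * x) \<partial>lborel) = char std_normal_distribution (s / c)"
    unfolding char_def by (subst integral_density) auto
  also have "\<dots> = complex_of_real (exp (- ((s / c)\<^sup>2) / 2))"
    by (simp add: char_std_normal_distribution)
  finally show ?thesis
    by (simp add: power_divide c(2) scaleR_conv_of_real flip: c_def)
qed

text \<open>Completing the square: density times damping factor is a constant multiple of the normal
  density with mean \<open>\<mu> / c\<^sup>2\<close> and standard deviation
  \<open>1 / c\<close>.\<close>

lemma integral_exp_square_normal:
  assumes "0 \<le> w"
  shows "(\<integral>z. exp (- (w * z\<^sup>2)) \<partial>normal_distribution \<mu> 1) = exp (- (w * \<mu>\<^sup>2 / (1 + 2 * w))) / sqrt (1 + 2 * w)"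
proof -
  define c where "c = sqrt (1 + 2 * w)"
  have c: "c > 0" "c\<^sup>2 = 1 + 2 * w" using assms by (simp_all add: c_def)
  have w: "w = (c\<^sup>2 - 1) / 2" using c(2) by simp
  have dens: "normal_density \<mu> 1 z * exp (- (w * z\<^sup>2))
    = exp (- (w * \<mu>\<^sup>2 / c\<^sup>2)) / c * normal_density (\<mu> / c\<^sup>2) (1 / c) z" for z
  proof -
    have "- ((z - \<mu>)\<^sup>2 / 2) + - (w * z\<^sup>2) = - (w * \<mu>\<^sup>2 / c\<^sup>2) + - ((z - \<mu> / c\<^sup>2)\<^sup>2 / (2 * (1 / c)\<^sup>2))"
      unfolding w using c(1) by (simp add: field_simps power2_eq_square)
    then have "exp (- ((z - \<mu>)\<^sup>2 / 2)) * exp (- (w * z\<^sup>2))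
        = exp (- (w * \<mu>\<^sup>2 / c\<^sup>2)) * exp (- ((z - \<mu> / c\<^sup>2)\<^sup>2 / (2 * (1 / c)\<^sup>2)))"
      unfolding exp_add[symmetric] by (rule arg_cong)
    then show ?thesis
      using c(1) unfolding normal_density_def
      by (simp add: real_sqrt_divide power_divide mult.assoc)
  qed
  have "(\<integral>z. exp (- (w * z\<^sup>2)) \<partial>normal_distribution \<mu> 1)
      = (\<integral>z. normal_density \<mu> 1 z * exp (- (w * z\<^sup>2)) \<partial>lborel)"
    unfolding normal_distribution_def by (simp add: integral_density)
  also have "\<dots> = exp (- (w * \<mu>\<^sup>2 / c\<^sup>2)) / c * (\<integral>z. normal_density (\<mu> / c\<^sup>2) (1 / c) z \<partial>lborel)"
    unfolding dens by simp
  also have "(\<integral>z. normal_density (\<mu> / c\<^sup>2) (1 / c) z \<partial>lborel) = 1"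
    using c(1) by simp
  finally show ?thesis by (simp add: c(2) flip: c_def)
qed

lemma noncentral_chi_square_laplace:
  assumes "0 \<le> w" "0 \<le> nc" "p > 0"
  shows "(\<integral>x. exp (- (w * x)) \<partial>noncentral_chi_square p nc)
    = exp (- (w * nc / (1 + 2 * w))) / sqrt (1 + 2 * w) ^ p"
proof -
  define \<nu> where "\<nu> l = normal_distribution (if l = 0 then sqrt nc else 0) 1" for l :: nat
  interpret \<nu>: prob_space "\<nu> l" for l unfolding \<nu>_def by (rule prob_space_normal_distribution) simp
  interpret product_prob_space \<nu> by (rule product_prob_spaceI) (rule \<nu>.prob_space_axioms)
  have [measurable_cong]: "sets (\<nu> l) = sets borel" for l by (simp add: \<nu>_def)
  have "(\<integral>x. exp (- (w * x)) \<partial>noncentral_chi_square p nc)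
      = (\<integral>z. exp (- (w * (\<Sum>l<p. (z l)\<^sup>2))) \<partial>PiM {..<p} \<nu>)"
    unfolding noncentral_chi_square_def \<nu>_def[symmetric, abs_def] by (subst integral_distr) auto
  also have "\<dots> = (\<integral>z. (\<Prod>l<p. exp (- (w * (z l)\<^sup>2))) \<partial>PiM {..<p} \<nu>)"
  proof -
    have "exp (- (w * (\<Sum>l<p. (z l)\<^sup>2))) = exp (\<Sum>l<p. - (w * (z l)\<^sup>2))" for z :: "nat \<Rightarrow> real"
      by (simp add: sum_distrib_left sum_negf)
    then show ?thesis by (simp only: exp_sum[OF finite_lessThan])
  qed
  also have "\<dots> = (\<Prod>l<p. \<integral>z. exp (- (w * z\<^sup>2)) \<partial>\<nu> l)"
  proof (rule product_integral_prod)
    show "integrable (\<nu> l) (\<lambda>z. exp (- (w * z\<^sup>2)))" for l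
      by (rule \<nu>.integrable_const_bound[of _ 1]) (use assms(1) in auto)
  qed simp
  also have "\<dots> = (\<Prod>l<p. exp (- (w * (if l = 0 then nc else 0) / (1 + 2 * w))) / sqrt (1 + 2 * w))"
    unfolding \<nu>_def using assms
    by (intro prod.cong refl) (simp add: integral_exp_square_normal)
  also have "\<dots> = (\<Prod>l<p. exp (- (w * (if l = 0 then nc else 0) / (1 + 2 * w)))) / sqrt (1 + 2 * w) ^ p"
    by (simp add: prod_dividef)
  \<comment> \<open>The hypothesis \<open>p > 0\<close> guarantees that coordinate 0, which carries
    the noncentrality, is present.\<close>
  also have "(\<Prod>l<p. exp (- (w * (if l = 0 then nc else 0) / (1 + 2 * w)))) = exp (- (w * nc / (1 + 2 * w)))"
    using assms(3) by (subst prod.remove[of _ 0]) auto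
  finally show ?thesis .
qed

lemma noncentral_chi_square_nonneg: "AE x in noncentral_chi_square p nc. 0 \<le> x"
proof -
  have [measurable_cong]: "sets (normal_distribution (if l = 0 then sqrt nc else 0) 1) = sets borel" for l :: nat
    by simp
  show ?thesis
    unfolding noncentral_chi_square_def by (subst AE_distr_iff) (auto intro!: sum_nonneg)
qed

text \<open>Stated for the nonnegative integral because it serves to bound the expectation of an
  infinite series of such variables before the series is known to converge.\<close>

lemma nn_integral_noncentral_chi_square:
  assumes "0 \<le> nc" "p > 0"
  shows "(\<integral>\<^sup>+x. ennreal x \<partial>noncentral_chi_square p nc) = ennreal (real p + nc)"
proof -
  define \<mu> where "\<mu> l = (if l = 0 then sqrt nc else 0)" for l :: nat
  define \<nu> where "\<nu> l = normal_distribution (\<mu> l) 1" for l :: nat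
  interpret \<nu>: prob_space "\<nu> l" for l unfolding \<nu>_def by (rule prob_space_normal_distribution) simp
  interpret product_prob_space \<nu> by (rule product_prob_spaceI) (rule \<nu>.prob_space_axioms)
  have [measurable_cong]: "sets (\<nu> l) = sets borel" for l by (simp add: \<nu>_def)
  have one: "(\<integral>\<^sup>+z. ennreal (z\<^sup>2) \<partial>\<nu> l) = ennreal (1 + (\<mu> l)\<^sup>2)" for l
  proof -
    have i2: "integrable (\<nu> l) (\<lambda>z. (z - \<mu> l)\<^sup>2)" and i1: "integrable (\<nu> l) (\<lambda>z. z - \<mu> l)"
      unfolding \<nu>_def using integrable_normal_distribution_moment[of 1 "\<mu> l" 2]
        integrable_normal_distribution_moment[of 1 "\<mu> l" 1] by auto
    have eq: "(\<lambda>z. z\<^sup>2) = (\<lambda>z. (z - \<mu> l)\<^sup>2 + 2 * \<mu> l * (z - \<mu> l) + (\<mu> l)\<^sup>2)"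
      by (rule ext) (simp add: power2_eq_square algebra_simps)
    have int: "integrable (\<nu> l) (\<lambda>z. z\<^sup>2)" by (subst eq) (use i1 i2 in simp)
    have iz: "integrable (\<nu> l) (\<lambda>z. z)" using Bochner_Integration.integrable_add[OF i1, of "\<lambda>_. \<mu> l"] by simp
    have "(\<integral>z. z - \<mu> l \<partial>\<nu> l) = 0"
    proof -
      have "(\<integral>z. z - \<mu> l \<partial>\<nu> l) = (\<integral>z. z \<partial>\<nu> l) - (\<integral>z. \<mu> l \<partial>\<nu> l)"
        by (rule Bochner_Integration.integral_diff[OF iz]) simp
      then show ?thesis
        using normal_distribution_mean[of 1 "\<mu> l"] \<nu>.prob_space[of l] unfolding \<nu>_def by simp
    qed
    moreover have "(\<integral>z. (z - \<mu> l)\<^sup>2 \<partial>\<nu> l) = 1"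
      unfolding \<nu>_def using normal_distribution_even_moment[of 1 1 "\<mu> l"] by simp
    ultimately have "(\<integral>z. z\<^sup>2 \<partial>\<nu> l) = 1 + (\<mu> l)\<^sup>2"
      by (subst eq) (use i1 i2 \<nu>.prob_space in simp)
    then show ?thesis using int by (simp add: nn_integral_eq_integral)
  qed
  have "(\<integral>\<^sup>+x. ennreal x \<partial>noncentral_chi_square p nc)
      = (\<integral>\<^sup>+z. ennreal (\<Sum>l<p. (z l)\<^sup>2) \<partial>PiM {..<p} \<nu>)"
    unfolding noncentral_chi_square_def \<nu>_def[symmetric, abs_def] \<mu>_def[symmetric]
    by (subst nn_integral_distr) auto
  also have "\<dots> = (\<integral>\<^sup>+z. (\<Sum>l<p. ennreal ((z l)\<^sup>2)) \<partial>PiM {..<p} \<nu>)"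
    by (simp add: sum_ennreal)
  also have "\<dots> = (\<Sum>l<p. \<integral>\<^sup>+z. ennreal ((z l)\<^sup>2) \<partial>PiM {..<p} \<nu>)"
    by (rule nn_integral_sum) auto
  also have "\<dots> = (\<Sum>l<p. \<integral>\<^sup>+z. ennreal (z\<^sup>2) \<partial>\<nu> l)"
  proof (rule sum.cong[OF refl])
    fix l assume "l \<in> {..<p}"
    then have "distr (PiM {..<p} \<nu>) (\<nu> l) (\<lambda>z. z l) = \<nu> l" using \<nu>.prob_space_axioms by (intro distr_PiM_component) auto
    then have "(\<integral>\<^sup>+z. ennreal (z\<^sup>2) \<partial>\<nu> l) = (\<integral>\<^sup>+z. ennreal (z\<^sup>2) \<partial>distr (PiM {..<p} \<nu>) (\<nu> l) (\<lambda>z. z l))"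
      by simp
    also have "\<dots> = (\<integral>\<^sup>+z. ennreal ((z l)\<^sup>2) \<partial>PiM {..<p} \<nu>)"
      using \<open>l \<in> {..<p}\<close> by (subst nn_integral_distr) auto
    finally show "(\<integral>\<^sup>+z. ennreal ((z l)\<^sup>2) \<partial>PiM {..<p} \<nu>) = (\<integral>\<^sup>+z. ennreal (z\<^sup>2) \<partial>\<nu> l)" by simp
  qed
  also have "\<dots> = ennreal (\<Sum>l<p. 1 + (\<mu> l)\<^sup>2)"
    unfolding one by (rule sum_ennreal) simp
  also have "(\<Sum>l<p. 1 + (\<mu> l)\<^sup>2) = real p + nc"
    using assms by (subst sum.remove[of _ 0]) (auto simp: \<mu>_def of_nat_diff)
  finally show ?thesis .
qed

text \<open>A Gaussian randomization (Hubbard--Stratonovich) linearizes the quadratic form.\<close>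

lemma exp_sum_squares_eq_integral:
  assumes "finite A" "0 \<le> \<theta>"
  shows "complex_of_real (exp (- (\<theta> * (\<Sum>p\<in>A. (q p)\<^sup>2))))
    = (\<integral>g. iexp (sqrt (2 * \<theta>) * (\<Sum>p\<in>A. g p * q p)) \<partial>PiM A (\<lambda>_. std_normal_distribution))"
proof -
  interpret std: prob_space std_normal_distribution by (rule prob_space_normal_density) simp
  interpret product_prob_space "\<lambda>_. std_normal_distribution"
    by (rule product_prob_spaceI) (rule std.prob_space_axioms)
  have "(\<integral>g. iexp (sqrt (2 * \<theta>) * (\<Sum>p\<in>A. g p * q p)) \<partial>PiM A (\<lambda>_. std_normal_distribution))
    = (\<integral>g. (\<Prod>p\<in>A. iexp ((sqrt (2 * \<theta>) * q p) * g p)) \<partial>PiM A (\<lambda>_. std_normal_distribution))"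
  proof -
    have "iexp (sqrt (2 * \<theta>) * (\<Sum>p\<in>A. g p * q p)) = exp (\<Sum>p\<in>A. \<i> * ((sqrt (2 * \<theta>) * q p) * g p))" for g
      by (simp add: sum_distrib_left mult_ac)
    then show ?thesis by (simp only: exp_sum[OF assms(1)])
  qed
  also have "\<dots> = (\<Prod>p\<in>A. char std_normal_distribution (sqrt (2 * \<theta>) * q p))"
    unfolding char_def by (rule product_integral_prod[OF assms(1)]) (rule std.integrable_iexp, simp_all del: of_real_mult)
  also have "\<dots> = (\<Prod>p\<in>A. complex_of_real (exp (- (\<theta> * (q p)\<^sup>2))))"
    using assms(2) by (simp add: char_std_normal_distribution power_mult_distrib)
  also have "\<dots> = complex_of_real (exp (\<Sum>p\<in>A. - (\<theta> * (q p)\<^sup>2)))"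
    by (simp only: exp_sum[OF assms(1)] of_real_prod)
  finally show ?thesis by (simp add: sum_distrib_left sum_negf)
qed

section \<open>Limits of quadratic forms\<close>

text \<open>After the Gaussian randomization the hypothesis gives convergence for each fixed
  \<open>g\<close>, and all integrands have modulus at most 1, so dominated convergence over
  \<open>g\<close> applies. The limit is again a product of one-dimensional Gaussian integrals; no
  limiting random vector is constructed, and \<open>lam p = 0\<close> is allowed.\<close>

lemma laplace_quadratic_tendsto:
  fixes M :: "nat \<Rightarrow> 'w measure" and V :: "nat \<Rightarrow> 'p \<Rightarrow> 'w \<Rightarrow> real"
  assumes M: "\<And>\<nu>. prob_space (M \<nu>)" and A: "finite A" and \<theta>: "0 \<le> \<theta>"
    and V: "\<And>\<nu> p. p \<in> A \<Longrightarrow> V \<nu> p \<in> borel_measurable (M \<nu>)"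
    and lam: "\<And>p. p \<in> A \<Longrightarrow> 0 \<le> lam p"
    and conv: "\<And>g. (\<lambda>\<nu>. \<integral>\<omega>. iexp (\<Sum>p\<in>A. g p * V \<nu> p \<omega>) \<partial>M \<nu>)
      \<longlonglongrightarrow> complex_of_real (exp (- ((\<Sum>p\<in>A. (g p)\<^sup>2 * lam p) / 2))) * iexp (\<Sum>p\<in>A. g p * \<mu> p)"
  shows "(\<lambda>\<nu>. \<integral>\<omega>. exp (- (\<theta> * (\<Sum>p\<in>A. (V \<nu> p \<omega>)\<^sup>2))) \<partial>M \<nu>)
    \<longlonglongrightarrow> (\<Prod>p\<in>A. exp (- (\<theta> * (\<mu> p)\<^sup>2 / (1 + 2 * \<theta> * lam p))) / sqrt (1 + 2 * \<theta> * lam p))"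
proof -
  define G where "G = PiM A (\<lambda>_. std_normal_distribution)"
  \<comment> \<open>With this scale the Gaussian characteristic function at \<open>c * q\<close> is
    \<open>exp (- (\<theta> * q\<^sup>2))\<close>.\<close>
  define c where "c = sqrt (2 * \<theta>)"
  have c2: "c\<^sup>2 = 2 * \<theta>" using \<theta> by (simp add: c_def)
  interpret std: prob_space std_normal_distribution by (rule prob_space_normal_density) simp
  interpret pr: product_prob_space "\<lambda>_. std_normal_distribution"
    by (rule product_prob_spaceI) (rule std.prob_space_axioms)
  interpret G: prob_space G unfolding G_def by (rule prob_space_PiM) (rule std.prob_space_axioms)
  have comp [measurable]: "(\<lambda>g. g p) \<in> borel_measurable G" if "p \<in> A" for p
    using measurable_component_singleton[OF that, of "\<lambda>_. std_normal_distribution"]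
    by (simp add: G_def measurable_cong_sets[OF refl, of std_normal_distribution borel])
  define \<Phi> where "\<Phi> \<nu> g = (\<integral>\<omega>. iexp (c * (\<Sum>p\<in>A. g p * V \<nu> p \<omega>)) \<partial>M \<nu>)" for \<nu> g
  have meas: "(\<lambda>(\<omega>, g). iexp (c * (\<Sum>p\<in>A. g p * V \<nu> p \<omega>))) \<in> borel_measurable (M \<nu> \<Otimes>\<^sub>M G)" for \<nu>
  proof -
    have "(\<lambda>x. g' x * V \<nu> p (fst x)) \<in> borel_measurable (M \<nu> \<Otimes>\<^sub>M G)"
      if p: "p \<in> A" and g': "g' = (\<lambda>x. snd x p)" for p g'
    proof -
      have "(\<lambda>x. V \<nu> p (fst x)) \<in> borel_measurable (M \<nu> \<Otimes>\<^sub>M G)"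
        by (rule measurable_compose[OF measurable_fst V[OF p]])
      moreover have "g' \<in> borel_measurable (M \<nu> \<Otimes>\<^sub>M G)"
        unfolding g' by (rule measurable_compose[OF measurable_snd comp[OF p]])
      ultimately show ?thesis by measurable
    qed
    then have [measurable]: "(\<lambda>x. \<Sum>p\<in>A. snd x p * V \<nu> p (fst x)) \<in> borel_measurable (M \<nu> \<Otimes>\<^sub>M G)"
      by (intro borel_measurable_sum) auto
    show ?thesis unfolding split_def by measurable
  qed
  have eq: "complex_of_real (\<integral>\<omega>. exp (- (\<theta> * (\<Sum>p\<in>A. (V \<nu> p \<omega>)\<^sup>2))) \<partial>M \<nu>) = (\<integral>g. \<Phi> \<nu> g \<partial>G)" for \<nu>
  proof -
    interpret M: prob_space "M \<nu>" by (rule M)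
    interpret pair: pair_prob_space "M \<nu>" G by unfold_locales
    have "integrable (M \<nu> \<Otimes>\<^sub>M G) (\<lambda>(\<omega>, g). iexp (c * (\<Sum>p\<in>A. g p * V \<nu> p \<omega>)))"
      by (rule pair.P.integrable_const_bound[OF _ meas, of 1]) (auto simp: split_def)
    from pair.Fubini_integral[OF this]
    have "(\<integral>g. \<Phi> \<nu> g \<partial>G) = (\<integral>\<omega>. (\<integral>g. iexp (c * (\<Sum>p\<in>A. g p * V \<nu> p \<omega>)) \<partial>G) \<partial>M \<nu>)"
      by (simp add: \<Phi>_def)
    also have "\<dots> = (\<integral>\<omega>. complex_of_real (exp (- (\<theta> * (\<Sum>p\<in>A. (V \<nu> p \<omega>)\<^sup>2)))) \<partial>M \<nu>)"
      unfolding exp_sum_squares_eq_integral[OF A \<theta>] G_def c_def ..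
    finally show ?thesis by simp
  qed
  define \<Psi> where "\<Psi> g = (\<Prod>p\<in>A. complex_of_real (exp (- (\<theta> * lam p * (g p)\<^sup>2))) * iexp (c * \<mu> p * g p))" for g
  have "(\<lambda>\<nu>. \<Phi> \<nu> g) \<longlonglongrightarrow> \<Psi> g" for g
  proof -
    have 1: "iexp (\<Sum>p\<in>A. (c * g p) * V \<nu> p \<omega>) = iexp (c * (\<Sum>p\<in>A. g p * V \<nu> p \<omega>))" for \<nu> \<omega>
      by (simp add: sum_distrib_left mult.assoc)
    have "- ((\<Sum>p\<in>A. (c * g p)\<^sup>2 * lam p) / 2) = (\<Sum>p\<in>A. - (\<theta> * lam p * (g p)\<^sup>2))"
      by (simp add: power_mult_distrib c2 sum_negf sum_divide_distrib mult_ac)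
    then have 2: "complex_of_real (exp (- ((\<Sum>p\<in>A. (c * g p)\<^sup>2 * lam p) / 2)))
        = (\<Prod>p\<in>A. complex_of_real (exp (- (\<theta> * lam p * (g p)\<^sup>2))))"
      by (simp only: exp_sum[OF A] of_real_prod)
    have "\<i> * complex_of_real (\<Sum>p\<in>A. (c * g p) * \<mu> p) = (\<Sum>p\<in>A. \<i> * complex_of_real (c * \<mu> p * g p))"
      by (simp add: sum_distrib_left mult_ac)
    then have 3: "iexp (\<Sum>p\<in>A. (c * g p) * \<mu> p) = (\<Prod>p\<in>A. iexp (c * \<mu> p * g p))"
      by (simp only: exp_sum[OF A])
    show ?thesis
      using conv[of "\<lambda>p. c * g p"] unfolding \<Phi>_def \<Psi>_def 1 2 3 prod.distrib .
  qed
  moreover have "\<Phi> \<nu> \<in> borel_measurable G" for \<nu>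
  proof -
    interpret M: prob_space "M \<nu>" by (rule M)
    interpret pair: pair_prob_space "M \<nu>" G by unfold_locales
    have "(\<lambda>(g, \<omega>). iexp (c * (\<Sum>p\<in>A. g p * V \<nu> p \<omega>))) \<in> borel_measurable (G \<Otimes>\<^sub>M M \<nu>)"
      using measurable_compose[OF measurable_pair_swap' meas[of \<nu>]] by (simp add: split_def)
    then show ?thesis
      unfolding \<Phi>_def[abs_def] by (rule M.borel_measurable_lebesgue_integral)
  qed
  moreover have "cmod (\<Phi> \<nu> g) \<le> 1" for \<nu> g
  proof -
    interpret M: prob_space "M \<nu>" by (rule M)
    have "cmod (\<Phi> \<nu> g) \<le> (\<integral>\<omega>. cmod (iexp (c * (\<Sum>p\<in>A. g p * V \<nu> p \<omega>))) \<partial>M \<nu>)"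
      unfolding \<Phi>_def by (rule integral_norm_bound)
    then show ?thesis using M.prob_space by simp
  qed
  moreover have "\<Psi> \<in> borel_measurable G"
    unfolding \<Psi>_def[abs_def] by (intro borel_measurable_prod) measurable
  ultimately have "(\<lambda>\<nu>. \<integral>g. \<Phi> \<nu> g \<partial>G) \<longlonglongrightarrow> (\<integral>g. \<Psi> g \<partial>G)"
    by (intro integral_dominated_convergence[where w = "\<lambda>_. 1"]) auto
  moreover have "(\<integral>g. \<Psi> g \<partial>G) = (\<Prod>p\<in>A. complex_of_real
      (exp (- (\<theta> * (\<mu> p)\<^sup>2 / (1 + 2 * \<theta> * lam p))) / sqrt (1 + 2 * \<theta> * lam p)))"
  proof -
    have "(\<integral>g. \<Psi> g \<partial>G) = (\<Prod>p\<in>A. \<integral>x. complex_of_real (exp (- (\<theta> * lam p * x\<^sup>2))) * iexp (c * \<mu> p * x)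
        \<partial>std_normal_distribution)"
      unfolding \<Psi>_def G_def
    proof (rule pr.product_integral_prod[OF A])
      fix p assume p: "p \<in> A"
      show "integrable std_normal_distribution (\<lambda>x. complex_of_real (exp (- (\<theta> * lam p * x\<^sup>2))) * iexp (c * \<mu> p * x))"
        by (rule std.integrable_const_bound[of _ 1]) (use \<theta> lam[OF p] in \<open>auto simp: norm_mult\<close>)
    qed
    also have "\<dots> = (\<Prod>p\<in>A. complex_of_real
      (exp (- (\<theta> * (\<mu> p)\<^sup>2 / (1 + 2 * \<theta> * lam p))) / sqrt (1 + 2 * \<theta> * lam p)))"
    proof (intro prod.cong refl)
      fix p assume p: "p \<in> A"
      have "0 \<le> \<theta> * lam p" using \<theta> lam[OF p] by simp
      have "(c * \<mu> p)\<^sup>2 = 2 * (\<theta> * (\<mu> p)\<^sup>2)" by (simp add: power_mult_distrib c2)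
      then have e: "(c * \<mu> p)\<^sup>2 / (2 * (1 + 2 * (\<theta> * lam p))) = \<theta> * (\<mu> p)\<^sup>2 / (1 + 2 * (\<theta> * lam p))"
        by (simp only: mult_divide_mult_cancel_left_if) simp
      from integral_gaussian_iexp[OF \<open>0 \<le> \<theta> * lam p\<close>, of "c * \<mu> p"]
      show "(\<integral>x. complex_of_real (exp (- (\<theta> * lam p * x\<^sup>2))) * iexp (c * \<mu> p * x) \<partial>std_normal_distribution)
        = complex_of_real (exp (- (\<theta> * (\<mu> p)\<^sup>2 / (1 + 2 * \<theta> * lam p))) / sqrt (1 + 2 * \<theta> * lam p))"
        unfolding e by (simp add: mult.assoc)
    qed
    finally show ?thesis .
  qed
  ultimately show ?thesis
    unfolding eq[symmetric] by (simp only: tendsto_of_real_iff flip: of_real_prod)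
qed

text \<open>Lipschitz in the norm and not in its square: comparing two quadratic forms then costs
  only a first moment of the distance of the vectors. The constant comes from
  \<open>u \<le> exp (u\<^sup>2 / 2)\<close> at
  \<open>u = sqrt (2 * \<theta>) * \<bar>z\<bar>\<close>.\<close>

lemma exp_neg_square_Lipschitz:
  fixes x y \<theta> :: real
  assumes "0 \<le> \<theta>"
  shows "\<bar>exp (- (\<theta> * x\<^sup>2)) - exp (- (\<theta> * y\<^sup>2))\<bar> \<le> sqrt (2 * \<theta>) * \<bar>x - y\<bar>"
proof -
  have deriv: "\<bar>2 * \<theta> * z * exp (- (\<theta> * z\<^sup>2))\<bar> \<le> sqrt (2 * \<theta>)" for z
  proof -
    define u where "u = sqrt (2 * \<theta>) * \<bar>z\<bar>"
    have u2: "u\<^sup>2 = 2 * (\<theta> * z\<^sup>2)" using assms by (simp add: u_def power_mult_distrib)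
    have "u \<le> 1 + u\<^sup>2 / 2"
    proof -
      have "0 \<le> (u - 1)\<^sup>2" by simp
      then have "2 * u \<le> u\<^sup>2 + 1" unfolding power2_diff by simp
      moreover have "0 \<le> u\<^sup>2" by simp
      ultimately show ?thesis by linarith
    qed
    also have "\<dots> \<le> exp (u\<^sup>2 / 2)" by (rule exp_ge_add_one_self)
    finally have "u * exp (- (u\<^sup>2 / 2)) \<le> 1" by (simp add: exp_minus field_simps)
    then have "sqrt (2 * \<theta>) * (u * exp (- (\<theta> * z\<^sup>2))) \<le> sqrt (2 * \<theta>) * 1"
      using assms by (intro mult_left_mono) (simp_all add: u2)
    moreover have "\<bar>2 * \<theta> * z * exp (- (\<theta> * z\<^sup>2))\<bar> = sqrt (2 * \<theta>) * (u * exp (- (\<theta> * z\<^sup>2)))"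
    proof -
      have "2 * \<theta> = sqrt (2 * \<theta>) * sqrt (2 * \<theta>)" using assms by simp
      then show ?thesis using assms by (simp add: u_def abs_mult)
    qed
    ultimately show ?thesis by simp
  qed
  have "norm (exp (- (\<theta> * x\<^sup>2)) - exp (- (\<theta> * y\<^sup>2))) \<le> sqrt (2 * \<theta>) * norm (x - y)"
  proof (rule field_differentiable_bound[of UNIV "\<lambda>z. exp (- (\<theta> * z\<^sup>2))" "\<lambda>z. - (2 * \<theta> * z * exp (- (\<theta> * z\<^sup>2)))"])
    fix z :: real
    show "((\<lambda>z. exp (- (\<theta> * z\<^sup>2))) has_field_derivative - (2 * \<theta> * z * exp (- (\<theta> * z\<^sup>2)))) (at z within UNIV)"
      by (auto intro!: derivative_eq_intros)
    show "norm (- (2 * \<theta> * z * exp (- (\<theta> * z\<^sup>2)))) \<le> sqrt (2 * \<theta>)" using deriv[of z] by simp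
  qed auto
  then show ?thesis by simp
qed

text \<open>Only expectations of the remainder norms are controlled, not those of their squares.
  Since differences of Laplace integrands never exceed 1, squares can be traded for first powers:
  either the sum of the \<open>a i\<close> is at least 1 and the bound is trivial, or every
  \<open>a i\<close> is at most 1.\<close>

lemma min_1_sum_squares_le:
  fixes a :: "'b \<Rightarrow> real"
  assumes "0 \<le> x" "\<And>i. i \<in> A \<Longrightarrow> 0 \<le> a i" "finite A"
  shows "min 1 (x + (\<Sum>i\<in>A. (a i)\<^sup>2)) \<le> x + (\<Sum>i\<in>A. a i)"
proof (cases "(\<Sum>i\<in>A. a i) \<ge> 1")
  case False
  have "(a i)\<^sup>2 \<le> a i" if "i \<in> A" for i
  proof -
    have "a i \<le> (\<Sum>i\<in>A. a i)" by (rule member_le_sum) (use assms that in auto)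
    then have "a i \<le> 1" using False by simp
    then show ?thesis using assms(2)[OF that] by (simp add: power2_eq_square mult_left_le)
  qed
  then have "(\<Sum>i\<in>A. (a i)\<^sup>2) \<le> (\<Sum>i\<in>A. a i)" by (rule sum_mono)
  then show ?thesis by simp
qed (use assms in simp)

text \<open>Pythagoras for the projection along the unit vector \<open>b\<close>; in particular the
  residual is never longer than \<open>x\<close>.\<close>

lemma sum_squares_residual:
  fixes x b :: "'b \<Rightarrow> real"
  assumes "(\<Sum>i\<in>A. (b i)\<^sup>2) = 1"
  shows "(\<Sum>i\<in>A. (x i - b i * (\<Sum>j\<in>A. b j * x j))\<^sup>2) = (\<Sum>i\<in>A. (x i)\<^sup>2) - (\<Sum>j\<in>A. b j * x j)\<^sup>2"
proof -
  define s where "s = (\<Sum>j\<in>A. b j * x j)"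
  have "(\<Sum>i\<in>A. (x i - b i * s)\<^sup>2) = (\<Sum>i\<in>A. (x i)\<^sup>2 - 2 * s * (b i * x i) + s\<^sup>2 * (b i)\<^sup>2)"
    by (simp add: power2_eq_square algebra_simps)
  also have "\<dots> = (\<Sum>i\<in>A. (x i)\<^sup>2) - 2 * s * s + s\<^sup>2"
    using assms by (simp add: sum.distrib sum_subtractf s_def flip: sum_distrib_left)
  finally show ?thesis by (simp add: s_def power2_eq_square)
qed

lemma exp_neg_diff_le: "0 \<le> x \<Longrightarrow> x \<le> y \<Longrightarrow> \<bar>exp (- y) - exp (- x :: real)\<bar> \<le> min 1 (y - x)"
proof -
  assume xy: "0 \<le> x" "x \<le> y"
  have "exp (- x) - exp (- y) = exp (- x) * (1 - exp (- (y - x)))"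
    by (simp add: right_diff_distrib flip: exp_add)
  also have "\<dots> \<le> 1 * (1 - exp (- (y - x)))"
    using xy by (intro mult_right_mono) auto
  also have "\<dots> \<le> y - x"
  proof -
    have "1 - (y - x) \<le> exp (- (y - x))" by (rule exp_minus_ge)
    then show ?thesis by (simp only: mult_1_left)
  qed
  finally have "exp (- x) - exp (- y) \<le> y - x" .
  moreover have "exp (- x) - exp (- y) \<le> 1"
    using xy by (smt (verit) exp_gt_zero exp_le_one_iff)
  moreover have "exp (- y) \<le> exp (- x)" using xy by simp
  ultimately show ?thesis by simp
qed

text \<open>\<open>S\<close> are the coordinates of the random fluctuations, \<open>D\<close> those of the drift, \<open>E\<close> those of a
  remainder of norm at most \<open>sqrt 2 * \<rho>\<close>. The vectors \<open>b \<nu>\<close> and \<open>\<beta>\<close> are the unit normals of the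
  projections, and the rows of \<open>u\<close> are an orthonormal basis of the complement of \<open>\<beta>\<close>.\<close>

locale quadratic_limit =
  fixes M :: "nat \<Rightarrow> 'w measure" and k :: nat and J :: "nat \<Rightarrow> 'i set"
    and S E :: "nat \<Rightarrow> nat \<Rightarrow> 'i \<Rightarrow> 'w \<Rightarrow> real" and \<rho> :: "nat \<Rightarrow> nat \<Rightarrow> 'w \<Rightarrow> real"
    and D :: "nat \<Rightarrow> 'i \<Rightarrow> real" and b :: "nat \<Rightarrow> nat \<Rightarrow> real" and \<beta> :: "nat \<Rightarrow> real"
    and T :: "nat \<Rightarrow> 'w \<Rightarrow> real" and lam :: "'i \<Rightarrow> real" and tl :: "nat \<Rightarrow> real" and c0 :: real
    and u :: "nat \<Rightarrow> nat \<Rightarrow> real"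
  assumes M: "prob_space (M \<nu>)"
    and finite_J: "finite (J R)" and incseq_J: "incseq J"
    and S_L2: "i < k \<Longrightarrow> r \<in> (\<Union>R. J R) \<Longrightarrow> L2 (M \<nu>) (S \<nu> i r)"
    and E_meas: "i < k \<Longrightarrow> r \<in> (\<Union>R. J R) \<Longrightarrow> E \<nu> i r \<in> borel_measurable (M \<nu>)"
    and \<rho>_int: "i < k \<Longrightarrow> integrable (M \<nu>) (\<rho> \<nu> i)"
    and \<rho>_nonneg: "i < k \<Longrightarrow> 0 \<le> \<rho> \<nu> i \<omega>"
    and T_meas: "T \<nu> \<in> borel_measurable (M \<nu>)"
    and T_lim: "AE \<omega> in M \<nu>. (\<lambda>R. \<Sum>r\<in>J R. \<Sum>i<k. (S \<nu> i r \<omega> + D i r + E \<nu> i r \<omega>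
        - b \<nu> i * (\<Sum>j<k. b \<nu> j * (S \<nu> j r \<omega> + D j r + E \<nu> j r \<omega>)))\<^sup>2) \<longlonglongrightarrow> T \<nu> \<omega>"
    and E_le: "i < k \<Longrightarrow> AE \<omega> in M \<nu>. \<forall>R. (\<Sum>r\<in>J R. (E \<nu> i r \<omega>)\<^sup>2) \<le> 2 * (\<rho> \<nu> i \<omega>)\<^sup>2"
    and \<rho>_lim: "i < k \<Longrightarrow> (\<lambda>\<nu>. \<integral>\<omega>. \<rho> \<nu> i \<omega> \<partial>M \<nu>) \<longlonglongrightarrow> 0"
    and tail: "R \<le> R' \<Longrightarrow> (\<Sum>r\<in>J R' - J R. \<Sum>i<k. (\<integral>\<omega>. (S \<nu> i r \<omega>)\<^sup>2 \<partial>M \<nu>) + (D i r)\<^sup>2) \<le> tl R"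
    and tl: "tl \<longlonglongrightarrow> 0"
    and S_le: "i < k \<Longrightarrow> r \<in> (\<Union>R. J R) \<Longrightarrow> (\<integral>\<omega>. (S \<nu> i r \<omega>)\<^sup>2 \<partial>M \<nu>) \<le> c0"
    and char_lim: "\<And>R c. (\<lambda>\<nu>. \<integral>\<omega>. iexp (\<Sum>i<k. \<Sum>r\<in>J R. c i r * S \<nu> i r \<omega>) \<partial>M \<nu>)
        \<longlonglongrightarrow> complex_of_real (exp (- ((\<Sum>i<k. \<Sum>r\<in>J R. (c i r)\<^sup>2 * lam r) / 2)))"
    and b_norm: "(\<Sum>i<k. (b \<nu> i)\<^sup>2) = 1"
    and b_lim: "i < k \<Longrightarrow> (\<lambda>\<nu>. b \<nu> i) \<longlonglongrightarrow> \<beta> i"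
    and projection: "\<And>x. (\<Sum>i<k. (x i - \<beta> i * (\<Sum>j<k. \<beta> j * x j))\<^sup>2) = (\<Sum>l<k - 1. (\<Sum>i<k. u l i * x i)\<^sup>2)"
    and orthonormal: "l < k - 1 \<Longrightarrow> l' < k - 1 \<Longrightarrow> (\<Sum>i<k. u l i * u l' i) = (if l = l' then 1 else 0)"
    and lam_nonneg: "r \<in> (\<Union>R. J R) \<Longrightarrow> 0 \<le> lam r"
begin

section \<open>Coordinates of the statistic and their idealized counterparts\<close>

definition Z where "Z \<nu> i r \<omega> = S \<nu> i r \<omega> + D i r + E \<nu> i r \<omega>"
definition Y where "Y \<nu> i r \<omega> = Z \<nu> i r \<omega> - b \<nu> i * (\<Sum>j<k. b \<nu> j * Z \<nu> j r \<omega>)"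
definition TR where "TR \<nu> R \<omega> = (\<Sum>r\<in>J R. \<Sum>i<k. (Y \<nu> i r \<omega>)\<^sup>2)"
text \<open>Idealized coordinates, without remainder; in \<open>Y'\<close> the limiting normal also
  replaces that of the finite sample. Only this limiting projection is described by the fixed rows
  \<open>u\<close>.\<close>

definition Z' where "Z' \<nu> i r \<omega> = S \<nu> i r \<omega> + D i r"
definition Y' where "Y' \<nu> i r \<omega> = Z' \<nu> i r \<omega> - \<beta> i * (\<Sum>j<k. \<beta> j * Z' \<nu> j r \<omega>)"

lemma T_lim': "AE \<omega> in M \<nu>. (\<lambda>R. TR \<nu> R \<omega>) \<longlonglongrightarrow> T \<nu> \<omega>"
  using T_lim unfolding TR_def Y_def Z_def .

lemma S_meas: "i < k \<Longrightarrow> r \<in> J R \<Longrightarrow> S \<nu> i r \<in> borel_measurable (M \<nu>)"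
  using L2_measurable[OF S_L2] by auto

lemma Z_meas: "i < k \<Longrightarrow> r \<in> J R \<Longrightarrow> Z \<nu> i r \<in> borel_measurable (M \<nu>)"
  unfolding Z_def[abs_def]
  by (intro borel_measurable_add borel_measurable_const S_meas E_meas) auto

lemma Z'_meas: "i < k \<Longrightarrow> r \<in> J R \<Longrightarrow> Z' \<nu> i r \<in> borel_measurable (M \<nu>)"
  unfolding Z'_def[abs_def] using S_meas by (intro borel_measurable_add) auto

lemma Y_meas: "i < k \<Longrightarrow> r \<in> J R \<Longrightarrow> Y \<nu> i r \<in> borel_measurable (M \<nu>)"
  unfolding Y_def[abs_def]
  by (intro borel_measurable_diff borel_measurable_times borel_measurable_sum borel_measurable_const Z_meas) auto

lemma Y'_meas: "i < k \<Longrightarrow> r \<in> J R \<Longrightarrow> Y' \<nu> i r \<in> borel_measurable (M \<nu>)"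
  unfolding Y'_def[abs_def]
  by (intro borel_measurable_diff borel_measurable_times borel_measurable_sum borel_measurable_const Z'_meas) auto

lemma TR_meas: "TR \<nu> R \<in> borel_measurable (M \<nu>)"
  unfolding TR_def[abs_def] by (intro borel_measurable_sum borel_measurable_power Y_meas) auto

lemma TR_nonneg: "0 \<le> TR \<nu> R \<omega>"
  unfolding TR_def by (intro sum_nonneg) auto

text \<open>By \<open>projection\<close> the residual is a sum of squares of \<open>k - 1\<close>
  linear forms with orthonormal rows \<open>u\<close>. Their limiting covariance is
  \<open>lam r\<close> times the identity, so the factors over \<open>l\<close> share the variance
  and differ only in their means.\<close>

lemma truncated_main_term:
  assumes \<theta>: "0 \<le> \<theta>"
  shows "(\<lambda>\<nu>. \<integral>\<omega>. exp (- (\<theta> * (\<Sum>r\<in>J R. \<Sum>i<k. (Y' \<nu> i r \<omega>)\<^sup>2))) \<partial>M \<nu>)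
    \<longlonglongrightarrow> (\<Prod>r\<in>J R. \<Prod>l<k - 1. exp (- (\<theta> * (\<Sum>i<k. u l i * D i r)\<^sup>2 / (1 + 2 * \<theta> * lam r))) / sqrt (1 + 2 * \<theta> * lam r))"
proof -
  define A where "A = J R \<times> {..<k - 1}"
  define V where "V \<nu> p \<omega> = (\<Sum>i<k. u (snd p) i * Z' \<nu> i (fst p) \<omega>)" for \<nu> p \<omega>
  define \<mu> where "\<mu> p = (\<Sum>i<k. u (snd p) i * D i (fst p))" for p
  have A: "finite A" using finite_J by (simp add: A_def)
  have sumA: "(\<Sum>p\<in>A. f (fst p) (snd p)) = (\<Sum>r\<in>J R. \<Sum>l<k - 1. f r l)" for f :: "'i \<Rightarrow> nat \<Rightarrow> real"
    unfolding A_def by (simp add: sum.cartesian_product split_def)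
  have prodA: "(\<Prod>p\<in>A. f (fst p) (snd p)) = (\<Prod>r\<in>J R. \<Prod>l<k - 1. f r l)" for f :: "'i \<Rightarrow> nat \<Rightarrow> real"
    unfolding A_def by (simp add: prod.cartesian_product split_def)
  have "(\<lambda>\<nu>. \<integral>\<omega>. exp (- (\<theta> * (\<Sum>p\<in>A. (V \<nu> p \<omega>)\<^sup>2))) \<partial>M \<nu>)
    \<longlonglongrightarrow> (\<Prod>p\<in>A. exp (- (\<theta> * (\<mu> p)\<^sup>2 / (1 + 2 * \<theta> * lam (fst p)))) / sqrt (1 + 2 * \<theta> * lam (fst p)))"
  proof (rule laplace_quadratic_tendsto[OF M A \<theta>])
    show "p \<in> A \<Longrightarrow> V \<nu> p \<in> borel_measurable (M \<nu>)" for \<nu> p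
      unfolding V_def[abs_def] A_def
      by (intro borel_measurable_sum borel_measurable_times borel_measurable_const Z'_meas[where R = R]) auto
    show "p \<in> A \<Longrightarrow> 0 \<le> lam (fst p)" for p using lam_nonneg[of "fst p"] unfolding A_def by (metis UN_I UNIV_I mem_Times_iff)
    fix g :: "'i \<times> nat \<Rightarrow> real"
    \<comment> \<open>The coefficient with which \<open>S\<close> enters after rearranging by sample
      and coordinate. Orthonormality of the rows preserves sums of squares, so the limiting variance
      takes the diagonal form required.\<close>
    define c where "c i r = (\<Sum>l<k - 1. g (r, l) * u l i)" for i r
    have swap: "(\<Sum>p\<in>A. g p * (\<Sum>i<k. u (snd p) i * x i (fst p))) = (\<Sum>i<k. \<Sum>r\<in>J R. c i r * x i r)" for x
    proof -
      have "(\<Sum>p\<in>A. g p * (\<Sum>i<k. u (snd p) i * x i (fst p)))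
        = (\<Sum>r\<in>J R. \<Sum>l<k - 1. \<Sum>i<k. g (r, l) * u l i * x i r)"
        using sumA[of "\<lambda>r l. g (r, l) * (\<Sum>i<k. u l i * x i r)"] by (simp add: sum_distrib_left mult.assoc)
      also have "\<dots> = (\<Sum>r\<in>J R. \<Sum>i<k. \<Sum>l<k - 1. g (r, l) * u l i * x i r)"
        by (intro sum.cong refl sum.swap)
      also have "\<dots> = (\<Sum>i<k. \<Sum>r\<in>J R. \<Sum>l<k - 1. g (r, l) * u l i * x i r)"
        by (rule sum.swap)
      finally show ?thesis by (simp add: c_def sum_distrib_right)
    qed
    have c2: "(\<Sum>i<k. (c i r)\<^sup>2) = (\<Sum>l<k - 1. (g (r, l))\<^sup>2)" for r
    proof -
      have "(\<Sum>i<k. (c i r)\<^sup>2) = (\<Sum>i<k. \<Sum>l<k - 1. \<Sum>l'<k - 1. g (r, l) * g (r, l') * (u l i * u l' i))"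
        unfolding c_def power2_eq_square sum_product by (simp add: mult_ac)
      also have "\<dots> = (\<Sum>l<k - 1. \<Sum>i<k. \<Sum>l'<k - 1. g (r, l) * g (r, l') * (u l i * u l' i))"
        by (rule sum.swap)
      also have "\<dots> = (\<Sum>l<k - 1. \<Sum>l'<k - 1. \<Sum>i<k. g (r, l) * g (r, l') * (u l i * u l' i))"
        by (intro sum.cong refl sum.swap)
      also have "\<dots> = (\<Sum>l<k - 1. \<Sum>l'<k - 1. if l' = l then (g (r, l))\<^sup>2 else 0)"
        using orthonormal by (intro sum.cong refl) (auto simp: power2_eq_square simp flip: sum_distrib_left)
      also have "\<dots> = (\<Sum>l<k - 1. (g (r, l))\<^sup>2)" by simp
      finally show ?thesis .
    qed
    have var: "(\<Sum>i<k. \<Sum>r\<in>J R. (c i r)\<^sup>2 * lam r) = (\<Sum>p\<in>A. (g p)\<^sup>2 * lam (fst p))"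
    proof -
      have "(\<Sum>i<k. \<Sum>r\<in>J R. (c i r)\<^sup>2 * lam r) = (\<Sum>r\<in>J R. (\<Sum>i<k. (c i r)\<^sup>2) * lam r)"
        by (subst sum.swap) (simp add: sum_distrib_right)
      also have "\<dots> = (\<Sum>r\<in>J R. \<Sum>l<k - 1. (g (r, l))\<^sup>2 * lam r)"
        by (simp add: c2 sum_distrib_right)
      finally show ?thesis by (simp add: A_def sum.cartesian_product split_def)
    qed
    have "iexp (\<Sum>p\<in>A. g p * V \<nu> p \<omega>)
      = iexp (\<Sum>i<k. \<Sum>r\<in>J R. c i r * S \<nu> i r \<omega>) * iexp (\<Sum>p\<in>A. g p * \<mu> p)" for \<nu> \<omega>
    proof -
      have "(\<Sum>p\<in>A. g p * V \<nu> p \<omega>) = (\<Sum>i<k. \<Sum>r\<in>J R. c i r * S \<nu> i r \<omega>) + (\<Sum>p\<in>A. g p * \<mu> p)"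
        using swap[of "\<lambda>i r. Z' \<nu> i r \<omega>"] swap[of D]
        by (simp add: V_def \<mu>_def Z'_def distrib_left sum.distrib)
      then show ?thesis by (simp add: exp_add distrib_left del: of_real_sum)
    qed
    then have "(\<integral>\<omega>. iexp (\<Sum>p\<in>A. g p * V \<nu> p \<omega>) \<partial>M \<nu>)
      = (\<integral>\<omega>. iexp (\<Sum>i<k. \<Sum>r\<in>J R. c i r * S \<nu> i r \<omega>) \<partial>M \<nu>) * iexp (\<Sum>p\<in>A. g p * \<mu> p)" for \<nu>
      by (simp only: integral_mult_left_zero)
    then show "(\<lambda>\<nu>. \<integral>\<omega>. iexp (\<Sum>p\<in>A. g p * V \<nu> p \<omega>) \<partial>M \<nu>)
      \<longlonglongrightarrow> complex_of_real (exp (- ((\<Sum>p\<in>A. (g p)\<^sup>2 * lam (fst p)) / 2))) * iexp (\<Sum>p\<in>A. g p * \<mu> p)"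
      using tendsto_mult_right[OF char_lim[of c R], of "iexp (\<Sum>p\<in>A. g p * \<mu> p)"] by (simp only: var)
  qed
  moreover have "(\<Sum>p\<in>A. (V \<nu> p \<omega>)\<^sup>2) = (\<Sum>r\<in>J R. \<Sum>i<k. (Y' \<nu> i r \<omega>)\<^sup>2)" for \<nu> \<omega>
    unfolding Y'_def projection V_def A_def by (simp add: sum.cartesian_product split_def)
  ultimately show ?thesis
    using prodA[of "\<lambda>r l. exp (- (\<theta> * (\<Sum>i<k. u l i * D i r)\<^sup>2 / (1 + 2 * \<theta> * lam r))) / sqrt (1 + 2 * \<theta> * lam r)"]
    by (simp add: \<mu>_def)
qed


section \<open>Replacing the finite-sample projection by its limit\<close>

lemma b_le_1: "i < k \<Longrightarrow> \<bar>b \<nu> i\<bar> \<le> 1"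
proof -
  assume "i < k"
  then have "(b \<nu> i)\<^sup>2 \<le> (\<Sum>i<k. (b \<nu> i)\<^sup>2)" by (intro member_le_sum) auto
  then show ?thesis by (simp add: b_norm abs_square_le_1)
qed

lemma abs_E_le:
  assumes "i < k" "r \<in> J R"
  shows "AE \<omega> in M \<nu>. \<bar>E \<nu> i r \<omega>\<bar> \<le> 2 * \<rho> \<nu> i \<omega>"
  using E_le[OF assms(1)]
proof eventually_elim
  case (elim \<omega>)
  have "(E \<nu> i r \<omega>)\<^sup>2 \<le> (\<Sum>r\<in>J R. (E \<nu> i r \<omega>)\<^sup>2)"
    by (rule member_le_sum) (use assms finite_J in auto)
  also have "\<dots> \<le> 2 * (\<rho> \<nu> i \<omega>)\<^sup>2" using elim by auto
  also have "\<dots> \<le> (2 * \<rho> \<nu> i \<omega>)\<^sup>2" by (simp add: power_mult_distrib)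
  finally have "\<bar>E \<nu> i r \<omega>\<bar> \<le> \<bar>2 * \<rho> \<nu> i \<omega>\<bar>" unfolding abs_le_square_iff .
  then show ?case using \<rho>_nonneg[OF assms(1), of \<nu> \<omega>] by simp
qed

lemma Z'_integrable:
  assumes "i < k" "r \<in> J R"
  shows "integrable (M \<nu>) (\<lambda>\<omega>. \<bar>Z' \<nu> i r \<omega>\<bar>)"
    and "(\<integral>\<omega>. \<bar>Z' \<nu> i r \<omega>\<bar> \<partial>M \<nu>) \<le> 1 + c0 + \<bar>D i r\<bar>"
proof -
  interpret prob_space "M \<nu>" by (rule M)
  have r: "r \<in> (\<Union>R. J R)" using assms(2) by auto
  have int: "integrable (M \<nu>) (S \<nu> i r)" "integrable (M \<nu>) (\<lambda>\<omega>. (S \<nu> i r \<omega>)\<^sup>2)"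
    by (rule L2_integrable L2_power2_integrable, rule S_L2[OF assms(1) r])+
  show *: "integrable (M \<nu>) (\<lambda>\<omega>. \<bar>Z' \<nu> i r \<omega>\<bar>)"
    unfolding Z'_def using int by simp
  have "\<bar>s + e\<bar> \<le> 1 + s\<^sup>2 + \<bar>e\<bar>" for s e :: real
  proof -
    have "0 \<le> (\<bar>s\<bar> - 1 / 2)\<^sup>2" by simp
    then have "\<bar>s\<bar> \<le> 1 + s\<^sup>2" unfolding power2_diff by (simp add: power2_eq_square)
    then show ?thesis by linarith
  qed
  then have "(\<integral>\<omega>. \<bar>Z' \<nu> i r \<omega>\<bar> \<partial>M \<nu>) \<le> (\<integral>\<omega>. 1 + (S \<nu> i r \<omega>)\<^sup>2 + \<bar>D i r\<bar> \<partial>M \<nu>)"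
    using int * unfolding Z'_def by (intro integral_mono) auto
  also have "\<dots> = 1 + (\<integral>\<omega>. (S \<nu> i r \<omega>)\<^sup>2 \<partial>M \<nu>) + \<bar>D i r\<bar>"
    using int prob_space by simp
  also have "\<dots> \<le> 1 + c0 + \<bar>D i r\<bar>" using S_le[OF assms(1) r] by simp
  finally show "(\<integral>\<omega>. \<bar>Z' \<nu> i r \<omega>\<bar> \<partial>M \<nu>) \<le> 1 + c0 + \<bar>D i r\<bar>" .
qed

text \<open>An integrable majorant of \<open>\<bar>Y - Y'\<bar>\<close>. The first two terms are the
  remainder and its projection, whose matrix entries are at most 1 in modulus; the last is the
  change from \<open>b b^T\<close> to \<open>\<beta> \<beta>^T\<close> acting on the idealized
  coordinates.\<close>

definition W where "W R \<nu> i r \<omega> = 2 * \<rho> \<nu> i \<omega> + (\<Sum>j<k. 2 * \<rho> \<nu> j \<omega>)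
  + (\<Sum>j<k. \<bar>b \<nu> i * b \<nu> j - \<beta> i * \<beta> j\<bar> * \<bar>Z' \<nu> j r \<omega>\<bar>)"

lemma Y_near_Y':
  assumes "i < k" "r \<in> J R"
  shows "AE \<omega> in M \<nu>. \<bar>Y \<nu> i r \<omega> - Y' \<nu> i r \<omega>\<bar> \<le> W R \<nu> i r \<omega>"
proof -
  have "AE \<omega> in M \<nu>. \<forall>j\<in>{..<k}. \<bar>E \<nu> j r \<omega>\<bar> \<le> 2 * \<rho> \<nu> j \<omega>"
    using assms(2) by (intro AE_finite_allI abs_E_le) auto
  then show ?thesis
  proof eventually_elim
    case (elim \<omega>)
    have "Y \<nu> i r \<omega> - Y' \<nu> i r \<omega> = E \<nu> i r \<omega> - (\<Sum>j<k. b \<nu> i * b \<nu> j * E \<nu> j r \<omega>)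
      - (\<Sum>j<k. (b \<nu> i * b \<nu> j - \<beta> i * \<beta> j) * Z' \<nu> j r \<omega>)"
      unfolding Y_def Y'_def Z_def Z'_def
      by (simp add: sum_distrib_left sum_subtractf sum.distrib algebra_simps)
    then have 1: "\<bar>Y \<nu> i r \<omega> - Y' \<nu> i r \<omega>\<bar> \<le> \<bar>E \<nu> i r \<omega>\<bar> + \<bar>\<Sum>j<k. b \<nu> i * b \<nu> j * E \<nu> j r \<omega>\<bar>
      + \<bar>\<Sum>j<k. (b \<nu> i * b \<nu> j - \<beta> i * \<beta> j) * Z' \<nu> j r \<omega>\<bar>" by linarith
    have 2: "\<bar>E \<nu> i r \<omega>\<bar> \<le> 2 * \<rho> \<nu> i \<omega>" using elim assms(1) by auto
    have 3: "\<bar>\<Sum>j<k. b \<nu> i * b \<nu> j * E \<nu> j r \<omega>\<bar> \<le> (\<Sum>j<k. 2 * \<rho> \<nu> j \<omega>)"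
    proof (rule order_trans[OF sum_abs sum_mono])
      fix j assume j: "j \<in> {..<k}"
      have "\<bar>b \<nu> i * b \<nu> j\<bar> \<le> 1 * 1"
        unfolding abs_mult using b_le_1 assms(1) j by (intro mult_mono) auto
      then have "\<bar>b \<nu> i * b \<nu> j\<bar> * \<bar>E \<nu> j r \<omega>\<bar> \<le> 1 * (2 * \<rho> \<nu> j \<omega>)"
        using elim j by (intro mult_mono) auto
      then show "\<bar>b \<nu> i * b \<nu> j * E \<nu> j r \<omega>\<bar> \<le> 2 * \<rho> \<nu> j \<omega>" by (simp add: abs_mult)
    qed
    have 4: "\<bar>\<Sum>j<k. (b \<nu> i * b \<nu> j - \<beta> i * \<beta> j) * Z' \<nu> j r \<omega>\<bar>
        \<le> (\<Sum>j<k. \<bar>b \<nu> i * b \<nu> j - \<beta> i * \<beta> j\<bar> * \<bar>Z' \<nu> j r \<omega>\<bar>)"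
      by (rule order_trans[OF sum_abs]) (simp add: abs_mult)
    show ?case unfolding W_def using 1 2 3 4 by linarith
  qed
qed

lemma W_lim:
  assumes i: "i < k" and r: "r \<in> J R"
  shows "integrable (M \<nu>) (W R \<nu> i r)" and "(\<lambda>\<nu>. \<integral>\<omega>. W R \<nu> i r \<omega> \<partial>M \<nu>) \<longlonglongrightarrow> 0"
    and "0 \<le> W R \<nu> i r \<omega>"
proof -
  show int: "integrable (M \<nu>) (W R \<nu> i r)" for \<nu>
    unfolding W_def[abs_def]
    by (intro Bochner_Integration.integrable_add Bochner_Integration.integrable_sum integrable_mult_right
      \<rho>_int Z'_integrable(1)[OF _ r]) (use i in auto)
  show nn: "0 \<le> W R \<nu> i r \<omega>" for \<nu> \<omega>
    unfolding W_def by (intro add_nonneg_nonneg sum_nonneg mult_nonneg_nonneg \<rho>_nonneg) (use i in auto)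
  have val: "(\<integral>\<omega>. W R \<nu> i r \<omega> \<partial>M \<nu>) = 2 * (\<integral>\<omega>. \<rho> \<nu> i \<omega> \<partial>M \<nu>) + (\<Sum>j<k. 2 * (\<integral>\<omega>. \<rho> \<nu> j \<omega> \<partial>M \<nu>))
    + (\<Sum>j<k. \<bar>b \<nu> i * b \<nu> j - \<beta> i * \<beta> j\<bar> * (\<integral>\<omega>. \<bar>Z' \<nu> j r \<omega>\<bar> \<partial>M \<nu>))" for \<nu>
  proof -
    have a: "j \<in> {..<k} \<Longrightarrow> integrable (M \<nu>) (\<rho> \<nu> j)"
      "j \<in> {..<k} \<Longrightarrow> integrable (M \<nu>) (\<lambda>\<omega>. \<bar>Z' \<nu> j r \<omega>\<bar>)" for j
      by (auto intro: \<rho>_int Z'_integrable(1)[OF _ r])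
    note c = integral_linear_combination[of "{..<k}" "M \<nu>" "\<rho> \<nu>" "\<lambda>_. 2", OF a(1)]
      integral_linear_combination[of "{..<k}" "M \<nu>" "\<lambda>j \<omega>. \<bar>Z' \<nu> j r \<omega>\<bar>"
        "\<lambda>j. \<bar>b \<nu> i * b \<nu> j - \<beta> i * \<beta> j\<bar>", OF a(2)]
    have i2: "integrable (M \<nu>) (\<lambda>\<omega>. 2 * \<rho> \<nu> i \<omega>)" using \<rho>_int[OF i] by simp
    show ?thesis
      unfolding W_def
      by (subst Bochner_Integration.integral_add[OF Bochner_Integration.integrable_add[OF i2 c(1)] c(3)], assumption+)
        (subst Bochner_Integration.integral_add[OF i2 c(1)], assumption, simp add: c(2,4)[simplified])
  qed
  show "(\<lambda>\<nu>. \<integral>\<omega>. W R \<nu> i r \<omega> \<partial>M \<nu>) \<longlonglongrightarrow> 0"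
  proof (rule tendsto_sandwich[of "\<lambda>_. 0"])
    show "\<forall>\<^sub>F \<nu> in sequentially. (\<integral>\<omega>. W R \<nu> i r \<omega> \<partial>M \<nu>) \<le> 2 * (\<integral>\<omega>. \<rho> \<nu> i \<omega> \<partial>M \<nu>)
      + (\<Sum>j<k. 2 * (\<integral>\<omega>. \<rho> \<nu> j \<omega> \<partial>M \<nu>)) + (\<Sum>j<k. \<bar>b \<nu> i * b \<nu> j - \<beta> i * \<beta> j\<bar> * (1 + c0 + \<bar>D j r\<bar>))"
      unfolding val by (intro always_eventually allI add_left_mono sum_mono mult_left_mono Z'_integrable(2)[OF _ r]) auto
    have "(\<lambda>\<nu>. 2 * (\<integral>\<omega>. \<rho> \<nu> i \<omega> \<partial>M \<nu>) + (\<Sum>j<k. 2 * (\<integral>\<omega>. \<rho> \<nu> j \<omega> \<partial>M \<nu>))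
      + (\<Sum>j<k. \<bar>b \<nu> i * b \<nu> j - \<beta> i * \<beta> j\<bar> * (1 + c0 + \<bar>D j r\<bar>)))
      \<longlonglongrightarrow> 2 * 0 + (\<Sum>j<k. 2 * 0) + (\<Sum>j<k. \<bar>\<beta> i * \<beta> j - \<beta> i * \<beta> j\<bar> * (1 + c0 + \<bar>D j r\<bar>))"
      by (intro tendsto_intros \<rho>_lim b_lim) (use i in auto)
    then show "(\<lambda>\<nu>. 2 * (\<integral>\<omega>. \<rho> \<nu> i \<omega> \<partial>M \<nu>) + (\<Sum>j<k. 2 * (\<integral>\<omega>. \<rho> \<nu> j \<omega> \<partial>M \<nu>))
      + (\<Sum>j<k. \<bar>b \<nu> i * b \<nu> j - \<beta> i * \<beta> j\<bar> * (1 + c0 + \<bar>D j r\<bar>))) \<longlonglongrightarrow> 0" by simp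
  qed (use nn in auto)
qed

lemma exp_integrable:
  assumes "X \<in> borel_measurable (M \<nu>)" "AE \<omega> in M \<nu>. 0 \<le> X \<omega>" "0 \<le> \<theta>"
  shows "integrable (M \<nu>) (\<lambda>\<omega>. exp (- (\<theta> * X \<omega> :: real)))"
proof -
  interpret prob_space "M \<nu>" by (rule M)
  show ?thesis
  proof (rule integrable_const_bound[of _ 1])
    show "AE \<omega> in M \<nu>. norm (exp (- (\<theta> * X \<omega>))) \<le> 1"
      using assms(2) by eventually_elim (use assms(3) in simp)
  qed (use assms(1) in measurable)
qed

text \<open>For a fixed truncation the passage from \<open>Y'\<close> to \<open>Y\<close> costs only
  the expectations of finitely many \<open>W\<close>, since a Euclidean distance is at most the sum
  of the absolute differences of the coordinates.\<close>

lemma truncated_laplace_tendsto: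
  assumes \<theta>: "0 \<le> \<theta>"
  shows "(\<lambda>\<nu>. \<integral>\<omega>. exp (- (\<theta> * TR \<nu> R \<omega>)) \<partial>M \<nu>)
    \<longlonglongrightarrow> (\<Prod>r\<in>J R. \<Prod>l<k - 1. exp (- (\<theta> * (\<Sum>i<k. u l i * D i r)\<^sup>2 / (1 + 2 * \<theta> * lam r))) / sqrt (1 + 2 * \<theta> * lam r))"
proof (rule Lim_transform[OF truncated_main_term[OF \<theta>]])
  define B where "B = J R \<times> {..<k}"
  define TR' where "TR' \<nu> \<omega> = (\<Sum>r\<in>J R. \<Sum>i<k. (Y' \<nu> i r \<omega>)\<^sup>2)" for \<nu> \<omega>
  have TR'_meas: "TR' \<nu> \<in> borel_measurable (M \<nu>)" for \<nu>
    unfolding TR'_def[abs_def] by (intro borel_measurable_sum borel_measurable_power Y'_meas) auto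
  have TR'_nonneg: "0 \<le> TR' \<nu> \<omega>" for \<nu> \<omega> unfolding TR'_def by (intro sum_nonneg) auto
  have Bsum: "(\<Sum>p\<in>B. f (fst p) (snd p)) = (\<Sum>r\<in>J R. \<Sum>i<k. f r i)" for f :: "'i \<Rightarrow> nat \<Rightarrow> real"
    unfolding B_def by (simp add: sum.cartesian_product split_def)
  have bound: "\<bar>(\<integral>\<omega>. exp (- (\<theta> * TR' \<nu> \<omega>)) \<partial>M \<nu>) - (\<integral>\<omega>. exp (- (\<theta> * TR \<nu> R \<omega>)) \<partial>M \<nu>)\<bar>
    \<le> sqrt (2 * \<theta>) * (\<Sum>r\<in>J R. \<Sum>i<k. (\<integral>\<omega>. W R \<nu> i r \<omega> \<partial>M \<nu>))" for \<nu>
  proof -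
    have i1: "integrable (M \<nu>) (\<lambda>\<omega>. exp (- (\<theta> * TR' \<nu> \<omega>)))"
      using TR'_nonneg by (intro exp_integrable TR'_meas \<theta>) auto
    have i2: "integrable (M \<nu>) (\<lambda>\<omega>. exp (- (\<theta> * TR \<nu> R \<omega>)))"
      using TR_nonneg by (intro exp_integrable TR_meas \<theta>) auto
    have iW: "integrable (M \<nu>) (\<lambda>\<omega>. \<Sum>r\<in>J R. \<Sum>i<k. W R \<nu> i r \<omega>)"
      by (intro Bochner_Integration.integrable_sum W_lim(1)) auto
    have "\<bar>(\<integral>\<omega>. exp (- (\<theta> * TR' \<nu> \<omega>)) \<partial>M \<nu>) - (\<integral>\<omega>. exp (- (\<theta> * TR \<nu> R \<omega>)) \<partial>M \<nu>)\<bar>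
      = \<bar>\<integral>\<omega>. exp (- (\<theta> * TR' \<nu> \<omega>)) - exp (- (\<theta> * TR \<nu> R \<omega>)) \<partial>M \<nu>\<bar>"
      using i1 i2 by simp
    also have "\<dots> \<le> (\<integral>\<omega>. \<bar>exp (- (\<theta> * TR' \<nu> \<omega>)) - exp (- (\<theta> * TR \<nu> R \<omega>))\<bar> \<partial>M \<nu>)"
      by (rule integral_abs_bound)
    also have "\<dots> \<le> (\<integral>\<omega>. sqrt (2 * \<theta>) * (\<Sum>r\<in>J R. \<Sum>i<k. W R \<nu> i r \<omega>) \<partial>M \<nu>)"
    proof (rule integral_mono_AE)
      have "AE \<omega> in M \<nu>. \<forall>p\<in>B. \<bar>Y \<nu> (snd p) (fst p) \<omega> - Y' \<nu> (snd p) (fst p) \<omega>\<bar> \<le> W R \<nu> (snd p) (fst p) \<omega>"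
        using finite_J by (intro AE_finite_allI Y_near_Y') (auto simp: B_def)
      then show "AE \<omega> in M \<nu>. \<bar>exp (- (\<theta> * TR' \<nu> \<omega>)) - exp (- (\<theta> * TR \<nu> R \<omega>))\<bar>
        \<le> sqrt (2 * \<theta>) * (\<Sum>r\<in>J R. \<Sum>i<k. W R \<nu> i r \<omega>)"
      proof eventually_elim
        case (elim \<omega>)
        define y y' where "y = (\<lambda>p. Y \<nu> (snd p) (fst p) \<omega>)" and "y' = (\<lambda>p. Y' \<nu> (snd p) (fst p) \<omega>)"
        have sq: "TR \<nu> R \<omega> = (L2_set y B)\<^sup>2" "TR' \<nu> \<omega> = (L2_set y' B)\<^sup>2"
          unfolding TR_def TR'_def L2_set_def y_def y'_def
          by (simp_all add: sum_nonneg Bsum[of "\<lambda>r i. (Y \<nu> i r \<omega>)\<^sup>2"] Bsum[of "\<lambda>r i. (Y' \<nu> i r \<omega>)\<^sup>2"])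
        have tri: "L2_set f B \<le> L2_set g B + L2_set (\<lambda>p. f p - g p) B" for f g :: "'i \<times> nat \<Rightarrow> real"
          using L2_set_triangle_ineq[of g "\<lambda>p. f p - g p" B] by simp
        have "\<bar>L2_set y' B - L2_set y B\<bar> \<le> L2_set (\<lambda>p. \<bar>y p - y' p\<bar>) B"
          using tri[of y y'] tri[of y' y] by (simp add: L2_set_def power2_commute)
        also have "\<dots> \<le> (\<Sum>p\<in>B. \<bar>y p - y' p\<bar>)"
          using L2_set_le_sum_abs[of "\<lambda>p. \<bar>y p - y' p\<bar>" B] by simp
        also have "\<dots> \<le> (\<Sum>p\<in>B. W R \<nu> (snd p) (fst p) \<omega>)"
          using elim by (intro sum_mono) (auto simp: y_def y'_def)
        also have "\<dots> = (\<Sum>r\<in>J R. \<Sum>i<k. W R \<nu> i r \<omega>)"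
          by (rule Bsum)
        finally have "sqrt (2 * \<theta>) * \<bar>L2_set y' B - L2_set y B\<bar> \<le> sqrt (2 * \<theta>) * (\<Sum>r\<in>J R. \<Sum>i<k. W R \<nu> i r \<omega>)"
          using \<theta> by (intro mult_left_mono) auto
        then show ?case
          unfolding sq using exp_neg_square_Lipschitz[OF \<theta>, of "L2_set y' B" "L2_set y B"] by linarith
      qed
    qed (use i1 i2 iW in auto)
    also have "\<dots> = sqrt (2 * \<theta>) * (\<Sum>r\<in>J R. \<Sum>i<k. (\<integral>\<omega>. W R \<nu> i r \<omega> \<partial>M \<nu>))"
    proof -
      have "(\<integral>\<omega>. (\<Sum>r\<in>J R. \<Sum>i<k. W R \<nu> i r \<omega>) \<partial>M \<nu>) = (\<Sum>r\<in>J R. \<integral>\<omega>. (\<Sum>i<k. W R \<nu> i r \<omega>) \<partial>M \<nu>)"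
        by (intro Bochner_Integration.integral_sum Bochner_Integration.integrable_sum W_lim(1)) auto
      also have "\<dots> = (\<Sum>r\<in>J R. \<Sum>i<k. (\<integral>\<omega>. W R \<nu> i r \<omega> \<partial>M \<nu>))"
        by (intro sum.cong refl Bochner_Integration.integral_sum W_lim(1)) auto
      finally show ?thesis by simp
    qed
    finally show ?thesis .
  qed
  have "(\<lambda>\<nu>. sqrt (2 * \<theta>) * (\<Sum>r\<in>J R. \<Sum>i<k. (\<integral>\<omega>. W R \<nu> i r \<omega> \<partial>M \<nu>)))
      \<longlonglongrightarrow> sqrt (2 * \<theta>) * (\<Sum>r\<in>J R. \<Sum>i<k. 0)"
    by (intro tendsto_intros W_lim(2)) auto
  then have lim: "(\<lambda>\<nu>. sqrt (2 * \<theta>) * (\<Sum>r\<in>J R. \<Sum>i<k. (\<integral>\<omega>. W R \<nu> i r \<omega> \<partial>M \<nu>))) \<longlonglongrightarrow> 0" by simp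
  show "(\<lambda>\<nu>. (\<integral>\<omega>. exp (- (\<theta> * TR \<nu> R \<omega>)) \<partial>M \<nu>)
      - (\<integral>\<omega>. exp (- (\<theta> * (\<Sum>r\<in>J R. \<Sum>i<k. (Y' \<nu> i r \<omega>)\<^sup>2))) \<partial>M \<nu>)) \<longlonglongrightarrow> 0"
    by (rule Lim_null_comparison[OF always_eventually lim])
      (use bound in \<open>simp add: TR'_def abs_minus_commute\<close>)
qed

text \<open>The estimate is proved between two truncations with a bound independent of the larger
  one, and passes to \<open>T\<close> by dominated convergence. The first term is uniform in
  \<open>\<nu>\<close>, the second does not depend on \<open>R\<close>.\<close>

lemma truncation_error:
  assumes \<theta>: "0 \<le> \<theta>"
  shows "\<bar>(\<integral>\<omega>. exp (- (\<theta> * T \<nu> \<omega>)) \<partial>M \<nu>) - (\<integral>\<omega>. exp (- (\<theta> * TR \<nu> R \<omega>)) \<partial>M \<nu>)\<bar>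
    \<le> 3 * \<theta> * tl R + sqrt (6 * \<theta>) * (\<Sum>i<k. \<integral>\<omega>. \<rho> \<nu> i \<omega> \<partial>M \<nu>)"
proof -
  interpret prob_space "M \<nu>" by (rule M)
  have step: "\<bar>(\<integral>\<omega>. exp (- (\<theta> * TR \<nu> R' \<omega>)) \<partial>M \<nu>) - (\<integral>\<omega>. exp (- (\<theta> * TR \<nu> R \<omega>)) \<partial>M \<nu>)\<bar>
    \<le> 3 * \<theta> * tl R + sqrt (6 * \<theta>) * (\<Sum>i<k. \<integral>\<omega>. \<rho> \<nu> i \<omega> \<partial>M \<nu>)" if "R \<le> R'" for R'
  proof -
    have sub: "J R \<subseteq> J R'" using incseq_J that by (auto simp: incseq_def)
    define B where "B = J R' - J R"
    have BJ: "r \<in> B \<Longrightarrow> r \<in> J R'" for r by (simp add: B_def)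
    have i1: "integrable (M \<nu>) (\<lambda>\<omega>. exp (- (\<theta> * TR \<nu> R \<omega>)))" for R
      using TR_nonneg by (intro exp_integrable TR_meas \<theta>) auto
    have S2: "integrable (M \<nu>) (\<lambda>\<omega>. (S \<nu> i r \<omega>)\<^sup>2)" if "i < k" "r \<in> B" for i r
      using BJ[OF that(2)] by (intro L2_power2_integrable S_L2 that) auto
    define q where "q \<omega> = (\<Sum>r\<in>B. \<Sum>i<k. (S \<nu> i r \<omega>)\<^sup>2 + (D i r)\<^sup>2)" for \<omega>
    have q_int: "integrable (M \<nu>) q" unfolding q_def[abs_def]
      using S2 by (intro Bochner_Integration.integrable_sum Bochner_Integration.integrable_add) auto
    have q_le: "(\<integral>\<omega>. q \<omega> \<partial>M \<nu>) \<le> tl R"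
    proof -
      have "(\<integral>\<omega>. q \<omega> \<partial>M \<nu>) = (\<Sum>r\<in>B. \<Sum>i<k. (\<integral>\<omega>. (S \<nu> i r \<omega>)\<^sup>2 \<partial>M \<nu>) + (D i r)\<^sup>2)"
      proof -
        have "(\<integral>\<omega>. q \<omega> \<partial>M \<nu>) = (\<Sum>r\<in>B. \<integral>\<omega>. (\<Sum>i<k. (S \<nu> i r \<omega>)\<^sup>2 + (D i r)\<^sup>2) \<partial>M \<nu>)"
          unfolding q_def using S2
          by (intro Bochner_Integration.integral_sum Bochner_Integration.integrable_sum Bochner_Integration.integrable_add) auto
        also have "\<dots> = (\<Sum>r\<in>B. \<Sum>i<k. \<integral>\<omega>. (S \<nu> i r \<omega>)\<^sup>2 + (D i r)\<^sup>2 \<partial>M \<nu>)"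
          using S2 by (intro sum.cong refl Bochner_Integration.integral_sum Bochner_Integration.integrable_add) auto
        also have "\<dots> = (\<Sum>r\<in>B. \<Sum>i<k. (\<integral>\<omega>. (S \<nu> i r \<omega>)\<^sup>2 \<partial>M \<nu>) + (D i r)\<^sup>2)"
          using S2 prob_space by (intro sum.cong refl) simp
        finally show ?thesis .
      qed
      then show ?thesis using tail[OF \<open>R \<le> R'\<close>, of \<nu>] by (simp add: B_def)
    qed
    have \<rho>_int': "i \<in> {..<k} \<Longrightarrow> integrable (M \<nu>) (\<rho> \<nu> i)" for i by (simp add: \<rho>_int)
    note comb = integral_linear_combination[of "{..<k}" "M \<nu>" "\<rho> \<nu>" "\<lambda>_. sqrt (6 * \<theta>)", OF \<rho>_int']
    have "\<bar>(\<integral>\<omega>. exp (- (\<theta> * TR \<nu> R' \<omega>)) \<partial>M \<nu>) - (\<integral>\<omega>. exp (- (\<theta> * TR \<nu> R \<omega>)) \<partial>M \<nu>)\<bar>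
      = \<bar>\<integral>\<omega>. exp (- (\<theta> * TR \<nu> R' \<omega>)) - exp (- (\<theta> * TR \<nu> R \<omega>)) \<partial>M \<nu>\<bar>"
      using i1 by simp
    also have "\<dots> \<le> (\<integral>\<omega>. \<bar>exp (- (\<theta> * TR \<nu> R' \<omega>)) - exp (- (\<theta> * TR \<nu> R \<omega>))\<bar> \<partial>M \<nu>)"
      by (rule integral_abs_bound)
    also have "\<dots> \<le> (\<integral>\<omega>. 3 * \<theta> * q \<omega> + (\<Sum>i<k. sqrt (6 * \<theta>) * \<rho> \<nu> i \<omega>) \<partial>M \<nu>)"
    proof (rule integral_mono_AE)
      have "AE \<omega> in M \<nu>. \<forall>i\<in>{..<k}. \<forall>R. (\<Sum>r\<in>J R. (E \<nu> i r \<omega>)\<^sup>2) \<le> 2 * (\<rho> \<nu> i \<omega>)\<^sup>2"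
        by (intro AE_finite_allI E_le) auto
      then show "AE \<omega> in M \<nu>. \<bar>exp (- (\<theta> * TR \<nu> R' \<omega>)) - exp (- (\<theta> * TR \<nu> R \<omega>))\<bar>
        \<le> 3 * \<theta> * q \<omega> + (\<Sum>i<k. sqrt (6 * \<theta>) * \<rho> \<nu> i \<omega>)"
      proof eventually_elim
        case (elim \<omega>)
        have diff: "TR \<nu> R' \<omega> - TR \<nu> R \<omega> = (\<Sum>r\<in>B. \<Sum>i<k. (Y \<nu> i r \<omega>)\<^sup>2)"
          unfolding TR_def B_def using sub finite_J by (simp add: sum_diff)
        also have "\<dots> \<le> (\<Sum>r\<in>B. \<Sum>i<k. (Z \<nu> i r \<omega>)\<^sup>2)"
          unfolding Y_def by (rule sum_mono) (simp add: sum_squares_residual[OF b_norm])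
        also have "\<dots> \<le> (\<Sum>r\<in>B. \<Sum>i<k. 3 * ((S \<nu> i r \<omega>)\<^sup>2 + (D i r)\<^sup>2) + 3 * (E \<nu> i r \<omega>)\<^sup>2)"
        proof (intro sum_mono)
          \<comment> \<open>The factor 3 separates fluctuation, drift and remainder; together with
            the factor 2 in \<open>E_le\<close> it produces the 6 under the root.\<close>
          have "(x + y + z)\<^sup>2 \<le> 3 * (x\<^sup>2 + y\<^sup>2) + 3 * z\<^sup>2" for x y z :: real
          proof -
            have "0 \<le> (x - y)\<^sup>2 + (x - z)\<^sup>2 + (y - z)\<^sup>2" by simp
            then show ?thesis by (simp add: power2_eq_square algebra_simps)
          qed
          then show "(Z \<nu> i r \<omega>)\<^sup>2 \<le> 3 * ((S \<nu> i r \<omega>)\<^sup>2 + (D i r)\<^sup>2) + 3 * (E \<nu> i r \<omega>)\<^sup>2" for i r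
            unfolding Z_def .
        qed
        also have "\<dots> = 3 * q \<omega> + 3 * (\<Sum>i<k. \<Sum>r\<in>B. (E \<nu> i r \<omega>)\<^sup>2)"
          unfolding q_def by (subst (3) sum.swap) (simp add: sum.distrib sum_distrib_left)
        also have "\<dots> \<le> 3 * q \<omega> + 3 * (\<Sum>i<k. 2 * (\<rho> \<nu> i \<omega>)\<^sup>2)"
        proof (intro add_left_mono mult_left_mono sum_mono)
          fix i assume "i \<in> {..<k}"
          have "(\<Sum>r\<in>B. (E \<nu> i r \<omega>)\<^sup>2) \<le> (\<Sum>r\<in>J R'. (E \<nu> i r \<omega>)\<^sup>2)"
            unfolding B_def using finite_J by (intro sum_mono2) auto
          then show "(\<Sum>r\<in>B. (E \<nu> i r \<omega>)\<^sup>2) \<le> 2 * (\<rho> \<nu> i \<omega>)\<^sup>2" using elim \<open>i \<in> {..<k}\<close> by (meson order_trans)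
        qed simp
        finally have le: "\<theta> * (TR \<nu> R' \<omega> - TR \<nu> R \<omega>) \<le> \<theta> * (3 * q \<omega> + 3 * (\<Sum>i<k. 2 * (\<rho> \<nu> i \<omega>)\<^sup>2))"
          using \<theta> by (intro mult_left_mono) auto
        also have "\<dots> = 3 * \<theta> * q \<omega> + (\<Sum>i<k. (sqrt (6 * \<theta>) * \<rho> \<nu> i \<omega>)\<^sup>2)"
          using \<theta> by (simp add: power_mult_distrib sum_distrib_left algebra_simps)
        finally have le: "\<theta> * TR \<nu> R' \<omega> - \<theta> * TR \<nu> R \<omega> \<le> 3 * \<theta> * q \<omega> + (\<Sum>i<k. (sqrt (6 * \<theta>) * \<rho> \<nu> i \<omega>)\<^sup>2)"
          by (simp add: right_diff_distrib)
        have "0 \<le> TR \<nu> R' \<omega> - TR \<nu> R \<omega>" unfolding diff by (intro sum_nonneg) auto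
        then have mono: "\<theta> * TR \<nu> R \<omega> \<le> \<theta> * TR \<nu> R' \<omega>" using \<theta> by (intro mult_left_mono) auto
        have q0: "0 \<le> 3 * \<theta> * q \<omega>" unfolding q_def using \<theta> by (intro mult_nonneg_nonneg sum_nonneg) auto
        have "\<bar>exp (- (\<theta> * TR \<nu> R' \<omega>)) - exp (- (\<theta> * TR \<nu> R \<omega>))\<bar> \<le> min 1 (\<theta> * TR \<nu> R' \<omega> - \<theta> * TR \<nu> R \<omega>)"
          using \<theta> TR_nonneg by (intro exp_neg_diff_le mono) auto
        also have "\<dots> \<le> min 1 (3 * \<theta> * q \<omega> + (\<Sum>i<k. (sqrt (6 * \<theta>) * \<rho> \<nu> i \<omega>)\<^sup>2))"
          using le by simp
        also have "\<dots> \<le> 3 * \<theta> * q \<omega> + (\<Sum>i<k. sqrt (6 * \<theta>) * \<rho> \<nu> i \<omega>)"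
          using \<theta> \<rho>_nonneg by (intro min_1_sum_squares_le q0) auto
        finally show ?case .
      qed
    qed (use i1 q_int comb(1) in auto)
    also have "\<dots> = 3 * \<theta> * (\<integral>\<omega>. q \<omega> \<partial>M \<nu>) + (\<Sum>i<k. sqrt (6 * \<theta>) * (\<integral>\<omega>. \<rho> \<nu> i \<omega> \<partial>M \<nu>))"
      using q_int comb by simp
    also have "\<dots> \<le> 3 * \<theta> * tl R + (\<Sum>i<k. sqrt (6 * \<theta>) * (\<integral>\<omega>. \<rho> \<nu> i \<omega> \<partial>M \<nu>))"
      using \<theta> q_le by (intro add_right_mono mult_left_mono) auto
    finally show ?thesis by (simp add: sum_distrib_left)
  qed
  have "(\<lambda>R'. \<integral>\<omega>. exp (- (\<theta> * TR \<nu> R' \<omega>)) \<partial>M \<nu>) \<longlonglongrightarrow> (\<integral>\<omega>. exp (- (\<theta> * T \<nu> \<omega>)) \<partial>M \<nu>)"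
  proof (rule integral_dominated_convergence[where w = "\<lambda>_. 1"])
    show "AE \<omega> in M \<nu>. (\<lambda>R'. exp (- (\<theta> * TR \<nu> R' \<omega>))) \<longlonglongrightarrow> exp (- (\<theta> * T \<nu> \<omega>))"
      using T_lim' by eventually_elim (intro tendsto_intros)
    show "AE \<omega> in M \<nu>. norm (exp (- (\<theta> * TR \<nu> R' \<omega>))) \<le> 1" for R'
      using \<theta> TR_nonneg by simp
  qed (use T_meas TR_meas in measurable)
  then have "(\<lambda>R'. \<bar>(\<integral>\<omega>. exp (- (\<theta> * TR \<nu> R' \<omega>)) \<partial>M \<nu>) - (\<integral>\<omega>. exp (- (\<theta> * TR \<nu> R \<omega>)) \<partial>M \<nu>)\<bar>)
    \<longlonglongrightarrow> \<bar>(\<integral>\<omega>. exp (- (\<theta> * T \<nu> \<omega>)) \<partial>M \<nu>) - (\<integral>\<omega>. exp (- (\<theta> * TR \<nu> R \<omega>)) \<partial>M \<nu>)\<bar>"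
    by (intro tendsto_intros)
  then show ?thesis by (rule LIMSEQ_le_const2) (use step in blast)
qed

text \<open>The order of choice matters: \<open>R\<close> is fixed by the tail and by the limit of
  the products, neither of which involves \<open>\<nu>\<close>, and only then is
  \<open>\<nu>\<close> taken large. The truncation error accounts for two of the four quarters of
  \<open>e\<close>.\<close>

lemma laplace_tendsto:
  assumes \<theta>: "0 \<le> \<theta>"
    and L: "(\<lambda>R. \<Prod>r\<in>J R. \<Prod>l<k - 1. exp (- (\<theta> * (\<Sum>i<k. u l i * D i r)\<^sup>2 / (1 + 2 * \<theta> * lam r)))
        / sqrt (1 + 2 * \<theta> * lam r)) \<longlonglongrightarrow> L"
  shows "(\<lambda>\<nu>. \<integral>\<omega>. exp (- (\<theta> * T \<nu> \<omega>)) \<partial>M \<nu>) \<longlonglongrightarrow> L"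
proof (rule LIMSEQ_I)
  fix e :: real assume "0 < e"
  then have e4: "0 < e / 4" by simp
  have "(\<lambda>R. 3 * \<theta> * tl R) \<longlonglongrightarrow> 3 * \<theta> * 0" by (intro tendsto_intros tl)
  then have "(\<lambda>R. 3 * \<theta> * tl R) \<longlonglongrightarrow> 0" by simp
  from order_tendstoD(2)[OF this e4] have "\<forall>\<^sub>F R in sequentially. 3 * \<theta> * tl R < e / 4" .
  moreover have "\<forall>\<^sub>F R in sequentially. dist (\<Prod>r\<in>J R. \<Prod>l<k - 1. exp (- (\<theta> * (\<Sum>i<k. u l i * D i r)\<^sup>2
      / (1 + 2 * \<theta> * lam r))) / sqrt (1 + 2 * \<theta> * lam r)) L < e / 4"
    using tendstoD[OF L e4] .
  ultimately have "\<forall>\<^sub>F R in sequentially. 3 * \<theta> * tl R < e / 4 \<and>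
    dist (\<Prod>r\<in>J R. \<Prod>l<k - 1. exp (- (\<theta> * (\<Sum>i<k. u l i * D i r)\<^sup>2
      / (1 + 2 * \<theta> * lam r))) / sqrt (1 + 2 * \<theta> * lam r)) L < e / 4" by eventually_elim simp
  then obtain R where R: "3 * \<theta> * tl R < e / 4" and
    RL: "dist (\<Prod>r\<in>J R. \<Prod>l<k - 1. exp (- (\<theta> * (\<Sum>i<k. u l i * D i r)\<^sup>2
      / (1 + 2 * \<theta> * lam r))) / sqrt (1 + 2 * \<theta> * lam r)) L < e / 4"
    by (auto simp: eventually_sequentially)
  have "(\<lambda>\<nu>. sqrt (6 * \<theta>) * (\<Sum>i<k. \<integral>\<omega>. \<rho> \<nu> i \<omega> \<partial>M \<nu>)) \<longlonglongrightarrow> sqrt (6 * \<theta>) * (\<Sum>i<k. 0)"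
    by (intro tendsto_intros \<rho>_lim) auto
  then have "(\<lambda>\<nu>. sqrt (6 * \<theta>) * (\<Sum>i<k. \<integral>\<omega>. \<rho> \<nu> i \<omega> \<partial>M \<nu>)) \<longlonglongrightarrow> 0" by simp
  from order_tendstoD(2)[OF this e4]
  have "\<forall>\<^sub>F \<nu> in sequentially. sqrt (6 * \<theta>) * (\<Sum>i<k. \<integral>\<omega>. \<rho> \<nu> i \<omega> \<partial>M \<nu>) < e / 4" .
  moreover note tendstoD[OF truncated_laplace_tendsto[OF \<theta>, of R] e4]
  ultimately have "\<forall>\<^sub>F \<nu> in sequentially. norm ((\<integral>\<omega>. exp (- (\<theta> * T \<nu> \<omega>)) \<partial>M \<nu>) - L) < e"
  proof eventually_elim
    case (elim \<nu>)
    then show ?case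
      using truncation_error[OF \<theta>, of \<nu> R] R RL unfolding dist_real_def real_norm_def by linarith
  qed
  then show "\<exists>no. \<forall>\<nu>\<ge>no. norm ((\<integral>\<omega>. exp (- (\<theta> * T \<nu> \<omega>)) \<partial>M \<nu>) - L) < e"
    by (simp add: eventually_sequentially)
qed

end

section \<open>Functional samples\<close>

lemma space_interval_measure [simp]: "space (interval_measure_on a b) = {a..b}"
  by (simp add: interval_measure_on_def space_restrict_space)

lemma finite_interval_measure: "finite_measure (interval_measure_on a b)"
  by (rule finite_measureI)
    (simp add: interval_measure_on_def emeasure_restrict_space space_restrict_space emeasure_lborel_Icc_eq)

lemma measure_interval_measure: "a \<le> b \<Longrightarrow> measure (interval_measure_on a b) {a..b} = b - a"
  by (simp add: interval_measure_on_def measure_restrict_space)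

lemma space_square_measure: "space (square_measure a b) = {a..b} \<times> {a..b}"
  by (simp add: square_measure_def space_pair_measure)

lemma mem_space_square:
  "x \<in> space (square_measure a b) \<Longrightarrow> fst x \<in> {a..b}" "x \<in> space (square_measure a b) \<Longrightarrow> snd x \<in> {a..b}"
  by (auto simp: space_square_measure)

lemma finite_square_measure: "finite_measure (square_measure a b)"
  unfolding square_measure_def
  by (intro finite_measure_pair_measure finite_interval_measure)

lemma measurable_square_fst [measurable]: "fst \<in> measurable (square_measure a b) (interval_measure_on a b)"
  and measurable_square_snd [measurable]: "snd \<in> measurable (square_measure a b) (interval_measure_on a b)"
  unfolding square_measure_def by measurable

lemma interval_pair_sigma_finite: "pair_sigma_finite (interval_measure_on a b) (interval_measure_on a b)"
  by (intro pair_sigma_finite_finite finite_interval_measure)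

lemma square_iterated_integral:
  fixes f :: "real \<times> real \<Rightarrow> real"
  assumes "integrable (square_measure a b) f"
  shows "(\<integral>s. (\<integral>t. f (s, t) \<partial>interval_measure_on a b) \<partial>interval_measure_on a b) = (\<integral>x. f x \<partial>square_measure a b)"
  using pair_sigma_finite.integral_fst'[OF interval_pair_sigma_finite] assms
  unfolding square_measure_def by blast

lemma L2_tensor:
  assumes f: "L2 (interval_measure_on a b) f" and g: "L2 (interval_measure_on a b) g"
  shows "L2 (square_measure a b) (\<lambda>x. f (fst x) * g (snd x))"
    and "(\<integral>x. (f (fst x) * g (snd x))\<^sup>2 \<partial>square_measure a b)
      = (\<integral>t. (f t)\<^sup>2 \<partial>interval_measure_on a b) * (\<integral>t. (g t)\<^sup>2 \<partial>interval_measure_on a b)"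
proof -
  note [measurable] = L2_measurable[OF f] L2_measurable[OF g]
  have "integrable (square_measure a b) (\<lambda>(s, t). (f s)\<^sup>2 * (g t)\<^sup>2)"
    unfolding square_measure_def
  proof (rule pair_sigma_finite.Fubini_integrable[OF interval_pair_sigma_finite])
    show "integrable (interval_measure_on a b) (\<lambda>s. \<integral>t. norm (case (s, t) of (s, t) \<Rightarrow> (f s)\<^sup>2 * (g t)\<^sup>2) \<partial>interval_measure_on a b)"
      using L2_power2_integrable[OF f] by (simp add: abs_mult)
  qed (use L2_power2_integrable[OF g] in auto)
  then have int: "integrable (square_measure a b) (\<lambda>x. (f (fst x))\<^sup>2 * (g (snd x))\<^sup>2)"
    by (simp add: split_def)
  show "L2 (square_measure a b) (\<lambda>x. f (fst x) * g (snd x))"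
    using int by (simp add: L2_def power_mult_distrib)
  show "(\<integral>x. (f (fst x) * g (snd x))\<^sup>2 \<partial>square_measure a b)
      = (\<integral>t. (f t)\<^sup>2 \<partial>interval_measure_on a b) * (\<integral>t. (g t)\<^sup>2 \<partial>interval_measure_on a b)"
    using square_iterated_integral[OF int] by (simp add: power_mult_distrib)
qed

lemma sample_cov_eq:
  assumes "n > 0" "n \<noteq> 1"
  shows "(real n - 1) * sample_cov n y s t = (\<Sum>j<n. y j s * y j t) - (\<Sum>j<n. y j s) * (\<Sum>j<n. y j t) / real n"
proof -
  define m where "m = sample_mean n y"
  have m: "real n * m r = (\<Sum>j<n. y j r)" for r using assms by (simp add: m_def sample_mean_def)
  have "(real n - 1) * sample_cov n y s t = (\<Sum>j<n. (y j s - m s) * (y j t - m t))"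
    using assms by (simp add: sample_cov_def m_def)
  also have "\<dots> = (\<Sum>j<n. y j s * y j t) - m t * (\<Sum>j<n. y j s) - m s * (\<Sum>j<n. y j t) + real n * (m s * m t)"
    by (simp add: algebra_simps sum.distrib sum_subtractf sum_distrib_left)
  also have "\<dots> = (\<Sum>j<n. y j s * y j t) - (\<Sum>j<n. y j s) * (\<Sum>j<n. y j t) / real n"
    unfolding m[symmetric] using assms by (simp add: field_simps)
  finally show ?thesis .
qed

text \<open>One configuration of sample sizes with centred observations. The bound \<open>C\<close>
  is a parameter, so that the estimates proved here hold with the same constants for all
  configurations.\<close>

locale functional_samples = prob_space M for M :: "'w measure" +
  fixes a b C :: real and k :: nat and n :: "nat \<Rightarrow> nat"
    and v :: "nat \<Rightarrow> nat \<Rightarrow> real \<Rightarrow> 'w \<Rightarrow> real" and c :: "nat \<Rightarrow> real \<Rightarrow> real \<Rightarrow> real"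
  assumes ab: "a < b" and n_ge_2: "i < k \<Longrightarrow> 2 \<le> n i"
    and v_meas: "i < k \<Longrightarrow> j < n i \<Longrightarrow>
      (\<lambda>(t, \<omega>). v i j t \<omega>) \<in> borel_measurable (interval_measure_on a b \<Otimes>\<^sub>M M)"
    and v_indep: "indep_vars (\<lambda>_. PiM {a..b} (\<lambda>_. borel)) (\<lambda>(i, j). sample_path {a..b} (v i j))
      (SIGMA i:{..<k}. {..<n i})"
    and v_cov: "i < k \<Longrightarrow> j < n i \<Longrightarrow> has_mean_cov M {a..b} (v i j) (\<lambda>_. 0) (c i)"
    and v_gauss: "i < k \<Longrightarrow> j < n i \<Longrightarrow> gaussian_process M {a..b} (v i j)"
    and c_bound: "i < k \<Longrightarrow> s \<in> {a..b} \<Longrightarrow> t \<in> {a..b} \<Longrightarrow> \<bar>c i s t\<bar> \<le> C"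
begin

abbreviation "\<mu> \<equiv> interval_measure_on a b"
abbreviation "Q \<equiv> square_measure a b"
text \<open>\<open>848 = 8 * (105 + 1)\<close>, where 105 is the eighth moment of the standard normal law.\<close>

abbreviation "K \<equiv> 848 * C ^ 4"

sublocale \<mu>: finite_measure \<mu> by (rule finite_interval_measure)
sublocale Q: finite_measure Q by (rule finite_square_measure)

section \<open>Products of paths as random fields on the square\<close>

definition P where "P = (SIGMA i:{..<k}. {..<n i})"

lemma finite_P: "finite P" by (simp add: P_def)

lemma mem_P: "(i, j) \<in> P \<longleftrightarrow> i < k \<and> j < n i" by (auto simp: P_def)

lemma gaussian_v: "i < k \<Longrightarrow> j < n i \<Longrightarrow> centred_gaussian M {a..b} (v i j) (c i)"
  by (simp add: centred_gaussian_def centred_gaussian_axioms_def prob_space_axioms v_gauss v_cov)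

lemma v_pair_measurable:
  assumes "i < k" "j < n i" "f \<in> measurable N \<mu>" "g \<in> measurable N M"
  shows "(\<lambda>z. v i j (f z) (g z)) \<in> borel_measurable N"
  using measurable_compose[OF measurable_Pair[OF assms(3,4)] v_meas[OF assms(1,2)]] by simp

lemma C_nonneg: "i < k \<Longrightarrow> 0 \<le> C"
  using c_bound[of i a a] ab by force

text \<open>The covariance functions come without measurability; it is inherited from the joint
  measurability of one observation, as \<open>c i\<close> is a parameter integral of products of its
  values.\<close>

lemma c_measurable:
  assumes "i < k" shows "(\<lambda>x. c i (fst x) (snd x)) \<in> borel_measurable Q"
proof -
  have j: "0 < n i" using n_ge_2[OF assms] by simp
  interpret cg: centred_gaussian M "{a..b}" "v i 0" "c i" by (rule gaussian_v[OF assms j])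
  have "(\<lambda>x. \<integral>\<omega>. v i 0 (fst x) \<omega> * v i 0 (snd x) \<omega> \<partial>M) \<in> borel_measurable Q"
  proof (rule borel_measurable_lebesgue_integral)
    show "(\<lambda>(x, \<omega>). v i 0 (fst x) \<omega> * v i 0 (snd x) \<omega>) \<in> borel_measurable (Q \<Otimes>\<^sub>M M)"
      unfolding split_def
      by (intro borel_measurable_times v_pair_measurable[OF assms j]) measurable
  qed
  then show ?thesis
    by (rule measurable_cong[THEN iffD1, rotated]) (use mem_space_square in \<open>auto intro!: cg.X_cov\<close>)
qed

lemma c_L2: "i < k \<Longrightarrow> L2 Q (\<lambda>x. c i (fst x) (snd x))"
  using mem_space_square by (intro Q.L2_bounded[of _ C] c_measurable c_bound) auto

definition H where
  "H p x \<omega> = v (fst p) (snd p) (fst x) \<omega> * v (fst p) (snd p) (snd x) \<omega> - c (fst p) (fst x) (snd x)"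

definition F where
  "F p = vimage_algebra (space M) (sample_path {a..b} (v (fst p) (snd p))) (PiM {a..b} (\<lambda>_. borel))"

lemma sample_path_measurable:
  assumes "p \<in> P"
  shows "sample_path {a..b} (v (fst p) (snd p)) \<in> measurable M (PiM {a..b} (\<lambda>_. borel))"
  using v_indep assms unfolding indep_vars_def2 P_def[symmetric] by (auto simp: split_def)

text \<open>Of the three pairings in Isserlis' formula, the one that pairs within \<open>x\<close>
  and within \<open>y\<close> cancels against the centring; the other two form
  \<open>varpi\<close>.\<close>

lemma random_field_H:
  assumes p: "p \<in> P"
  shows "random_field Q M (H p) (varpi (c (fst p))) K"
proof -
  obtain i j where p_eq: "p = (i, j)" and i: "i < k" and j: "j < n i"
    using p by (auto simp: P_def)
  interpret cg: centred_gaussian M "{a..b}" "v i j" "c i" by (rule gaussian_v[OF i j])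
  have C0: "0 \<le> C" by (rule C_nonneg[OF i])
  show ?thesis
  proof
    show "(\<lambda>(x, \<omega>). H p x \<omega>) \<in> borel_measurable (Q \<Otimes>\<^sub>M M)"
      unfolding split_def H_def p_eq fst_conv snd_conv
      using measurable_compose[OF measurable_fst c_measurable[OF i]]
      by (intro borel_measurable_diff borel_measurable_times v_pair_measurable[OF i j]) (measurable, auto)
    fix x assume x: "x \<in> space Q"
    note x' = mem_space_square[OF x]
    note [measurable] = cg.X_measurable[OF x'(1)] cg.X_measurable[OF x'(2)]
    \<comment> \<open>Convexity splits off \<open>c i\<close>, and the product of two values is
      dominated by their eighth powers, so that only one-dimensional Gaussian moments are needed for
      \<open>K\<close>.\<close>
    have le: "(v i j (fst x) \<omega> * v i j (snd x) \<omega> - c i (fst x) (snd x)) ^ 4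
      \<le> 4 * (v i j (fst x) \<omega> ^ 8 + v i j (snd x) \<omega> ^ 8) + 8 * C ^ 4" for \<omega>
    proof -
      have 1: "(y - z) ^ 4 \<le> 8 * (y ^ 4 + z ^ 4)" for y z :: real
      proof -
        have "(y - z)\<^sup>2 \<le> 2 * (y\<^sup>2 + z\<^sup>2)"
          using sum_squares_ge_zero[of "y + z" 0] by (simp add: power2_eq_square algebra_simps)
        then have "((y - z)\<^sup>2)\<^sup>2 \<le> (2 * (y\<^sup>2 + z\<^sup>2))\<^sup>2" by (intro power_mono) auto
        also have "\<dots> = 4 * (y\<^sup>2 + z\<^sup>2)\<^sup>2" by (simp only: power_mult_distrib) simp
        also have "(y\<^sup>2 + z\<^sup>2)\<^sup>2 \<le> 2 * ((y\<^sup>2)\<^sup>2 + (z\<^sup>2)\<^sup>2)"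
          using zero_le_power2[of "y\<^sup>2 - z\<^sup>2"] by (simp add: power2_sum power2_diff)
        finally show ?thesis by simp
      qed
      have 2: "(y * z) ^ 4 \<le> (y ^ 8 + z ^ 8) / 2" for y z :: real
        using zero_le_power2[of "y ^ 4 - z ^ 4"]
        by (simp add: power2_diff power_mult_distrib flip: power_mult)
      have "\<bar>c i (fst x) (snd x)\<bar> ^ 4 \<le> C ^ 4" using c_bound[OF i x'] by (intro power_mono) auto
      then have "c i (fst x) (snd x) ^ 4 \<le> C ^ 4" by simp
      then show ?thesis
        using 1[of "v i j (fst x) \<omega> * v i j (snd x) \<omega>" "c i (fst x) (snd x)"]
          2[of "v i j (fst x) \<omega>" "v i j (snd x) \<omega>"] by (simp add: field_simps)
    qed
    have int: "integrable M (\<lambda>\<omega>. 4 * (v i j (fst x) \<omega> ^ 8 + v i j (snd x) \<omega> ^ 8) + 8 * C ^ 4)"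
      using cg.X_power_integrable[OF x'(1)] cg.X_power_integrable[OF x'(2)] by simp
    show int4: "integrable M (\<lambda>\<omega>. H p x \<omega> ^ 4)"
      unfolding H_def p_eq fst_conv snd_conv
    proof (rule Bochner_Integration.integrable_bound[OF int])
      show "AE \<omega> in M. norm ((v i j (fst x) \<omega> * v i j (snd x) \<omega> - c i (fst x) (snd x)) ^ 4)
        \<le> norm (4 * (v i j (fst x) \<omega> ^ 8 + v i j (snd x) \<omega> ^ 8) + 8 * C ^ 4)"
        using le by (intro AE_I2) (auto intro: order_trans[OF _ abs_ge_self])
    qed measurable
    have c_le: "c i s s ^ 4 \<le> C ^ 4" if "s \<in> {a..b}" for s
      using power_mono[OF c_bound[OF i that that], of 4] by simp
    have "(\<integral>\<omega>. H p x \<omega> ^ 4 \<partial>M) \<le> (\<integral>\<omega>. 4 * (v i j (fst x) \<omega> ^ 8 + v i j (snd x) \<omega> ^ 8) + 8 * C ^ 4 \<partial>M)"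
      using int4 le by (intro integral_mono int) (auto simp: H_def p_eq)
    also have "\<dots> = 4 * (105 * c i (fst x) (fst x) ^ 4 + 105 * c i (snd x) (snd x) ^ 4) + 8 * C ^ 4"
      using cg.X_power_integrable[OF x'(1)] cg.X_power_integrable[OF x'(2)]
        cg.X_moment_8[OF x'(1)] cg.X_moment_8[OF x'(2)] prob_space by simp
    also have "\<dots> \<le> K" using c_le[OF x'(1)] c_le[OF x'(2)] by simp
    finally show "(\<integral>\<omega>. H p x \<omega> ^ 4 \<partial>M) \<le> K" .
    have G_int: "integrable M (\<lambda>\<omega>. v i j s \<omega> * v i j t \<omega>)" if "s \<in> {a..b}" "t \<in> {a..b}" for s t
      by (rule L2_mult_integrable[OF cg.X_L2[OF that(1)] cg.X_L2[OF that(2)]])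
    show "(\<integral>\<omega>. H p x \<omega> \<partial>M) = 0"
      unfolding H_def p_eq fst_conv snd_conv using G_int[OF x'] cg.X_cov[OF x'] prob_space by simp
    fix y assume y: "y \<in> space Q"
    note y' = mem_space_square[OF y]
    have "(\<integral>\<omega>. H p x \<omega> * H p y \<omega> \<partial>M) = (\<integral>\<omega>. v i j (fst x) \<omega> * v i j (snd x) \<omega> * (v i j (fst y) \<omega> * v i j (snd y) \<omega>)
      - c i (fst y) (snd y) * (v i j (fst x) \<omega> * v i j (snd x) \<omega>)
      - c i (fst x) (snd x) * (v i j (fst y) \<omega> * v i j (snd y) \<omega>) + c i (fst x) (snd x) * c i (fst y) (snd y) \<partial>M)"
      unfolding H_def p_eq by (simp add: algebra_simps)
    also have "\<dots> = c i (fst x) (fst y) * c i (snd x) (snd y) + c i (fst x) (snd y) * c i (snd x) (fst y)"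
      using cg.Isserlis[OF x' y'] G_int[OF x'] G_int[OF y'] cg.X_cov[OF x'] cg.X_cov[OF y'] prob_space
      by simp
    \<comment> \<open>Isserlis' formula yields the arguments in the order \<open>t1\<close>,
      \<open>s2\<close>, while \<open>varpi\<close> has \<open>s2\<close>,
      \<open>t1\<close>.\<close>
    also have "c i (snd x) (fst y) = c i (fst y) (snd x)" by (rule cg.cov_sym[OF x'(2) y'(1)])
    finally show "(\<integral>\<omega>. H p x \<omega> * H p y \<omega> \<partial>M) = varpi (c (fst p)) x y"
      by (simp add: varpi_def p_eq split_def)
  qed
qed

sublocale independent_fields M Q P H "\<lambda>p. varpi (c (fst p))" K F
proof (rule independent_fields.intro[OF prob_space_axioms independent_fields_axioms.intro])
  show "finite P" by (rule finite_P)
  fix p assume p: "p \<in> P"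
  show "random_field Q M (H p) (varpi (c (fst p))) K" by (rule random_field_H[OF p])
  have space: "sample_path {a..b} (v (fst p) (snd p)) \<in> space M \<rightarrow> space (PiM {a..b} (\<lambda>_. borel))"
    using measurable_space[OF sample_path_measurable[OF p]] by auto
  show "subalgebra M (F p)"
    unfolding subalgebra_def F_def using sets_vimage_algebra2[OF space] measurable_sets[OF sample_path_measurable[OF p]]
    by auto
  fix x assume x: "x \<in> space Q"
  have v_F: "v (fst p) (snd p) t \<in> borel_measurable (F p)" if t: "t \<in> {a..b}" for t
  proof -
    have "(\<lambda>\<omega>. sample_path {a..b} (v (fst p) (snd p)) \<omega> t) \<in> borel_measurable (F p)"
      unfolding F_def
      by (rule measurable_compose[OF measurable_vimage_algebra1[OF space] measurable_component_singleton[OF t]])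
    then show ?thesis using t by (simp add: sample_path_def)
  qed
  show "H p x \<in> borel_measurable (F p)"
    unfolding H_def[abs_def] using v_F mem_space_square[OF x] by (intro borel_measurable_diff borel_measurable_times) auto
next
  have "indep_sets (\<lambda>p. {sample_path {a..b} (v (fst p) (snd p)) -` A \<inter> space M |A. A \<in> sets (PiM {a..b} (\<lambda>_. borel))}) P"
    using v_indep unfolding indep_vars_def2 P_def[symmetric] by (simp add: split_def)
  moreover have "sets (F p) = {sample_path {a..b} (v (fst p) (snd p)) -` A \<inter> space M |A. A \<in> sets (PiM {a..b} (\<lambda>_. borel))}"
    if "p \<in> P" for p
    unfolding F_def using measurable_space[OF sample_path_measurable[OF that]]
    by (intro sets_vimage_algebra2) auto
  ultimately show "indep_sets (\<lambda>p. sets (F p)) P"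
    by (subst indep_sets_cong[OF refl]) auto
qed

text \<open>Used for the correction by sample means: almost all paths are square integrable on the
  interval, so tensor products of their sums lie in \<open>L2\<close> of the square.\<close>

lemma random_field_v:
  assumes i: "i < k" and j: "j < n i"
  shows "random_field \<mu> M (v i j) (c i) (3 * C\<^sup>2)"
proof -
  interpret cg: centred_gaussian M "{a..b}" "v i j" "c i" by (rule gaussian_v[OF i j])
  show ?thesis
  proof
    show "(\<lambda>(x, \<omega>). v i j x \<omega>) \<in> borel_measurable (\<mu> \<Otimes>\<^sub>M M)" by (rule v_meas[OF i j])
    fix t assume "t \<in> space \<mu>"
    then have t: "t \<in> {a..b}" by simp
    show "integrable M (\<lambda>\<omega>. v i j t \<omega> ^ 4)" by (rule cg.X_power_integrable[OF t])
    have "(\<integral>\<omega>. v i j t \<omega> ^ 4 \<partial>M) = 3 * (c i t t)\<^sup>2"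
      using cg.combination_moments(2)[of "{0::nat}" "\<lambda>_. t" "\<lambda>_. 1"] t by simp
    also have "\<dots> \<le> 3 * C\<^sup>2"
      using power_mono[OF c_bound[OF i t t], of 2] by simp
    finally show "(\<integral>\<omega>. v i j t \<omega> ^ 4 \<partial>M) \<le> 3 * C\<^sup>2" .
    show "(\<integral>\<omega>. v i j t \<omega> \<partial>M) = 0" by (rule cg.X_mean[OF t])
    fix s assume "s \<in> space \<mu>"
    then show "(\<integral>\<omega>. v i j t \<omega> * v i j s \<omega> \<partial>M) = c i t s" using t by (simp add: cg.X_cov)
  qed
qed

text \<open>A single exceptional null set, off which the pathwise identities below are used;
  finiteness of \<open>P\<close> makes it one set for all observations.\<close>

lemma AE_good_paths:
  "AE \<omega> in M. \<forall>p\<in>P. L2 Q (\<lambda>x. H p x \<omega>) \<and> L2 \<mu> (\<lambda>t. v (fst p) (snd p) t \<omega>)"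
proof (rule AE_finite_allI[OF finite_P])
  fix p assume p: "p \<in> P"
  have "AE \<omega> in M. L2 \<mu> (\<lambda>t. v (fst p) (snd p) t \<omega>)"
    using random_field.AE_paths[OF random_field_v[of "fst p" "snd p"]] p
    by (auto simp: mem_P split_def P_def)
  then show "AE \<omega> in M. L2 Q (\<lambda>x. H p x \<omega>) \<and> L2 \<mu> (\<lambda>t. v (fst p) (snd p) t \<omega>)"
    using random_field.AE_paths[OF random_field_H[OF p]] by eventually_elim auto
qed

section \<open>The correction by sample means\<close>

lemma n_pos: "i < k \<Longrightarrow> 0 < real (n i) - 1"
  using n_ge_2[of i] by simp

definition W where "W i t \<omega> = (\<Sum>j<n i. v i j t \<omega>)"

definition V where "V i \<omega> = (\<integral>t. (W i t \<omega>)\<^sup>2 \<partial>\<mu>)"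

text \<open>Up to the factor \<open>sqrt 2\<close>, a bound for the norm of the remainder
  \<open>R_field\<close>: \<open>C * (b - a)\<close> bounds the norm of \<open>c i\<close> on the
  square, and \<open>V i\<close> is the norm of the tensor square of the path sum.\<close>

definition \<rho> where "\<rho> i \<omega> = (C * (b - a) + V i \<omega> / real (n i)) / sqrt (real (n i) - 1)"

lemma W_pair_L2: "i < k \<Longrightarrow> L2 (\<mu> \<Otimes>\<^sub>M M) (\<lambda>(t, \<omega>). W i t \<omega>)"
  using random_field.H_pair_L2[OF random_field_v] unfolding W_def split_def
  by (intro L2_sum) auto

lemma v_uncorrelated:
  assumes i: "i < k" and j: "j < n i" "j' < n i" and t: "t \<in> {a..b}"
  shows "(\<integral>\<omega>. v i j t \<omega> * v i j' t \<omega> \<partial>M) = (if j = j' then c i t t else 0)"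
proof (cases "j = j'")
  case True
  then show ?thesis
    using centred_gaussian.X_cov[OF gaussian_v[OF i j(1)] t t] by simp
next
  case False
  \<comment> \<open>Evaluation at \<open>t\<close> is measurable on the product space, so
    independence of the paths passes to their values at a fixed time.\<close>
  have "indep_vars (\<lambda>_. borel) (\<lambda>p \<omega>. (case p of (i, j) \<Rightarrow> sample_path {a..b} (v i j)) \<omega> t) P"
    unfolding P_def by (rule indep_vars_compose2[OF v_indep]) (use t in auto)
  then have "indep_vars (\<lambda>_. borel) (\<lambda>p \<omega>. v (fst p) (snd p) t \<omega>) P"
    using t by (simp add: sample_path_def split_def)
  then have "indep_vars (\<lambda>_. borel) (\<lambda>p \<omega>. v (fst p) (snd p) t \<omega>) {(i, j), (i, j')}"
    by (rule indep_vars_subset) (use i j in \<open>auto simp: mem_P\<close>)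
  moreover have "integrable M (v i j'' t)" if "j'' < n i" for j''
    by (rule L2_integrable[OF centred_gaussian.X_L2[OF gaussian_v[OF i that] t]])
  ultimately have "(\<integral>\<omega>. (\<Prod>p\<in>{(i, j), (i, j')}. v (fst p) (snd p) t \<omega>) \<partial>M)
    = (\<Prod>p\<in>{(i, j), (i, j')}. \<integral>\<omega>. v (fst p) (snd p) t \<omega> \<partial>M)"
    using j by (intro indep_vars_lebesgue_integral) auto
  then show ?thesis
    using False centred_gaussian.X_mean[OF gaussian_v[OF i j(1)] t] by simp
qed

lemma expectation_W_power2:
  assumes i: "i < k" and t: "t \<in> {a..b}"
  shows "(\<integral>\<omega>. (W i t \<omega>)\<^sup>2 \<partial>M) = real (n i) * c i t t"
proof -
  have int: "integrable M (\<lambda>\<omega>. v i j t \<omega> * v i j' t \<omega>)" if "j < n i" "j' < n i" for j j'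
    by (intro L2_mult_integrable centred_gaussian.X_L2[OF gaussian_v[OF i] t] that)
  have "(\<integral>\<omega>. (W i t \<omega>)\<^sup>2 \<partial>M) = (\<integral>\<omega>. (\<Sum>j<n i. \<Sum>j'<n i. v i j t \<omega> * v i j' t \<omega>) \<partial>M)"
    by (simp add: W_def power2_eq_square sum_product)
  also have "\<dots> = (\<Sum>j<n i. \<integral>\<omega>. (\<Sum>j'<n i. v i j t \<omega> * v i j' t \<omega>) \<partial>M)"
    using int by (intro Bochner_Integration.integral_sum Bochner_Integration.integrable_sum) auto
  also have "\<dots> = (\<Sum>j<n i. \<Sum>j'<n i. \<integral>\<omega>. v i j t \<omega> * v i j' t \<omega> \<partial>M)"
    using int by (intro sum.cong refl Bochner_Integration.integral_sum) auto
  also have "\<dots> = (\<Sum>j<n i. \<Sum>j'<n i. if j = j' then c i t t else 0)"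
    using v_uncorrelated[OF i _ _ t] by (intro sum.cong refl) auto
  finally show ?thesis by simp
qed

lemma V_integrable: "i < k \<Longrightarrow> integrable M (V i)"
  and expectation_V: "i < k \<Longrightarrow> (\<integral>\<omega>. V i \<omega> \<partial>M) \<le> real (n i) * (C * (b - a))"
proof -
  assume i: "i < k"
  interpret pr: pair_sigma_finite \<mu> M
    by (intro pair_sigma_finite_finite finite_interval_measure finite_measure_axioms)
  have int: "integrable (\<mu> \<Otimes>\<^sub>M M) (\<lambda>(t, \<omega>). (W i t \<omega>)\<^sup>2)"
    using L2_power2_integrable[OF W_pair_L2[OF i]] by (simp add: split_def)
  show "integrable M (V i)" unfolding V_def[abs_def] using pr.integrable_snd[OF int] .
  have "(\<integral>\<omega>. V i \<omega> \<partial>M) = (\<integral>t. (\<integral>\<omega>. (W i t \<omega>)\<^sup>2 \<partial>M) \<partial>\<mu>)"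
    unfolding V_def using pr.Fubini_integral[OF int] .
  also have "\<dots> \<le> (\<integral>t. real (n i) * C \<partial>\<mu>)"
  proof (rule integral_mono)
    fix t assume "t \<in> space \<mu>"
    then have t: "t \<in> {a..b}" by simp
    have "c i t t \<le> C" using c_bound[OF i t t] by simp
    then show "(\<integral>\<omega>. (W i t \<omega>)\<^sup>2 \<partial>M) \<le> real (n i) * C"
      unfolding expectation_W_power2[OF i t] by (intro mult_left_mono) auto
  qed (use pr.integrable_fst[OF int] in auto)
  also have "\<dots> = real (n i) * (C * (b - a))"
    using ab by (simp add: measure_interval_measure)
  finally show "(\<integral>\<omega>. V i \<omega> \<partial>M) \<le> real (n i) * (C * (b - a))" .
qed

lemma \<rho>_integrable: "i < k \<Longrightarrow> integrable M (\<rho> i)"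
  unfolding \<rho>_def[abs_def] using V_integrable by simp

lemma \<rho>_nonneg: "i < k \<Longrightarrow> 0 \<le> \<rho> i \<omega>"
  unfolding \<rho>_def V_def using C_nonneg[of i] ab n_pos[of i] by simp

text \<open>Of the order of one over the root of the sample size, because distinct observations are
  uncorrelated and the expectation of \<open>V i\<close> therefore grows only linearly.\<close>

lemma expectation_\<rho>:
  assumes i: "i < k" shows "(\<integral>\<omega>. \<rho> i \<omega> \<partial>M) \<le> 2 * (C * (b - a)) / sqrt (real (n i) - 1)"
proof -
  have "(\<integral>\<omega>. \<rho> i \<omega> \<partial>M) = (C * (b - a) + (\<integral>\<omega>. V i \<omega> \<partial>M) / real (n i)) / sqrt (real (n i) - 1)"
    unfolding \<rho>_def using V_integrable[OF i] prob_space by simp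
  also have "\<dots> \<le> (C * (b - a) + C * (b - a)) / sqrt (real (n i) - 1)"
    using expectation_V[OF i] n_ge_2[OF i] n_pos[OF i]
    by (intro divide_right_mono add_left_mono) (simp_all add: divide_le_eq mult.commute)
  finally show ?thesis by simp
qed

section \<open>Normalized sums, their coordinates and variances\<close>

definition S where "S i f \<omega> = (\<Sum>j<n i. X (i, j) f \<omega>) / sqrt (real (n i) - 1)"

definition S_field where "S_field i x \<omega> = (\<Sum>j<n i. H (i, j) x \<omega>) / sqrt (real (n i) - 1)"

text \<open>Two effects are collected. There are \<open>n i\<close> summands while the normalization
  counts \<open>n i - 1\<close>, which leaves one surplus copy of \<open>c i\<close>; and the sample
  mean takes the place of the true mean 0, which subtracts the product of the path sums over
  \<open>n i\<close>.\<close>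

definition R_field where
  "R_field i x \<omega> = (c i (fst x) (snd x) - W i (fst x) \<omega> * W i (snd x) \<omega> / real (n i)) / sqrt (real (n i) - 1)"

text \<open>The variance of the coordinate along \<open>f\<close> of a single observation in sample
  \<open>i\<close>.\<close>

definition B where "B i f = (\<integral>x. f x * (\<integral>y. varpi (c i) x y * f y \<partial>Q) \<partial>Q)"

lemma S_L2: "i < k \<Longrightarrow> L2 Q f \<Longrightarrow> L2 M (S i f)"
  unfolding S_def[abs_def] using X_L2
  by (auto simp: mem_P divide_inverse mult.commute[of _ "inverse _"] intro!: L2_cmult L2_sum)

lemma X_power2: "(i, j) \<in> P \<Longrightarrow> L2 Q f \<Longrightarrow> (\<integral>\<omega>. (X (i, j) f \<omega>)\<^sup>2 \<partial>M) = B i f"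
  using expectation_mult_X[of "(i, j)" "(i, j)" f f] by (simp add: B_def power2_eq_square)

lemma B_nonneg:
  assumes "i < k" "L2 Q f" shows "0 \<le> B i f"
proof -
  have "B i f = (\<integral>\<omega>. (X (i, 0) f \<omega>)\<^sup>2 \<partial>M)"
    using X_power2[of i 0 f] n_ge_2[OF assms(1)] assms by (simp add: mem_P)
  then show ?thesis by simp
qed

lemma expectation_S_power2:
  assumes i: "i < k" and f: "L2 Q f"
  shows "(\<integral>\<omega>. (S i f \<omega>)\<^sup>2 \<partial>M) = real (n i) / (real (n i) - 1) * B i f"
proof -
  have sub: "Pair i ` {..<n i} \<subseteq> P" using i by (auto simp: P_def)
  have re: "(\<Sum>p\<in>Pair i ` {..<n i}. h p) = (\<Sum>j<n i. h (i, j))" for h :: "nat \<times> nat \<Rightarrow> real"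
    by (subst sum.reindex) (auto simp: inj_on_def)
  have "(\<integral>\<omega>. (\<Sum>j<n i. X (i, j) f \<omega>)\<^sup>2 \<partial>M) = (\<Sum>j<n i. \<integral>\<omega>. (X (i, j) f \<omega>)\<^sup>2 \<partial>M)"
    using expectation_power2_sum[OF sub f] unfolding re .
  also have "\<dots> = real (n i) * B i f" using X_power2[of i _ f] i f by (simp add: mem_P)
  finally show ?thesis
    unfolding S_def using n_pos[OF i] by (simp add: power_divide)
qed

lemma B_Bessel:
  assumes e: "orthonormal_basis Q I e" and J: "J \<subseteq> I" "finite J" and i: "i < k"
  shows "(\<Sum>r\<in>J. B i (e r)) \<le> measure Q (space Q) * sqrt K"
proof -
  have p: "(i, 0) \<in> P" using i n_ge_2[OF i] by (simp add: mem_P)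
  have "(\<Sum>r\<in>J. B i (e r)) = (\<Sum>r\<in>J. \<integral>\<omega>. (X (i, 0) (e r) \<omega>)\<^sup>2 \<partial>M)"
    using J orthonormal_basisD(1)[OF e] by (intro sum.cong refl X_power2[OF p, symmetric]) auto
  also have "\<dots> \<le> measure Q (space Q) * sqrt K"
    by (rule random_field.\<xi>_Bessel[OF random_field_H[OF p] e J])
  finally show ?thesis .
qed

lemma char_S_approx:
  assumes f: "\<And>i. i < k \<Longrightarrow> L2 Q (f i)"
    and L: "\<And>i. i < k \<Longrightarrow> ((\<integral>x. (f i x)\<^sup>2 \<partial>Q) * measure Q (space Q))\<^sup>2 * K \<le> L"
  shows "cmod ((\<integral>\<omega>. iexp (\<Sum>i<k. S i (f i) \<omega>) \<partial>M)
      - complex_of_real (exp (- (\<Sum>i<k. real (n i) / (real (n i) - 1) * B i (f i)) / 2)))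
    \<le> (\<Sum>i<k. real (n i) * ((1 / sqrt (real (n i) - 1)) ^ 3 * (1 + L) + (1 / sqrt (real (n i) - 1)) ^ 4 * L))"
proof -
  have Psum: "(\<Sum>p\<in>P. h p) = (\<Sum>i<k. \<Sum>j<n i. h (i, j))" for h :: "nat \<times> nat \<Rightarrow> real"
    unfolding P_def by (subst sum.Sigma) (auto simp: split_def)
  define s where "s p = 1 / sqrt (real (n (fst p)) - 1)" for p :: "nat \<times> nat"
  have 1: "(\<Sum>p\<in>P. s p * X p (f (fst p)) \<omega>) = (\<Sum>i<k. S i (f i) \<omega>)" for \<omega>
    unfolding Psum S_def s_def by (simp add: sum_divide_distrib)
  have "(\<Sum>p\<in>P. (s p)\<^sup>2 * (\<integral>\<omega>. (X p (f (fst p)) \<omega>)\<^sup>2 \<partial>M)) = (\<Sum>i<k. \<Sum>j<n i. B i (f i) / (real (n i) - 1))"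
    unfolding Psum using n_pos f by (intro sum.cong refl) (simp add: X_power2 mem_P s_def power_divide less_imp_le)
  then have 2: "(\<Sum>p\<in>P. (s p)\<^sup>2 * (\<integral>\<omega>. (X p (f (fst p)) \<omega>)\<^sup>2 \<partial>M))
      = (\<Sum>i<k. real (n i) / (real (n i) - 1) * B i (f i))" by simp
  have 3: "(\<Sum>p\<in>P. \<bar>s p\<bar> ^ 3 * (1 + L) + s p ^ 4 * L)
      = (\<Sum>i<k. real (n i) * ((1 / sqrt (real (n i) - 1)) ^ 3 * (1 + L) + (1 / sqrt (real (n i) - 1)) ^ 4 * L))"
    unfolding Psum s_def using n_pos by (intro sum.cong refl) (simp add: less_imp_le)
  show ?thesis
    using char_sum_approx[of "\<lambda>p. f (fst p)" L s] f L unfolding 1 2 3 by (auto simp: P_def)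
qed

text \<open>Lets a linear form in many coordinates of a sample be treated as one coordinate along
  the combined test function, so that an estimate with one test function per sample
  suffices.\<close>

lemma S_linear:
  assumes f: "\<And>r. r \<in> J \<Longrightarrow> L2 Q (f r)" and i: "i < k"
  shows "AE \<omega> in M. S i (\<lambda>x. \<Sum>r\<in>J. w r * f r x) \<omega> = (\<Sum>r\<in>J. w r * S i (f r) \<omega>)"
  using AE_good_paths
proof eventually_elim
  case (elim \<omega>)
  have "X (i, j) (\<lambda>x. \<Sum>r\<in>J. w r * f r x) \<omega> = (\<Sum>r\<in>J. w r * X (i, j) (f r) \<omega>)" if "j < n i" for j
  proof -
    have HL: "L2 Q (\<lambda>x. H (i, j) x \<omega>)" using elim i that by (auto simp: mem_P)
    have "X (i, j) (\<lambda>x. \<Sum>r\<in>J. w r * f r x) \<omega> = (\<integral>x. (\<Sum>r\<in>J. w r * (f r x * H (i, j) x \<omega>)) \<partial>Q)"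
      unfolding field_integral_def by (simp add: sum_distrib_right mult.assoc)
    also have "\<dots> = (\<Sum>r\<in>J. w r * X (i, j) (f r) \<omega>)"
      unfolding field_integral_def by (rule integral_linear_combination(2)) (intro L2_mult_integrable f HL)
    finally show ?thesis .
  qed
  then have "S i (\<lambda>x. \<Sum>r\<in>J. w r * f r x) \<omega> = (\<Sum>j<n i. \<Sum>r\<in>J. w r * X (i, j) (f r) \<omega>) / sqrt (real (n i) - 1)"
    unfolding S_def by simp
  also have "\<dots> = (\<Sum>r\<in>J. w r * S i (f r) \<omega>)"
    unfolding S_def by (subst sum.swap) (simp add: sum_distrib_left sum_divide_distrib)
  finally show ?case .
qed

section \<open>Exact decomposition of the centred sample covariances\<close>

abbreviation SC where "SC i x \<omega> \<equiv> sample_cov (n i) (\<lambda>j t. v i j t \<omega>) (fst x) (snd x)"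

text \<open>An identity and not an expansion: the factor \<open>sqrt (real (n i) - 1)\<close> is
  inverse to the scale of the alternative, so that the drift appears as \<open>d\<close>
  itself.\<close>

lemma sample_cov_decomposition:
  assumes i: "i < k" and d: "c i (fst x) (snd x) = g + d / sqrt (real (n i) - 1)"
  shows "sqrt (real (n i) - 1) * (SC i x \<omega> - g) = S_field i x \<omega> + d + R_field i x \<omega>"
proof -
  define q where "q = sqrt (real (n i) - 1)"
  define z where "z = c i (fst x) (snd x)"
  define w where "w = W i (fst x) \<omega> * W i (snd x) \<omega> / real (n i)"
  define A where "A = (\<Sum>j<n i. H (i, j) x \<omega>)"
  have q: "q > 0" "q * q = real (n i) - 1" using n_pos[OF i] by (simp_all add: q_def)
  have d': "d = q * (z - g)" using d q(1) by (simp add: z_def q_def[symmetric])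
  have "(real (n i) - 1) * SC i x \<omega> = (\<Sum>j<n i. v i j (fst x) \<omega> * v i j (snd x) \<omega>) - w"
    using n_ge_2[OF i] by (subst sample_cov_eq) (auto simp: w_def W_def)
  also have "(\<Sum>j<n i. v i j (fst x) \<omega> * v i j (snd x) \<omega>) = A + (q * q + 1) * z"
    by (simp add: A_def H_def sum_subtractf z_def q(2))
  finally have "q * (q * SC i x \<omega>) = A + (q * q + 1) * z - w" by (simp add: q(2) flip: mult.assoc)
  then have "q * (q * (SC i x \<omega> - g)) = A + q * d + (z - w)"
    by (simp add: d' algebra_simps)
  then have "q * (SC i x \<omega> - g) = (A + q * d + (z - w)) / q" using q(1) by (simp add: field_simps)
  also have "\<dots> = A / q + d + (z - w) / q" using q(1) by (simp add: field_simps)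
  finally show ?thesis by (simp add: q_def S_field_def R_field_def A_def z_def w_def)
qed

lemma sum_n_pos: "0 < k \<Longrightarrow> 0 < (\<Sum>i<k. real (n i) - 1)"
  using n_pos by (intro sum_pos) auto

text \<open>The finite-sample counterpart of \<open>sqrt (\<tau> i)\<close>. Counting
  \<open>n i - 1\<close> makes it an exact unit vector at every sample size, and centring by the
  pooled covariance an exact orthogonal projection.\<close>

definition weight where "weight i = sqrt ((real (n i) - 1) / (\<Sum>i<k. real (n i) - 1))"

lemma weight_norm: "0 < k \<Longrightarrow> (\<Sum>i<k. (weight i)\<^sup>2) = 1"
proof -
  assume "0 < k"
  from sum_n_pos[OF this] have pos: "0 < (\<Sum>i<k. real (n i) - 1)" .
  have "(\<Sum>i<k. (weight i)\<^sup>2) = (\<Sum>i<k. (real (n i) - 1) / (\<Sum>i<k. real (n i) - 1))"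
    unfolding weight_def using n_pos pos by (intro sum.cong refl real_sqrt_pow2) (simp add: less_imp_le)
  also have "\<dots> = 1" using pos by (simp flip: sum_divide_distrib)
  finally show ?thesis .
qed

text \<open>The pooled covariance is a weighted mean, so any common reference value \<open>g\<close>
  cancels. After scaling by the roots, subtracting it is the projection orthogonal to the unit
  vector \<open>weight\<close>.\<close>

lemma centred_by_pooled:
  assumes i: "i < k"
  shows "sqrt (real (n i) - 1) * (SC i x \<omega> - pooled_cov k n (\<lambda>i j t. v i j t \<omega>) (fst x) (snd x))
    = sqrt (real (n i) - 1) * (SC i x \<omega> - g)
      - weight i * (\<Sum>j<k. weight j * (sqrt (real (n j) - 1) * (SC j x \<omega> - g)))"
proof -
  define N where "N = (\<Sum>i<k. real (n i) - 1)"
  have N: "0 < N" using sum_n_pos i by (simp add: N_def)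
  have N_eq: "real (\<Sum>i<k. n i) - real k = N" by (simp add: N_def sum_subtractf)
  have pool: "pooled_cov k n (\<lambda>i j t. v i j t \<omega>) (fst x) (snd x) = (\<Sum>j<k. (real (n j) - 1) * SC j x \<omega>) / N"
    by (simp only: pooled_cov_def N_eq)
  have "(\<Sum>j<k. weight j * (sqrt (real (n j) - 1) * (SC j x \<omega> - g))) = (\<Sum>j<k. (real (n j) - 1) * (SC j x \<omega> - g) / sqrt N)"
  proof (intro sum.cong refl)
    fix j assume "j \<in> {..<k}"
    then have "0 < real (n j) - 1" using n_pos by simp
    then show "weight j * (sqrt (real (n j) - 1) * (SC j x \<omega> - g)) = (real (n j) - 1) * (SC j x \<omega> - g) / sqrt N"
      by (simp add: weight_def N_def[symmetric] real_sqrt_divide)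
  qed
  also have "\<dots> = ((\<Sum>j<k. (real (n j) - 1) * SC j x \<omega>) - N * g) / sqrt N"
  proof -
    have "(\<Sum>j<k. (real (n j) - 1) * g) = N * g" by (simp only: N_def sum_distrib_right)
    then show ?thesis by (simp add: right_diff_distrib sum_subtractf flip: sum_divide_distrib)
  qed
  finally have "weight i * (\<Sum>j<k. weight j * (sqrt (real (n j) - 1) * (SC j x \<omega> - g)))
    = sqrt (real (n i) - 1) * (((\<Sum>j<k. (real (n j) - 1) * SC j x \<omega>) - N * g) / (sqrt N * sqrt N))"
    by (simp add: weight_def N_def[symmetric] real_sqrt_divide)
  also have "\<dots> = sqrt (real (n i) - 1) * (((\<Sum>j<k. (real (n j) - 1) * SC j x \<omega>) - N * g) / N)"
    using N by simp
  also have "((\<Sum>j<k. (real (n j) - 1) * SC j x \<omega>) - N * g) / N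
    = pooled_cov k n (\<lambda>i j t. v i j t \<omega>) (fst x) (snd x) - g"
    unfolding pool using N by (simp add: diff_divide_distrib)
  finally show ?thesis by (simp add: algebra_simps)
qed

text \<open>The norm of a tensor square factors, which gives \<open>V i\<close> for the path sums.
  The sum of two squares is finally enlarged to the square of the sum to reach the closed form of
  \<open>\<rho>\<close>.\<close>

lemma R_field_L2:
  assumes i: "i < k" and W: "L2 \<mu> (\<lambda>t. W i t \<omega>)"
  shows "L2 Q (\<lambda>x. R_field i x \<omega>)" and "(\<integral>x. (R_field i x \<omega>)\<^sup>2 \<partial>Q) \<le> 2 * (\<rho> i \<omega>)\<^sup>2"
proof -
  define q where "q = real (n i) - 1"
  have q: "q > 0" using n_pos[OF i] by (simp add: q_def)
  have ni: "real (n i) > 0" using n_ge_2[OF i] by simp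
  note WL = L2_cmult[OF L2_tensor(1)[OF W W], of "1 / real (n i)"]
  have RL: "L2 Q (\<lambda>x. 1 / sqrt q * (c i (fst x) (snd x) - 1 / real (n i) * (W i (fst x) \<omega> * W i (snd x) \<omega>)))"
    by (intro L2_cmult L2_diff c_L2[OF i] WL)
  then show L: "L2 Q (\<lambda>x. R_field i x \<omega>)" by (simp add: R_field_def q_def)
  have "(\<integral>x. (R_field i x \<omega>)\<^sup>2 \<partial>Q)
    \<le> (\<integral>x. 2 / q * (C\<^sup>2 + (1 / real (n i) * (W i (fst x) \<omega> * W i (snd x) \<omega>))\<^sup>2) \<partial>Q)"
  proof (rule integral_mono)
    fix x assume x: "x \<in> space Q"
    have "(y - z)\<^sup>2 \<le> 2 * (y\<^sup>2 + z\<^sup>2)" for y z :: real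
      using zero_le_power2[of "y + z"] by (simp add: power2_sum power2_diff)
    moreover have "(c i (fst x) (snd x))\<^sup>2 \<le> C\<^sup>2"
      using c_bound[OF i mem_space_square[OF x]] C_nonneg[OF i] by (simp add: abs_le_square_iff[symmetric])
    ultimately have "(c i (fst x) (snd x) - 1 / real (n i) * (W i (fst x) \<omega> * W i (snd x) \<omega>))\<^sup>2
      \<le> 2 * (C\<^sup>2 + (1 / real (n i) * (W i (fst x) \<omega> * W i (snd x) \<omega>))\<^sup>2)"
      by (smt (verit))
    then have "(c i (fst x) (snd x) - 1 / real (n i) * (W i (fst x) \<omega> * W i (snd x) \<omega>))\<^sup>2 / q
      \<le> 2 * (C\<^sup>2 + (1 / real (n i) * (W i (fst x) \<omega> * W i (snd x) \<omega>))\<^sup>2) / q"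
      using q by (intro divide_right_mono) auto
    then show "(R_field i x \<omega>)\<^sup>2 \<le> 2 / q * (C\<^sup>2 + (1 / real (n i) * (W i (fst x) \<omega> * W i (snd x) \<omega>))\<^sup>2)"
      using q by (simp add: R_field_def q_def[symmetric] power_divide)
  next
    show "integrable Q (\<lambda>x. 2 / q * (C\<^sup>2 + (1 / real (n i) * (W i (fst x) \<omega> * W i (snd x) \<omega>))\<^sup>2))"
      using L2_power2_integrable[OF WL] by simp
  qed (rule L2_power2_integrable[OF L])
  also have "\<dots> = 2 / q * (C\<^sup>2 * measure Q (space Q) + (\<integral>x. (1 / real (n i) * (W i (fst x) \<omega> * W i (snd x) \<omega>))\<^sup>2 \<partial>Q))"
    using L2_power2_integrable[OF WL] by simp
  also have "(\<integral>x. (1 / real (n i) * (W i (fst x) \<omega> * W i (snd x) \<omega>))\<^sup>2 \<partial>Q) = (V i \<omega> / real (n i))\<^sup>2"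
    using L2_tensor(2)[OF W W] by (simp add: power_mult_distrib power_divide V_def power2_eq_square)
  also have "measure Q (space Q) = (b - a)\<^sup>2"
  proof -
    have "measure Q (space Q) = measure \<mu> {a..b} * measure \<mu> {a..b}"
      unfolding square_measure_def space_pair_measure
      using \<mu>.emeasure_pair_measure_Times[of "{a..b}" \<mu> "{a..b}"] sets.top[of \<mu>]
      by (simp add: measure_def enn2real_mult)
    then show ?thesis using ab by (simp add: measure_interval_measure power2_eq_square)
  qed
  also have "2 / q * (C\<^sup>2 * (b - a)\<^sup>2 + (V i \<omega> / real (n i))\<^sup>2) \<le> 2 / q * (C * (b - a) + V i \<omega> / real (n i))\<^sup>2"
  proof (rule mult_left_mono)
    have "0 \<le> C * (b - a)" "0 \<le> V i \<omega> / real (n i)"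
      using C_nonneg[OF i] ab by (simp_all add: V_def)
    then have "0 \<le> C * (b - a) * (V i \<omega> / real (n i))" by (rule mult_nonneg_nonneg)
    then show "C\<^sup>2 * (b - a)\<^sup>2 + (V i \<omega> / real (n i))\<^sup>2 \<le> (C * (b - a) + V i \<omega> / real (n i))\<^sup>2"
      unfolding power2_sum by (simp add: power_mult_distrib)
  qed (use q in simp)
  also have "\<dots> = 2 * (\<rho> i \<omega>)\<^sup>2"
    using q by (simp add: \<rho>_def q_def[symmetric] power_divide)
  finally show "(\<integral>x. (R_field i x \<omega>)\<^sup>2 \<partial>Q) \<le> 2 * (\<rho> i \<omega>)\<^sup>2" .
qed

lemma W_path_L2:
  assumes "\<forall>p\<in>P. L2 Q (\<lambda>x. H p x \<omega>) \<and> L2 \<mu> (\<lambda>t. v (fst p) (snd p) t \<omega>)" and "i < k"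
  shows "L2 \<mu> (\<lambda>t. W i t \<omega>)"
  unfolding W_def
proof (rule L2_sum)
  fix j assume "j \<in> {..<n i}"
  then have "(i, j) \<in> P" using assms(2) by (simp add: mem_P)
  with assms(1) show "L2 \<mu> (\<lambda>t. v i j t \<omega>)" by force
qed

definition E where "E i f \<omega> = (\<integral>x. R_field i x \<omega> * f x \<partial>Q)"

lemma E_Bessel:
  assumes e: "orthonormal_basis Q I e" and J: "\<And>R. J R \<subseteq> I" "\<And>R::nat. finite (J R)" and i: "i < k"
  shows "AE \<omega> in M. \<forall>R. (\<Sum>r\<in>J R. (E i (e r) \<omega>)\<^sup>2) \<le> 2 * (\<rho> i \<omega>)\<^sup>2"
  using AE_good_paths
proof eventually_elim
  case (elim \<omega>)
  note R = R_field_L2[OF i W_path_L2[OF elim i]]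
  show ?case
    using orthonormal_Bessel[OF e J R(1)] R(2) unfolding E_def by (meson order_trans)
qed

lemma R_field_measurable:
  assumes i: "i < k" shows "(\<lambda>(\<omega>, x). R_field i x \<omega>) \<in> borel_measurable (M \<Otimes>\<^sub>M Q)"
proof -
  have "(\<lambda>z. v i j (fst (snd z)) (fst z)) \<in> borel_measurable (M \<Otimes>\<^sub>M Q)"
    and "(\<lambda>z. v i j (snd (snd z)) (fst z)) \<in> borel_measurable (M \<Otimes>\<^sub>M Q)" if "j < n i" for j
    by (rule v_pair_measurable[OF i that]; measurable)+
  moreover have "(\<lambda>z. c i (fst (snd z)) (snd (snd z))) \<in> borel_measurable (M \<Otimes>\<^sub>M Q)"
    by (rule measurable_compose[OF measurable_snd c_measurable[OF i]])
  ultimately show ?thesis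
    unfolding R_field_def W_def split_def
    by (intro borel_measurable_divide borel_measurable_diff borel_measurable_times borel_measurable_sum
      borel_measurable_const) auto
qed

lemma E_measurable:
  assumes i: "i < k" and f: "L2 Q f" shows "E i f \<in> borel_measurable M"
proof -
  have "(\<lambda>(\<omega>, x). R_field i x \<omega> * f x) \<in> borel_measurable (M \<Otimes>\<^sub>M Q)"
    using R_field_measurable[OF i] measurable_compose[OF measurable_snd L2_measurable[OF f], of M]
    unfolding split_def by (intro borel_measurable_times)
  then show ?thesis unfolding E_def[abs_def] by (rule Q.borel_measurable_lebesgue_integral)
qed

section \<open>The statistic: measurability and series representation\<close>

abbreviation T where "T \<omega> \<equiv> T_statistic a b k n (\<lambda>i j t. v i j t \<omega>)"

lemma T_measurable: "T \<in> borel_measurable M"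
proof -
  have v1: "(\<lambda>z. v i j (snd (fst z)) (fst (fst z))) \<in> borel_measurable ((M \<Otimes>\<^sub>M \<mu>) \<Otimes>\<^sub>M \<mu>)"
    and v2: "(\<lambda>z. v i j (snd z) (fst (fst z))) \<in> borel_measurable ((M \<Otimes>\<^sub>M \<mu>) \<Otimes>\<^sub>M \<mu>)"
    if "i < k" "j < n i" for i j
    by (rule v_pair_measurable[OF that]; measurable)+
  have sc: "(\<lambda>z. sample_cov (n i) (\<lambda>j t. v i j t (fst (fst z))) (snd (fst z)) (snd z))
    \<in> borel_measurable ((M \<Otimes>\<^sub>M \<mu>) \<Otimes>\<^sub>M \<mu>)" if "i < k" for i
    unfolding sample_cov_def sample_mean_def
    by (intro borel_measurable_divide borel_measurable_diff borel_measurable_times borel_measurable_sum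
      borel_measurable_const v1 v2 that) auto
  have pc: "(\<lambda>z. pooled_cov k n (\<lambda>i j t. v i j t (fst (fst z))) (snd (fst z)) (snd z))
    \<in> borel_measurable ((M \<Otimes>\<^sub>M \<mu>) \<Otimes>\<^sub>M \<mu>)"
    unfolding pooled_cov_def
    by (intro borel_measurable_divide borel_measurable_diff borel_measurable_times borel_measurable_sum
      borel_measurable_const sc) auto
  have "(\<lambda>(\<omega>, s). \<integral>t. (sample_cov (n i) (\<lambda>j t. v i j t \<omega>) s t - pooled_cov k n (\<lambda>i j t. v i j t \<omega>) s t)\<^sup>2 \<partial>\<mu>)
    \<in> borel_measurable (M \<Otimes>\<^sub>M \<mu>)" if "i < k" for i
    unfolding split_def
    by (rule \<mu>.borel_measurable_lebesgue_integral)
      (use sc[OF that] pc in \<open>simp add: split_def borel_measurable_power borel_measurable_diff\<close>)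
  then have "(\<lambda>\<omega>. \<integral>s. (\<integral>t. (sample_cov (n i) (\<lambda>j t. v i j t \<omega>) s t - pooled_cov k n (\<lambda>i j t. v i j t \<omega>) s t)\<^sup>2 \<partial>\<mu>) \<partial>\<mu>)
    \<in> borel_measurable M" if "i < k" for i
    using that by (intro \<mu>.borel_measurable_lebesgue_integral)
  then show ?thesis
    unfolding T_statistic_def
    by (intro borel_measurable_sum borel_measurable_times borel_measurable_const) auto
qed

lemma T_nonneg: "0 \<le> T \<omega>"
  unfolding T_statistic_def using n_pos
  by (intro sum_nonneg mult_nonneg_nonneg Bochner_Integration.integral_nonneg) (auto simp: less_imp_le)

text \<open>Centring acts linearly across the samples and commutes with taking coordinates on the
  square. Hence Parseval for each of the \<open>k\<close> projected fields gives the series, with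
  the same projection applied to the coordinates.\<close>

lemma T_Parseval:
  assumes e: "orthonormal_basis Q I e"
    and J: "\<And>R. J R \<subseteq> I" "\<And>R::nat. finite (J R)" "incseq J" "(\<Union>R. J R) = I"
    and alt: "\<And>i s t. i < k \<Longrightarrow> s \<in> {a..b} \<Longrightarrow> t \<in> {a..b} \<Longrightarrow> c i s t = g s t + d i s t / sqrt (real (n i) - 1)"
    and d: "\<And>i. i < k \<Longrightarrow> L2 Q (\<lambda>x. d i (fst x) (snd x))"
  defines "Z \<equiv> \<lambda>i r \<omega>. S i (e r) \<omega> + (\<integral>x. d i (fst x) (snd x) * e r x \<partial>Q) + E i (e r) \<omega>"
  shows "AE \<omega> in M. (\<lambda>R. \<Sum>r\<in>J R. \<Sum>i<k. (Z i r \<omega> - weight i * (\<Sum>j<k. weight j * Z j r \<omega>))\<^sup>2) \<longlonglongrightarrow> T \<omega>"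
  using AE_good_paths
proof eventually_elim
  case (elim \<omega>)
  have eL: "r \<in> I \<Longrightarrow> L2 Q (e r)" for r by (rule orthonormal_basisD(1)[OF e])
  define z where "z i x = S_field i x \<omega> + d i (fst x) (snd x) + R_field i x \<omega>" for i x
  define y where "y i x = z i x - weight i * (\<Sum>j<k. weight j * z j x)" for i x
  have HL: "L2 Q (\<lambda>x. H (i, j) x \<omega>)" if "i < k" "j < n i" for i j
    using elim that by (auto simp: mem_P)
  have SL: "L2 Q (\<lambda>x. 1 / sqrt (real (n i) - 1) * (\<Sum>j<n i. H (i, j) x \<omega>))" if "i < k" for i
    using HL that by (intro L2_cmult L2_sum) auto
  then have SL: "L2 Q (\<lambda>x. S_field i x \<omega>)" if "i < k" for i
    using that by (simp add: S_field_def)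
  have RL: "L2 Q (\<lambda>x. R_field i x \<omega>)" if "i < k" for i
    by (rule R_field_L2[OF that W_path_L2[OF elim that]])
  have zL: "L2 Q (z i)" if "i < k" for i
    unfolding z_def[abs_def] by (intro L2_add SL d RL that)
  have yL: "L2 Q (y i)" if "i < k" for i
    unfolding y_def[abs_def] by (intro L2_diff L2_cmult L2_sum zL that) auto
  have z_eq: "sqrt (real (n i) - 1) * (SC i x \<omega> - g (fst x) (snd x)) = z i x" if "i < k" "x \<in> space Q" for i x
    unfolding z_def using sample_cov_decomposition[OF that(1)] alt[OF that(1) mem_space_square[OF that(2)]] .
  have y_eq: "y i x = sqrt (real (n i) - 1) * (SC i x \<omega> - pooled_cov k n (\<lambda>i j t. v i j t \<omega>) (fst x) (snd x))"
    if "i < k" "x \<in> space Q" for i x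
    unfolding centred_by_pooled[OF that(1), where g = "g (fst x) (snd x)"] y_def using z_eq that by simp
  have T_eq: "T \<omega> = (\<Sum>i<k. \<integral>x. (y i x)\<^sup>2 \<partial>Q)"
    unfolding T_statistic_def
  proof (intro sum.cong refl)
    fix i assume "i \<in> {..<k}"
    then have i: "i < k" by simp
    define h where "h s t = sample_cov (n i) (\<lambda>j t. v i j t \<omega>) s t - pooled_cov k n (\<lambda>i j t. v i j t \<omega>) s t" for s t
    have "(\<integral>x. (y i x)\<^sup>2 \<partial>Q) = (\<integral>s. (\<integral>t. (y i (s, t))\<^sup>2 \<partial>\<mu>) \<partial>\<mu>)"
      by (rule square_iterated_integral[OF L2_power2_integrable[OF yL[OF i]], symmetric])
    also have "\<dots> = (\<integral>s. (\<integral>t. (real (n i) - 1) * (h s t)\<^sup>2 \<partial>\<mu>) \<partial>\<mu>)"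
      using y_eq[OF i] n_pos[OF i]
      by (intro Bochner_Integration.integral_cong refl)
        (simp add: space_square_measure power_mult_distrib h_def less_imp_le)
    finally show "(real (n i) - 1) * (\<integral>s. (\<integral>t. (sample_cov (n i) (\<lambda>j t. v i j t \<omega>) s t
        - pooled_cov k n (\<lambda>i j t. v i j t \<omega>) s t)\<^sup>2 \<partial>\<mu>) \<partial>\<mu>) = (\<integral>x. (y i x)\<^sup>2 \<partial>Q)"
      by (simp add: h_def)
  qed
  have z_coord: "(\<integral>x. z i x * e r x \<partial>Q) = Z i r \<omega>" if i: "i < k" and r: "r \<in> I" for i r
  proof -
    have "(\<integral>x. z i x * e r x \<partial>Q) = (\<integral>x. S_field i x \<omega> * e r x + d i (fst x) (snd x) * e r x + R_field i x \<omega> * e r x \<partial>Q)"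
      by (simp add: z_def distrib_right)
    also have "\<dots> = (\<integral>x. S_field i x \<omega> * e r x \<partial>Q) + (\<integral>x. d i (fst x) (snd x) * e r x \<partial>Q) + E i (e r) \<omega>"
      unfolding E_def using L2_mult_integrable[OF SL[OF i] eL[OF r]] L2_mult_integrable[OF d[OF i] eL[OF r]]
        L2_mult_integrable[OF RL[OF i] eL[OF r]] by simp
    also have "(\<integral>x. S_field i x \<omega> * e r x \<partial>Q)
      = (\<integral>x. (\<Sum>j<n i. 1 / sqrt (real (n i) - 1) * (e r x * H (i, j) x \<omega>)) \<partial>Q)"
      by (simp add: S_field_def sum_divide_distrib sum_distrib_left mult.commute)
    also have "\<dots> = (\<Sum>j<n i. 1 / sqrt (real (n i) - 1) * (\<integral>x. e r x * H (i, j) x \<omega> \<partial>Q))"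
      by (rule integral_linear_combination(2)) (use i r in \<open>auto intro!: L2_mult_integrable eL HL\<close>)
    also have "\<dots> = S i (e r) \<omega>"
      by (simp add: S_def field_integral_def sum_divide_distrib)
    finally show ?thesis by (simp add: Z_def)
  qed
  have y_coord: "(\<integral>x. y i x * e r x \<partial>Q) = Z i r \<omega> - weight i * (\<Sum>j<k. weight j * Z j r \<omega>)"
    if i: "i < k" and r: "r \<in> I" for i r
  proof -
    have int: "integrable Q (\<lambda>x. z j x * e r x)" if "j \<in> {..<k}" for j
      using that by (intro L2_mult_integrable zL eL r) auto
    note comb = integral_linear_combination[of "{..<k}" Q "\<lambda>j x. z j x * e r x" weight, OF int]
    have "(\<integral>x. y i x * e r x \<partial>Q) = (\<integral>x. z i x * e r x - weight i * (\<Sum>j<k. weight j * (z j x * e r x)) \<partial>Q)"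
      by (simp add: y_def left_diff_distrib sum_distrib_right mult.assoc)
    also have "\<dots> = (\<integral>x. z i x * e r x \<partial>Q) - weight i * (\<Sum>j<k. weight j * (\<integral>x. z j x * e r x \<partial>Q))"
      using int[of i] i comb by simp
    finally show ?thesis using z_coord i r by simp
  qed
  have "(\<lambda>R. \<Sum>i<k. \<Sum>r\<in>J R. (\<integral>x. y i x * e r x \<partial>Q)\<^sup>2) \<longlonglongrightarrow> (\<Sum>i<k. \<integral>x. (y i x)\<^sup>2 \<partial>Q)"
    by (intro tendsto_sum Q.orthonormal_Parseval[OF e _ J] yL) auto
  moreover have "(\<Sum>i<k. \<Sum>r\<in>J R. (\<integral>x. y i x * e r x \<partial>Q)\<^sup>2)
    = (\<Sum>r\<in>J R. \<Sum>i<k. (Z i r \<omega> - weight i * (\<Sum>j<k. weight j * Z j r \<omega>))\<^sup>2)" for R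
    using J(1)[of R] by (subst sum.swap) (auto intro!: sum.cong simp: y_coord)
  ultimately show ?case unfolding T_eq by simp
qed

end

section \<open>Quadratic forms of perturbed kernels\<close>

definition kernel_form :: "'x measure \<Rightarrow> ('x \<Rightarrow> 'x \<Rightarrow> real) \<Rightarrow> ('x \<Rightarrow> real) \<Rightarrow> real" where
  "kernel_form Q \<kappa> f = (\<integral>x. f x * (\<integral>y. \<kappa> x y * f y \<partial>Q) \<partial>Q)"

definition bounded_kernel :: "'x measure \<Rightarrow> ('x \<Rightarrow> 'x \<Rightarrow> real) \<Rightarrow> bool" where
  "bounded_kernel Q \<kappa> \<longleftrightarrow> (\<lambda>(x, y). \<kappa> x y) \<in> borel_measurable (Q \<Otimes>\<^sub>M Q) \<and>
     (\<exists>C. \<forall>x\<in>space Q. \<forall>y\<in>space Q. \<bar>\<kappa> x y\<bar> \<le> C)"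

lemma (in finite_measure) bounded_kernel_L2:
  assumes \<kappa>: "bounded_kernel M \<kappa>" and f: "L2 M f"
  shows "x \<in> space M \<Longrightarrow> integrable M (\<lambda>y. \<kappa> x y * f y)"
    and "L2 M (\<lambda>x. \<integral>y. \<kappa> x y * f y \<partial>M)"
proof -
  note [measurable] = L2_measurable[OF f]
  from \<kappa> have [measurable]: "(\<lambda>(x, y). \<kappa> x y) \<in> borel_measurable (M \<Otimes>\<^sub>M M)"
    by (simp add: bounded_kernel_def)
  from \<kappa> obtain C where C: "\<And>x y. x \<in> space M \<Longrightarrow> y \<in> space M \<Longrightarrow> \<bar>\<kappa> x y\<bar> \<le> C"
    unfolding bounded_kernel_def by blast
  show int: "integrable M (\<lambda>y. \<kappa> x y * f y)" if "x \<in> space M" for x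
  proof (rule L2_mult_integrable[OF L2_bounded f])
    show "\<kappa> x \<in> borel_measurable M" using that by measurable
  qed (use C that in auto)
  show "L2 M (\<lambda>x. \<integral>y. \<kappa> x y * f y \<partial>M)"
  proof (rule L2_bounded[of _ "\<integral>y. C * \<bar>f y\<bar> \<partial>M"])
    fix x assume x: "x \<in> space M"
    have "\<bar>\<integral>y. \<kappa> x y * f y \<partial>M\<bar> \<le> (\<integral>y. \<bar>\<kappa> x y * f y\<bar> \<partial>M)" by (rule integral_abs_bound)
    also have "\<dots> \<le> (\<integral>y. C * \<bar>f y\<bar> \<partial>M)"
    proof (rule integral_mono)
      show "integrable M (\<lambda>y. \<bar>\<kappa> x y * f y\<bar>)" using int[OF x] by (rule integrable_abs)
      show "integrable M (\<lambda>y. C * \<bar>f y\<bar>)" using L2_integrable[OF f] by simp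
      show "\<bar>\<kappa> x y * f y\<bar> \<le> C * \<bar>f y\<bar>" if "y \<in> space M" for y
        unfolding abs_mult using C[OF x that] by (rule mult_right_mono) simp
    qed
    finally show "\<bar>\<integral>y. \<kappa> x y * f y \<partial>M\<bar> \<le> (\<integral>y. C * \<bar>f y\<bar> \<partial>M)" .
  qed measurable
qed

lemma (in finite_measure) kernel_form_quadratic:
  assumes k: "bounded_kernel M k0" "bounded_kernel M k1" "bounded_kernel M k2" and f: "L2 M f"
    and eq: "\<And>x y. x \<in> space M \<Longrightarrow> y \<in> space M \<Longrightarrow> \<kappa> x y = k0 x y + e * k1 x y + e\<^sup>2 * k2 x y"
  shows "kernel_form M \<kappa> f = kernel_form M k0 f + e * kernel_form M k1 f + e\<^sup>2 * kernel_form M k2 f"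
proof -
  have inner: "(\<integral>y. \<kappa> x y * f y \<partial>M) = (\<integral>y. k0 x y * f y \<partial>M) + e * (\<integral>y. k1 x y * f y \<partial>M) + e\<^sup>2 * (\<integral>y. k2 x y * f y \<partial>M)"
    if x: "x \<in> space M" for x
  proof -
    have "(\<integral>y. \<kappa> x y * f y \<partial>M) = (\<integral>y. k0 x y * f y + e * (k1 x y * f y) + e\<^sup>2 * (k2 x y * f y) \<partial>M)"
      using x by (intro Bochner_Integration.integral_cong) (auto simp: eq algebra_simps)
    then show ?thesis
      using bounded_kernel_L2(1)[OF k(1) f x] bounded_kernel_L2(1)[OF k(2) f x] bounded_kernel_L2(1)[OF k(3) f x] by simp
  qed
  have "kernel_form M \<kappa> f = (\<integral>x. f x * (\<integral>y. k0 x y * f y \<partial>M) + e * (f x * (\<integral>y. k1 x y * f y \<partial>M))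
      + e\<^sup>2 * (f x * (\<integral>y. k2 x y * f y \<partial>M)) \<partial>M)"
    unfolding kernel_form_def
    by (intro Bochner_Integration.integral_cong refl) (simp only: inner distrib_left mult.left_commute)
  then show ?thesis
    using L2_mult_integrable[OF f bounded_kernel_L2(2)[OF k(1) f]] L2_mult_integrable[OF f bounded_kernel_L2(2)[OF k(2) f]]
      L2_mult_integrable[OF f bounded_kernel_L2(2)[OF k(3) f]]
    by (simp add: kernel_form_def)
qed

text \<open>The eigenvalue equations hold only almost everywhere; for finitely many of them the
  exceptional sets combine, and orthonormality then diagonalizes the form.\<close>

lemma (in finite_measure) kernel_form_eigen:
  assumes \<kappa>: "bounded_kernel M \<kappa>" and e: "orthonormal_basis M I e" and J: "J \<subseteq> I" "finite J"
    and eig: "\<And>r. r \<in> I \<Longrightarrow> eigenfunction M \<kappa> (l r) (e r)"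
  shows "kernel_form M \<kappa> (\<lambda>x. \<Sum>r\<in>J. w r * e r x) = (\<Sum>r\<in>J. (w r)\<^sup>2 * l r)"
proof -
  define f where "f x = (\<Sum>r\<in>J. w r * e r x)" for x
  have eL: "r \<in> J \<Longrightarrow> L2 M (e r)" for r using J orthonormal_basisD(1)[OF e] by auto
  have fL: "L2 M f" unfolding f_def[abs_def] by (intro L2_sum L2_cmult eL)
  have "AE x in M. \<forall>r\<in>J. (\<integral>y. \<kappa> x y * e r y \<partial>M) = l r * e r x"
    using eig J by (intro AE_finite_allI) (auto simp: eigenfunction_def)
  then have AE: "AE x in M. (\<integral>y. \<kappa> x y * f y \<partial>M) = (\<Sum>r\<in>J. w r * l r * e r x)"
    using AE_space
  proof eventually_elim
    case (elim x)
    have "(\<integral>y. \<kappa> x y * f y \<partial>M) = (\<integral>y. (\<Sum>r\<in>J. w r * (\<kappa> x y * e r y)) \<partial>M)"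
      by (simp add: f_def sum_distrib_left mult_ac)
    also have "\<dots> = (\<Sum>r\<in>J. w r * (\<integral>y. \<kappa> x y * e r y \<partial>M))"
      by (rule integral_linear_combination(2)) (rule bounded_kernel_L2(1)[OF \<kappa> eL elim(2)])
    also have "\<dots> = (\<Sum>r\<in>J. w r * l r * e r x)"
      using elim by (intro sum.cong) auto
    finally show ?case .
  qed
  have "kernel_form M \<kappa> f = (\<integral>x. (\<Sum>r\<in>J. w r * l r * (f x * e r x)) \<partial>M)"
    unfolding kernel_form_def
  proof (rule integral_cong_AE)
    show "AE x in M. f x * (\<integral>y. \<kappa> x y * f y \<partial>M) = (\<Sum>r\<in>J. w r * l r * (f x * e r x))"
      using AE by eventually_elim (simp add: sum_distrib_left mult_ac)
    show "(\<lambda>x. f x * (\<integral>y. \<kappa> x y * f y \<partial>M)) \<in> borel_measurable M"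
      using L2_measurable[OF fL] L2_measurable[OF bounded_kernel_L2(2)[OF \<kappa> fL]] by measurable
    show "(\<lambda>x. \<Sum>r\<in>J. w r * l r * (f x * e r x)) \<in> borel_measurable M"
      using L2_measurable[OF fL] L2_measurable[OF eL] by (intro borel_measurable_sum borel_measurable_times) auto
  qed
  also have "\<dots> = (\<Sum>r\<in>J. w r * l r * (\<integral>x. f x * e r x \<partial>M))"
    by (rule integral_linear_combination(2)) (intro L2_mult_integrable fL eL)
  also have "\<dots> = (\<Sum>r\<in>J. (w r)\<^sup>2 * l r)"
    unfolding f_def using J orthonormal_inner_sum[OF e J]
    by (intro sum.cong refl) (auto simp: power2_eq_square subset_iff)
  finally show ?thesis by (simp add: f_def[abs_def])
qed

text \<open>The first-order term in \<open>e\<close> of \<open>varpi\<close> at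
  \<open>c + e d\<close>, twice the bilinear form that polarizes \<open>varpi\<close>.\<close>

definition varpi_mixed :: "(real \<Rightarrow> real \<Rightarrow> real) \<Rightarrow> (real \<Rightarrow> real \<Rightarrow> real) \<Rightarrow> real \<times> real \<Rightarrow> real \<times> real \<Rightarrow> real" where
  "varpi_mixed c d = (\<lambda>(s1, t1) (s2, t2). c s1 s2 * d t1 t2 + d s1 s2 * c t1 t2 + c s1 t2 * d s2 t1 + d s1 t2 * c s2 t1)"

lemma varpi_perturbation:
  assumes "\<And>s t. s \<in> {a..b} \<Longrightarrow> t \<in> {a..b} \<Longrightarrow> c' s t = c s t + d s t * e"
    and "x \<in> space (square_measure a b)" "y \<in> space (square_measure a b)"
  shows "varpi c' x y = varpi c x y + e * varpi_mixed c d x y + e\<^sup>2 * varpi d x y"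
  using assms by (auto simp: space_square_measure varpi_def varpi_mixed_def power2_eq_square algebra_simps)

section \<open>Bounded measurable kernels built from bivariate functions\<close>

definition bounded_bivariate :: "real \<Rightarrow> real \<Rightarrow> (real \<Rightarrow> real \<Rightarrow> real) \<Rightarrow> bool" where
  "bounded_bivariate a b c \<longleftrightarrow> (\<lambda>x. c (fst x) (snd x)) \<in> borel_measurable (square_measure a b) \<and>
     (\<exists>C. \<forall>s\<in>{a..b}. \<forall>t\<in>{a..b}. \<bar>c s t\<bar> \<le> C)"

lemma bounded_bivariate_L2:
  assumes "bounded_bivariate a b c"
  shows "L2 (square_measure a b) (\<lambda>x. c (fst x) (snd x))"
proof -
  obtain C where "\<And>s t. s \<in> {a..b} \<Longrightarrow> t \<in> {a..b} \<Longrightarrow> \<bar>c s t\<bar> \<le> C"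
    using assms unfolding bounded_bivariate_def by blast
  then show ?thesis
    using assms mem_space_square unfolding bounded_bivariate_def
    by (intro finite_measure.L2_bounded[OF finite_square_measure, of _ _ _ C]) blast+
qed

text \<open>One statement for all products in \<open>varpi\<close> and \<open>varpi_mixed\<close>.
  The flag \<open>sw\<close> is needed because in the second half of these kernels the last factor
  takes its first argument from \<open>y\<close> and its second from \<open>x\<close>.\<close>

lemma bounded_kernel_product:
  fixes p q p' q' :: "real \<times> real \<Rightarrow> real"
  assumes c: "bounded_bivariate a b c" and d: "bounded_bivariate a b d"
    and pq: "f \<in> {fst, snd}" "g \<in> {fst, snd}" "f' \<in> {fst, snd}" "g' \<in> {fst, snd}"
  shows "bounded_kernel (square_measure a b) (\<lambda>x y. c (f x) (g y) * d (f' (if sw then y else x)) (g' (if sw then x else y)))"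
proof -
  let ?Q = "square_measure a b"
  have comp: "(\<lambda>z. c (h z) (h' z)) \<in> borel_measurable (?Q \<Otimes>\<^sub>M ?Q)"
    if "bounded_bivariate a b c" "h \<in> measurable (?Q \<Otimes>\<^sub>M ?Q) (interval_measure_on a b)"
      "h' \<in> measurable (?Q \<Otimes>\<^sub>M ?Q) (interval_measure_on a b)" for c h h'
    using measurable_compose[OF measurable_Pair[OF that(2,3)], of "\<lambda>x. c (fst x) (snd x)" borel] that(1)
    by (simp add: bounded_bivariate_def square_measure_def)
  have fs: "f \<in> measurable ?Q (interval_measure_on a b)" if "f \<in> {fst, snd}" for f
    using that measurable_square_fst measurable_square_snd by blast
  have m: "(\<lambda>z. f (fst z)) \<in> measurable (?Q \<Otimes>\<^sub>M ?Q) (interval_measure_on a b)"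
    "(\<lambda>z. f (snd z)) \<in> measurable (?Q \<Otimes>\<^sub>M ?Q) (interval_measure_on a b)" if "f \<in> {fst, snd}" for f
    by (rule measurable_compose[OF measurable_fst fs[OF that]] measurable_compose[OF measurable_snd fs[OF that]])+
  obtain C where C: "\<And>s t. s \<in> {a..b} \<Longrightarrow> t \<in> {a..b} \<Longrightarrow> \<bar>c s t\<bar> \<le> C"
    using c unfolding bounded_bivariate_def by blast
  obtain D where D: "\<And>s t. s \<in> {a..b} \<Longrightarrow> t \<in> {a..b} \<Longrightarrow> \<bar>d s t\<bar> \<le> D"
    using d unfolding bounded_bivariate_def by blast
  have mem: "f x \<in> {a..b}" if "f \<in> {fst, snd}" "x \<in> space ?Q" for f x
    using that mem_space_square[of x a b] by auto
  show ?thesis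
    unfolding bounded_kernel_def
  proof
    show "(\<lambda>(x, y). c (f x) (g y) * d (f' (if sw then y else x)) (g' (if sw then x else y))) \<in> borel_measurable (?Q \<Otimes>\<^sub>M ?Q)"
    proof -
      have "(\<lambda>z. c (f (fst z)) (g (snd z))) \<in> borel_measurable (?Q \<Otimes>\<^sub>M ?Q)"
        by (rule comp[OF c m(1)[OF pq(1)] m(2)[OF pq(2)]])
      moreover have "(\<lambda>z. d (f' (if sw then snd z else fst z)) (g' (if sw then fst z else snd z))) \<in> borel_measurable (?Q \<Otimes>\<^sub>M ?Q)"
        using comp[OF d m(2)[OF pq(3)] m(1)[OF pq(4)]] comp[OF d m(1)[OF pq(3)] m(2)[OF pq(4)]] by (cases sw) simp_all
      ultimately show ?thesis unfolding split_def by (rule borel_measurable_times)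
    qed
    have "\<bar>c (f x) (g y) * d (f' (if sw then y else x)) (g' (if sw then x else y))\<bar> \<le> C * D"
      if "x \<in> space ?Q" "y \<in> space ?Q" for x y
    proof -
      have 1: "\<bar>c (f x) (g y)\<bar> \<le> C" by (intro C mem that pq)
      have 2: "\<bar>d (f' (if sw then y else x)) (g' (if sw then x else y))\<bar> \<le> D"
        using D[OF mem[OF pq(3) that(2)] mem[OF pq(4) that(1)]] D[OF mem[OF pq(3) that(1)] mem[OF pq(4) that(2)]]
        by (cases sw) simp_all
      show ?thesis
        unfolding abs_mult using order_trans[OF abs_ge_zero 1] by (intro mult_mono 1 2) auto
    qed
    then show "\<exists>C. \<forall>x\<in>space ?Q. \<forall>y\<in>space ?Q. \<bar>c (f x) (g y) * d (f' (if sw then y else x)) (g' (if sw then x else y))\<bar> \<le> C"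
      by blast
  qed
qed

lemma bounded_kernel_add:
  assumes "bounded_kernel Q k1" "bounded_kernel Q k2"
  shows "bounded_kernel Q (\<lambda>x y. k1 x y + k2 x y)"
proof -
  obtain C1 where C1: "\<And>x y. x \<in> space Q \<Longrightarrow> y \<in> space Q \<Longrightarrow> \<bar>k1 x y\<bar> \<le> C1"
    using assms(1) unfolding bounded_kernel_def by blast
  obtain C2 where C2: "\<And>x y. x \<in> space Q \<Longrightarrow> y \<in> space Q \<Longrightarrow> \<bar>k2 x y\<bar> \<le> C2"
    using assms(2) unfolding bounded_kernel_def by blast
  have "\<forall>x\<in>space Q. \<forall>y\<in>space Q. \<bar>k1 x y + k2 x y\<bar> \<le> C1 + C2"
    by (intro ballI order_trans[OF abs_triangle_ineq add_mono] C1 C2)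
  moreover have "(\<lambda>(x, y). k1 x y + k2 x y) \<in> borel_measurable (Q \<Otimes>\<^sub>M Q)"
    using assms unfolding bounded_kernel_def split_def by (intro borel_measurable_add) blast+
  ultimately show ?thesis unfolding bounded_kernel_def by blast
qed

lemma bounded_kernel_varpi_mixed:
  assumes c: "bounded_bivariate a b c" and d: "bounded_bivariate a b d"
  shows "bounded_kernel (square_measure a b) (varpi_mixed c d)"
proof -
  have eq: "varpi_mixed c d = (\<lambda>x y. c (fst x) (fst y) * d (snd x) (snd y) + d (fst x) (fst y) * c (snd x) (snd y)
    + c (fst x) (snd y) * d (fst y) (snd x) + d (fst x) (snd y) * c (fst y) (snd x))"
    by (intro ext) (simp add: varpi_mixed_def split_def)
  show ?thesis
    unfolding eq
    using bounded_kernel_product[OF c d, of fst fst snd snd False] bounded_kernel_product[OF d c, of fst fst snd snd False]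
      bounded_kernel_product[OF c d, of fst snd fst snd True] bounded_kernel_product[OF d c, of fst snd fst snd True]
    by (intro bounded_kernel_add) simp_all
qed

lemma bounded_kernel_varpi:
  assumes c: "bounded_bivariate a b c"
  shows "bounded_kernel (square_measure a b) (varpi c)"
proof -
  have eq: "varpi c = (\<lambda>x y. c (fst x) (fst y) * c (snd x) (snd y) + c (fst x) (snd y) * c (fst y) (snd x))"
    by (intro ext) (simp add: varpi_def split_def)
  show ?thesis
    unfolding eq
    using bounded_kernel_product[OF c c, of fst fst snd snd False] bounded_kernel_product[OF c c, of fst snd fst snd True]
    by (intro bounded_kernel_add) simp_all
qed

text \<open>Three values of the parameter determine a quadratic polynomial, so summability passes to the
  coefficients.\<close>

lemma summable_on_quadratic_coefficients:
  fixes \<alpha> \<beta> \<zeta> :: "'i \<Rightarrow> real"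
  assumes sm: "\<And>x. x \<in> {x1, x2, x3} \<Longrightarrow> (\<lambda>r. \<alpha> r + x * \<beta> r + x\<^sup>2 * \<zeta> r) summable_on I"
    and x: "x1 \<noteq> x2" "x1 \<noteq> x3" "x2 \<noteq> x3"
  shows "\<alpha> summable_on I" "\<beta> summable_on I" "\<zeta> summable_on I"
proof -
  define h where "h x r = \<alpha> r + x * \<beta> r + x\<^sup>2 * \<zeta> r" for x r
  have h: "h x1 summable_on I" "h x2 summable_on I" "h x3 summable_on I"
    using sm unfolding h_def[abs_def] by auto
  have lin: "(\<lambda>r. p * f r + q * g r) summable_on I" if "f summable_on I" "g summable_on I" for p q and f g :: "'i \<Rightarrow> real"
    by (intro summable_on_add summable_on_cmult_right that)
  have d: "h x r - h y r = (x - y) * (\<beta> r + (x + y) * \<zeta> r)" for x y r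
    by (simp add: h_def power2_eq_square algebra_simps)
  have quot: "g summable_on I"
    if "f summable_on I" "f' summable_on I" "p \<noteq> 0" "\<And>r. f r - f' r = p * g r" for p and f f' g :: "'i \<Rightarrow> real"
  proof -
    have "g r = inverse p * f r + (- inverse p) * f' r" for r
    proof -
      have "inverse p * (f r - f' r) = g r" using that(3,4) by simp
      then show ?thesis by (simp add: right_diff_distrib)
    qed
    then have "g = (\<lambda>r. inverse p * f r + (- inverse p) * f' r)" by (rule ext)
    then show ?thesis using lin[OF that(1,2), of "inverse p" "- inverse p"] by (simp only:)
  qed
  \<comment> \<open>First divided differences, in which \<open>\<alpha>\<close> has dropped out;
    their difference isolates \<open>\<zeta>\<close>.\<close>
  define g12 g13 where "g12 r = \<beta> r + (x1 + x2) * \<zeta> r" and "g13 r = \<beta> r + (x1 + x3) * \<zeta> r" for r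
  have g12: "g12 summable_on I"
    by (rule quot[OF h(1,2), of "x1 - x2"]) (use x(1) in \<open>simp_all add: d g12_def\<close>)
  have g13: "g13 summable_on I"
    by (rule quot[OF h(1,3), of "x1 - x3"]) (use x(2) in \<open>simp_all add: d g13_def\<close>)
  show \<zeta>: "\<zeta> summable_on I"
    by (rule quot[OF g12 g13, of "x2 - x3"]) (use x(3) in \<open>simp_all add: g12_def g13_def algebra_simps\<close>)
  show \<beta>: "\<beta> summable_on I"
    by (rule quot[OF g12 summable_on_cmult_right[OF \<zeta>], of 1 "x1 + x2"]) (simp_all add: g12_def)
  show "\<alpha> summable_on I"
    by (rule quot[OF h(1) lin[OF \<beta> \<zeta>], of 1 x1 "x1\<^sup>2"]) (simp_all add: h_def)
qed

text \<open>An increasing exhaustion eventually contains any given finite set, so the unordered sum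
  is reached along it.\<close>

lemma exhaustion_sum_tendsto:
  fixes f :: "'i \<Rightarrow> real"
  assumes J: "\<And>R. J R \<subseteq> I" "\<And>R::nat. finite (J R)" "incseq J" "(\<Union>R. J R) = I" and f: "f summable_on I"
  shows "(\<lambda>R. \<Sum>r\<in>J R. f r) \<longlonglongrightarrow> (\<Sum>\<^sub>\<infinity>r\<in>I. f r)"
proof -
  have J_lim: "filterlim J (finite_subsets_at_top I) sequentially"
    unfolding filterlim_finite_subsets_at_top
  proof (intro allI impI)
    fix X assume X: "finite X \<and> X \<subseteq> I"
    have "finite X" "X \<subseteq> (\<Union>R. J R)" using X J(4) by auto
    then have "\<exists>R. X \<subseteq> J R"
    proof (induction X rule: finite_induct)
      case (insert x X)
      then obtain R1 R2 where "x \<in> J R1" "X \<subseteq> J R2" by auto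
      moreover have "J R1 \<subseteq> J (max R1 R2)" "J R2 \<subseteq> J (max R1 R2)"
        using J(3) unfolding incseq_def by simp_all
      ultimately show ?case by blast
    qed simp
    then obtain R0 where "X \<subseteq> J R0" ..
    then have "X \<subseteq> J R" if "R0 \<le> R" for R using J(3) that unfolding incseq_def by blast
    then show "\<forall>\<^sub>F R in sequentially. finite (J R) \<and> X \<subseteq> J R \<and> J R \<subseteq> I"
      using J(1,2) by (auto simp: eventually_sequentially)
  qed
  have "(sum f \<longlongrightarrow> infsum f I) (finite_subsets_at_top I)"
    using has_sum_infsum[OF f] by (simp add: has_sum_def)
  from filterlim_compose[OF this J_lim] show ?thesis by simp
qed

section \<open>The limiting variable\<close>

locale limit_variable = prob_space N for N :: "'p measure" +
  fixes A :: "nat \<Rightarrow> 'p \<Rightarrow> real" and I :: "nat set" and lam \<delta>2 :: "nat \<Rightarrow> real" and p :: nat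
  assumes A_indep: "indep_vars (\<lambda>_. borel) A I"
    and A_distr: "r \<in> I \<Longrightarrow> distr N borel (A r) = noncentral_chi_square p (\<delta>2 r / lam r)"
    and lam_pos: "r \<in> I \<Longrightarrow> 0 < lam r" and \<delta>2_nonneg: "r \<in> I \<Longrightarrow> 0 \<le> \<delta>2 r" and p_pos: "0 < p"
    and lam_summable: "lam summable_on I" and \<delta>2_summable: "\<delta>2 summable_on I"
begin

lemma A_measurable: "r \<in> I \<Longrightarrow> A r \<in> borel_measurable N"
  using A_indep unfolding indep_vars_def2 by auto

lemma nc_nonneg: "r \<in> I \<Longrightarrow> 0 \<le> \<delta>2 r / lam r"
  using lam_pos[of r] \<delta>2_nonneg[of r] by simp

lemma A_nonneg: "AE x in N. \<forall>r\<in>I. 0 \<le> A r x"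
proof (rule AE_ball_countable[THEN iffD2, rule_format])
  fix r assume r: "r \<in> I"
  have "AE y in distr N borel (A r). 0 \<le> y"
    unfolding A_distr[OF r] by (rule noncentral_chi_square_nonneg)
  then show "AE x in N. 0 \<le> A r x" using A_measurable[OF r] by (simp add: AE_distr_iff)
qed (rule countableI_type)

lemma A_laplace:
  assumes r: "r \<in> I" and \<theta>: "0 \<le> \<theta>"
  shows "(\<integral>x. exp (- (\<theta> * (lam r * A r x))) \<partial>N)
    = exp (- (\<theta> * \<delta>2 r / (1 + 2 * \<theta> * lam r))) / sqrt (1 + 2 * \<theta> * lam r) ^ p"
proof -
  have "(\<integral>x. exp (- (\<theta> * (lam r * A r x))) \<partial>N) = (\<integral>y. exp (- ((\<theta> * lam r) * y)) \<partial>distr N borel (A r))"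
    using A_measurable[OF r] by (subst integral_distr) (auto simp: mult.assoc)
  also have "\<dots> = exp (- ((\<theta> * lam r) * (\<delta>2 r / lam r) / (1 + 2 * (\<theta> * lam r)))) / sqrt (1 + 2 * (\<theta> * lam r)) ^ p"
    unfolding A_distr[OF r]
    using \<theta> lam_pos[OF r] nc_nonneg[OF r] p_pos by (intro noncentral_chi_square_laplace) auto
  finally show ?thesis using lam_pos[OF r] by (simp add: mult.assoc)
qed

text \<open>Extension by 0 to all natural numbers turns the unordered sum over a possibly finite
  index set into an ordinary series.\<close>

definition summand where "summand r x = (if r \<in> I then lam r * A r x else 0)"

lemma summand_measurable [measurable]: "summand r \<in> borel_measurable N"
proof (cases "r \<in> I")
  case True
  note [measurable] = A_measurable[OF True]
  show ?thesis using True unfolding summand_def[abs_def] by simp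
qed (simp add: summand_def[abs_def])

lemma summand_nonneg: "AE x in N. \<forall>r. 0 \<le> summand r x"
  using A_nonneg by eventually_elim (auto simp: summand_def lam_pos less_imp_le)

lemma summable_abs_iff: "(\<lambda>r. lam r * A r x) summable_on I \<longleftrightarrow> summable (\<lambda>r. \<bar>summand r x\<bar>)"
proof -
  have "(\<lambda>r. lam r * A r x) summable_on I \<longleftrightarrow> (\<lambda>r. summand r x) summable_on UNIV"
    by (rule summable_on_cong_neutral) (auto simp: summand_def)
  also have "\<dots> \<longleftrightarrow> (\<lambda>r. \<bar>summand r x\<bar>) summable_on UNIV"
    using summable_on_iff_abs_summable_on_real[of "\<lambda>r. summand r x" UNIV] by simp
  also have "\<dots> \<longleftrightarrow> summable (\<lambda>r. \<bar>summand r x\<bar>)"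
    by (rule summable_on_UNIV_nonneg_real_iff) simp
  finally show ?thesis .
qed

lemma infsum_eq_suminf:
  assumes "(\<lambda>r. lam r * A r x) summable_on I"
  shows "(\<Sum>\<^sub>\<infinity>r\<in>I. lam r * A r x) = (\<Sum>r. summand r x)"
proof -
  have 1: "(\<Sum>\<^sub>\<infinity>r\<in>I. lam r * A r x) = (\<Sum>\<^sub>\<infinity>r. summand r x)"
    by (rule infsum_cong_neutral) (auto simp: summand_def)
  have "(\<lambda>r. summand r x) summable_on UNIV"
    using assms by (rule summable_on_cong_neutral[THEN iffD1, rotated -1]) (auto simp: summand_def)
  then have "(\<lambda>r. summand r x) sums (\<Sum>\<^sub>\<infinity>r. summand r x)"
    by (intro has_sum_imp_sums has_sum_infsum)
  then show ?thesis unfolding 1 by (rule sums_unique)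
qed

text \<open>The expectations \<open>p * lam r + \<delta>2 r\<close> are summable, so a series of
  almost surely nonnegative terms has finite expectation and converges almost surely.\<close>

lemma AE_summable: "AE x in N. (\<lambda>r. lam r * A r x) summable_on I"
proof -
  define m where "m r = (if r \<in> I then real p * lam r + \<delta>2 r else 0)" for r
  have m_sum: "summable m"
  proof -
    have "(\<lambda>r. real p * lam r + \<delta>2 r) summable_on I"
      by (intro summable_on_add summable_on_cmult_right lam_summable \<delta>2_summable)
    then have "m summable_on UNIV"
      by (rule summable_on_cong_neutral[THEN iffD1, rotated -1]) (auto simp: m_def)
    then show ?thesis by (intro summable_on_imp_summable)
  qed
  have m_nonneg: "0 \<le> m r" for r
    using lam_pos[of r] \<delta>2_nonneg[of r] by (auto simp: m_def less_imp_le)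
  have int: "(\<integral>\<^sup>+x. ennreal (summand r x) \<partial>N) = ennreal (m r)" for r
  proof (cases "r \<in> I")
    case True
    have "(\<integral>\<^sup>+x. ennreal (summand r x) \<partial>N) = (\<integral>\<^sup>+x. ennreal (lam r) * ennreal (A r x) \<partial>N)"
      using True lam_pos[OF True] by (simp add: summand_def ennreal_mult')
    also have "\<dots> = ennreal (lam r) * (\<integral>\<^sup>+y. ennreal y \<partial>distr N borel (A r))"
      using A_measurable[OF True] by (simp add: nn_integral_distr nn_integral_cmult)
    also have "\<dots> = ennreal (lam r) * ennreal (real p + \<delta>2 r / lam r)"
      unfolding A_distr[OF True] using nn_integral_noncentral_chi_square[OF nc_nonneg[OF True] p_pos] by simp
    also have "\<dots> = ennreal (m r)"
    proof -
      have "lam r * (real p + \<delta>2 r / lam r) = m r"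
        using True lam_pos[OF True] by (simp add: m_def distrib_left mult.commute)
      then show ?thesis using lam_pos[OF True] nc_nonneg[OF True] by (subst ennreal_mult[symmetric]) auto
    qed
    finally show ?thesis .
  qed (simp add: summand_def m_def)
  have "(\<integral>\<^sup>+x. (\<Sum>r. ennreal (summand r x)) \<partial>N) = (\<Sum>r. \<integral>\<^sup>+x. ennreal (summand r x) \<partial>N)"
    by (rule nn_integral_suminf) measurable
  also have "\<dots> = ennreal (\<Sum>r. m r)"
    unfolding int by (rule suminf_ennreal2[OF m_nonneg m_sum])
  finally have "AE x in N. (\<Sum>r. ennreal (summand r x)) \<noteq> \<infinity>"
    by (intro nn_integral_PInf_AE) auto
  then show ?thesis
    using summand_nonneg
  proof eventually_elim
    case (elim x)
    then have "summable (\<lambda>r. summand r x)" by (intro summable_suminf_not_top) (auto simp: infinity_ennreal_def)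
    then show ?case using elim(2) by (simp add: summable_abs_iff)
  qed
qed

lemma series_measurable: "(\<lambda>x. \<Sum>\<^sub>\<infinity>r\<in>I. lam r * A r x) \<in> borel_measurable N"
proof -
  \<comment> \<open>Where the family is not summable, \<open>infsum\<close> has the value 0; making
    this default explicit describes the sum at every point and not only almost everywhere.\<close>
  have "(\<Sum>\<^sub>\<infinity>r\<in>I. lam r * A r x) = (if (\<Sum>r. ennreal \<bar>summand r x\<bar>) = \<infinity> then 0 else (\<Sum>r. summand r x))" for x
  proof (cases "summable (\<lambda>r. \<bar>summand r x\<bar>)")
    case True
    have "(\<Sum>r. ennreal \<bar>summand r x\<bar>) = ennreal (\<Sum>r. \<bar>summand r x\<bar>)"
      by (rule suminf_ennreal2[OF _ True]) simp
    then show ?thesis using infsum_eq_suminf[OF summable_abs_iff[THEN iffD2, OF True]] by simp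
  next
    case False
    then have "(\<Sum>r. ennreal \<bar>summand r x\<bar>) = \<infinity>"
      using summable_suminf_not_top[OF abs_ge_zero, of "\<lambda>r. summand r x"] unfolding infinity_ennreal_def by blast
    moreover have "\<not> (\<lambda>r. lam r * A r x) summable_on I" using False by (simp add: summable_abs_iff)
    ultimately show ?thesis by (simp add: infsum_not_exists)
  qed
  then have eq: "(\<lambda>x. \<Sum>\<^sub>\<infinity>r\<in>I. lam r * A r x)
    = (\<lambda>x. if (\<Sum>r. ennreal \<bar>summand r x\<bar>) = \<infinity> then 0 else (\<Sum>r. summand r x))"
    by (rule ext)
  have 1: "(\<lambda>x. \<Sum>r. ennreal \<bar>summand r x\<bar>) \<in> borel_measurable N" by measurable
  have 2: "(\<lambda>x. \<Sum>r. summand r x) \<in> borel_measurable N" by measurable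
  have 3: "{x \<in> space N. (\<Sum>r. ennreal \<bar>summand r x\<bar>) = \<infinity>} \<in> sets N"
    by (rule borel_measurable_eq[OF 1 borel_measurable_const])
  show ?thesis unfolding eq by (rule measurable_If[OF _ 2 3]) simp
qed

lemma series_nonneg: "AE x in N. 0 \<le> (\<Sum>\<^sub>\<infinity>r\<in>I. lam r * A r x)"
  using A_nonneg by eventually_elim (auto intro!: infsum_nonneg simp: lam_pos less_imp_le)

lemma partial_laplace:
  assumes F: "finite F" "F \<subseteq> I" and \<theta>: "0 \<le> \<theta>"
  shows "(\<integral>x. exp (- (\<theta> * (\<Sum>r\<in>F. lam r * A r x))) \<partial>N)
    = (\<Prod>r\<in>F. exp (- (\<theta> * \<delta>2 r / (1 + 2 * \<theta> * lam r))) / sqrt (1 + 2 * \<theta> * lam r) ^ p)"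
proof -
  have "(\<integral>x. exp (- (\<theta> * (\<Sum>r\<in>F. lam r * A r x))) \<partial>N) = (\<integral>x. (\<Prod>r\<in>F. exp (- (\<theta> * (lam r * A r x)))) \<partial>N)"
  proof -
    have "exp (- (\<theta> * (\<Sum>r\<in>F. lam r * A r x))) = exp (\<Sum>r\<in>F. - (\<theta> * (lam r * A r x)))" for x
      by (simp add: sum_distrib_left sum_negf)
    then show ?thesis by (simp only: exp_sum[OF F(1)])
  qed
  also have "\<dots> = (\<Prod>r\<in>F. \<integral>x. exp (- (\<theta> * (lam r * A r x))) \<partial>N)"
  proof (rule indep_vars_lebesgue_integral[OF F(1)])
    show "indep_vars (\<lambda>_. borel) (\<lambda>r x. exp (- (\<theta> * (lam r * A r x)))) F"
      by (rule indep_vars_compose2[OF indep_vars_subset[OF A_indep F(2)], where Y = "\<lambda>r y. exp (- (\<theta> * (lam r * y)))"]) auto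
    fix r assume "r \<in> F"
    then have r: "r \<in> I" using F(2) by auto
    note [measurable] = A_measurable[OF r]
    show "integrable N (\<lambda>x. exp (- (\<theta> * (lam r * A r x))))"
    proof (rule integrable_const_bound[of _ 1])
      show "AE x in N. norm (exp (- (\<theta> * (lam r * A r x)))) \<le> 1"
        using A_nonneg by eventually_elim (use \<theta> lam_pos[OF r] r in auto)
    qed measurable
  qed
  also have "\<dots> = (\<Prod>r\<in>F. exp (- (\<theta> * \<delta>2 r / (1 + 2 * \<theta> * lam r))) / sqrt (1 + 2 * \<theta> * lam r) ^ p)"
    using F(2) \<theta> by (intro prod.cong refl A_laplace) auto
  finally show ?thesis .
qed

text \<open>The partial sums are almost surely nonnegative, so dominated convergence applies to
  their Laplace integrands; independence has already put these into product form. The infinite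
  product need not be evaluated.\<close>

lemma series_laplace:
  assumes J: "\<And>R. J R \<subseteq> I" "\<And>R::nat. finite (J R)" "incseq J" "(\<Union>R. J R) = I" and \<theta>: "0 \<le> \<theta>"
  shows "(\<lambda>R. \<Prod>r\<in>J R. exp (- (\<theta> * \<delta>2 r / (1 + 2 * \<theta> * lam r))) / sqrt (1 + 2 * \<theta> * lam r) ^ p)
    \<longlonglongrightarrow> (\<integral>x. exp (- (\<theta> * (\<Sum>\<^sub>\<infinity>r\<in>I. lam r * A r x))) \<partial>N)"
proof -
  have "(\<lambda>R. \<integral>x. exp (- (\<theta> * (\<Sum>r\<in>J R. lam r * A r x))) \<partial>N)
    \<longlonglongrightarrow> (\<integral>x. exp (- (\<theta> * (\<Sum>\<^sub>\<infinity>r\<in>I. lam r * A r x))) \<partial>N)"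
  proof (rule integral_dominated_convergence[where w = "\<lambda>_. 1"])
    note [measurable] = series_measurable
    show "(\<lambda>x. exp (- (\<theta> * (\<Sum>\<^sub>\<infinity>r\<in>I. lam r * A r x)))) \<in> borel_measurable N" by measurable
    show "(\<lambda>x. exp (- (\<theta> * (\<Sum>r\<in>J R. lam r * A r x)))) \<in> borel_measurable N" for R
    proof -
      have [measurable]: "(\<lambda>x. \<Sum>r\<in>J R. lam r * A r x) \<in> borel_measurable N"
        using J(1) A_measurable by (intro borel_measurable_sum borel_measurable_times) auto
      show ?thesis by measurable
    qed
    show "AE x in N. (\<lambda>R. exp (- (\<theta> * (\<Sum>r\<in>J R. lam r * A r x)))) \<longlonglongrightarrow> exp (- (\<theta> * (\<Sum>\<^sub>\<infinity>r\<in>I. lam r * A r x)))"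
      using AE_summable by eventually_elim (intro tendsto_intros exhaustion_sum_tendsto[OF J])
    show "AE x in N. norm (exp (- (\<theta> * (\<Sum>r\<in>J R. lam r * A r x)))) \<le> 1" for R
      using A_nonneg
    proof eventually_elim
      case (elim x)
      have "0 \<le> (\<Sum>r\<in>J R. lam r * A r x)"
        using elim J(1)[of R] lam_pos by (intro sum_nonneg mult_nonneg_nonneg) (auto simp: less_imp_le)
      then show ?case using \<theta> by simp
    qed
  qed simp
  then show ?thesis unfolding partial_laplace[OF J(2,1) \<theta>] .
qed

end

section \<open>The matrix W\<close>

lemma W_decomposition_orthonormal:
  assumes W: "W_decomposition k \<tau> U" and l: "l < k" "l' < k"
  shows "(\<Sum>i<k. U $$ (i, l) * U $$ (i, l')) = (if l = l' then 1 else 0)"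
proof -
  have U: "U \<in> carrier_mat k k" and UU: "U\<^sup>T * U = 1\<^sub>m k" using W by (simp_all add: W_decomposition_def)
  have "(U\<^sup>T * U) $$ (l, l') = (\<Sum>i<k. U $$ (i, l) * U $$ (i, l'))"
    using U l by (simp add: scalar_prod_def atLeast0LessThan)
  then show ?thesis using l unfolding UU by simp
qed

lemma W_decomposition_entries:
  assumes W: "W_decomposition k \<tau> U" and ij: "i < k" "j < k"
  shows "(\<Sum>l<k - 1. U $$ (i, l) * U $$ (j, l)) = (if i = j then 1 else 0) - sqrt (\<tau> i) * sqrt (\<tau> j)"
proof -
  define D where "D = mat k k (\<lambda>(i, j). if i = j \<and> i < k - 1 then 1 else 0 :: real)"
  have U: "U \<in> carrier_mat k k" and WU: "W_matrix k \<tau> = U * D * U\<^sup>T"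
    using W by (simp_all add: W_decomposition_def D_def)
  have UD: "(U * D) $$ (i, l) = (if l < k - 1 then U $$ (i, l) else 0)" if "l < k" for l
  proof -
    have "(U * D) $$ (i, l) = (\<Sum>h<k. U $$ (i, h) * (if h = l \<and> h < k - 1 then 1 else 0))"
      using U ij that by (simp add: scalar_prod_def atLeast0LessThan D_def)
    also have "\<dots> = (\<Sum>h<k. if h = l then (if l < k - 1 then U $$ (i, l) else 0) else 0)"
      by (intro sum.cong refl) auto
    finally show ?thesis using that by simp
  qed
  have "W_matrix k \<tau> $$ (i, j) = (\<Sum>l<k. (U * D) $$ (i, l) * U $$ (j, l))"
    unfolding WU using U ij by (simp add: scalar_prod_def atLeast0LessThan D_def)
  also have "\<dots> = (\<Sum>l<k. if l < k - 1 then U $$ (i, l) * U $$ (j, l) else 0)"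
    by (intro sum.cong refl) (auto simp: UD)
  also have "\<dots> = (\<Sum>l\<in>{l \<in> {..<k}. l < k - 1}. U $$ (i, l) * U $$ (j, l))"
    by (rule sum.inter_filter[symmetric]) simp
  also have "{l \<in> {..<k}. l < k - 1} = {..<k - 1}" by auto
  finally show ?thesis using ij by (simp add: W_matrix_def)
qed

text \<open>Both sides are the quadratic form of the matrix \<open>W_matrix k \<tau>\<close>: on the
  left as the residual along a unit vector, on the right because the first \<open>k - 1\<close>
  columns of \<open>U\<close> form an orthonormal basis of its range.\<close>

lemma W_decomposition_projection:
  assumes W: "W_decomposition k \<tau> U" and \<tau>: "\<And>i. i < k \<Longrightarrow> 0 \<le> \<tau> i" "(\<Sum>i<k. \<tau> i) = 1"
  shows "(\<Sum>i<k. (x i - sqrt (\<tau> i) * (\<Sum>j<k. sqrt (\<tau> j) * x j))\<^sup>2) = (\<Sum>l<k - 1. (\<Sum>i<k. U $$ (i, l) * x i)\<^sup>2)"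
proof -
  have "(\<Sum>i<k. (sqrt (\<tau> i))\<^sup>2) = 1" using \<tau> by simp
  note sum_squares_residual[OF this, of x]
  also have "(\<Sum>i<k. (x i)\<^sup>2) - (\<Sum>j<k. sqrt (\<tau> j) * x j)\<^sup>2
    = (\<Sum>i<k. \<Sum>j<k. x i * x j * ((if i = j then 1 else 0) - sqrt (\<tau> i) * sqrt (\<tau> j)))"
  proof -
    have "(\<Sum>i<k. \<Sum>j<k. x i * x j * (if i = j then 1 else 0)) = (\<Sum>i<k. \<Sum>j<k. if j = i then (x i)\<^sup>2 else 0)"
      by (intro sum.cong refl) (auto simp: power2_eq_square)
    also have "\<dots> = (\<Sum>i<k. (x i)\<^sup>2)" by simp
    finally show ?thesis
      by (simp add: right_diff_distrib sum_subtractf power2_eq_square sum_product mult_ac)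
  qed
  also have "\<dots> = (\<Sum>i<k. \<Sum>j<k. \<Sum>l<k - 1. (U $$ (i, l) * x i) * (U $$ (j, l) * x j))"
    by (intro sum.cong refl)
      (simp add: W_decomposition_entries[OF W, symmetric] sum_distrib_left mult_ac)
  also have "\<dots> = (\<Sum>i<k. \<Sum>l<k - 1. \<Sum>j<k. (U $$ (i, l) * x i) * (U $$ (j, l) * x j))"
    by (intro sum.cong refl sum.swap)
  also have "\<dots> = (\<Sum>l<k - 1. \<Sum>i<k. \<Sum>j<k. (U $$ (i, l) * x i) * (U $$ (j, l) * x j))"
    by (rule sum.swap)
  finally show ?thesis by (simp only: power2_eq_square sum_product)
qed

lemma d_tilde_index:
  assumes W: "W_decomposition k \<tau> U" and l: "l < k - 1"
  shows "vec_index (d_tilde k U d s t) l = (\<Sum>i<k. U $$ (i, l) * d i s t)"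
proof -
  have U: "U \<in> carrier_mat k k" using W by (simp add: W_decomposition_def)
  have "vec_index (d_tilde k U d s t) l
    = (\<Sum>h<k. (if l = h then 1 else 0) * vec_index (U\<^sup>T *\<^sub>v Matrix.vec k (\<lambda>i. d i s t)) h)"
    using U l by (simp add: d_tilde_def scalar_prod_def atLeast0LessThan)
  also have "\<dots> = (\<Sum>h<k. if h = l then vec_index (U\<^sup>T *\<^sub>v Matrix.vec k (\<lambda>i. d i s t)) l else 0)"
    by (intro sum.cong refl) auto
  also have "\<dots> = vec_index (U\<^sup>T *\<^sub>v Matrix.vec k (\<lambda>i. d i s t)) l" using l by simp
  also have "\<dots> = (\<Sum>i<k. U $$ (i, l) * d i s t)"
    using U l by (simp add: scalar_prod_def atLeast0LessThan)
  finally show ?thesis .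
qed

text \<open>The vector-valued iterated integral becomes a combination of the coordinates of the
  \<open>d i\<close>; square integrability permits merging the two integrals into one over the
  square and taking the combination outside.\<close>

lemma delta_sq_eq:
  assumes W: "W_decomposition k \<tau> U" and d: "\<And>i. i < k \<Longrightarrow> L2 (square_measure a b) (\<lambda>x. d i (fst x) (snd x))"
    and f: "L2 (square_measure a b) f"
  shows "delta_sq a b k U d f
    = (\<Sum>l<k - 1. (\<Sum>i<k. U $$ (i, l) * (\<integral>x. d i (fst x) (snd x) * f x \<partial>square_measure a b))\<^sup>2)"
  unfolding delta_sq_def
proof (intro sum.cong refl arg_cong[where f = "\<lambda>x. x\<^sup>2"])
  fix l assume "l \<in> {..<k - 1}"
  then have l: "l < k - 1" by simp
  let ?\<mu> = "interval_measure_on a b" and ?Q = "square_measure a b"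
  define h where "h x = (\<Sum>i<k. U $$ (i, l) * d i (fst x) (snd x)) * f x" for x
  have h: "integrable ?Q h"
    unfolding h_def[abs_def] by (intro L2_mult_integrable[OF L2_sum f] L2_cmult d) auto
  have "(\<integral>s. (\<integral>t. vec_index (d_tilde k U d s t) l * f (s, t) \<partial>?\<mu>) \<partial>?\<mu>) = (\<integral>s. (\<integral>t. h (s, t) \<partial>?\<mu>) \<partial>?\<mu>)"
    by (simp add: d_tilde_index[OF W l] h_def)
  also have "\<dots> = (\<integral>x. h x \<partial>?Q)" by (rule square_iterated_integral[OF h])
  also have "\<dots> = (\<integral>x. (\<Sum>i<k. U $$ (i, l) * (d i (fst x) (snd x) * f x)) \<partial>?Q)"
    by (simp add: h_def sum_distrib_right mult.assoc)
  also have "\<dots> = (\<Sum>i<k. U $$ (i, l) * (\<integral>x. d i (fst x) (snd x) * f x \<partial>?Q))"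
    by (rule integral_linear_combination(2)) (auto intro!: L2_mult_integrable d f)
  finally show "(\<integral>s. (\<integral>t. vec_index (d_tilde k U d s t) l * f (s, t) \<partial>?\<mu>) \<partial>?\<mu>)
    = (\<Sum>i<k. U $$ (i, l) * (\<integral>x. d i (fst x) (snd x) * f x \<partial>?Q))" .
qed

section \<open>The local alternative\<close>

locale local_alternative_samples =
  fixes a b C :: real and k :: nat and n :: "nat \<Rightarrow> nat \<Rightarrow> nat" and M :: "nat \<Rightarrow> 'w measure"
    and v :: "nat \<Rightarrow> nat \<Rightarrow> nat \<Rightarrow> real \<Rightarrow> 'w \<Rightarrow> real" and \<gamma>s :: "nat \<Rightarrow> nat \<Rightarrow> real \<Rightarrow> real \<Rightarrow> real"
    and \<gamma> :: "real \<Rightarrow> real \<Rightarrow> real" and d :: "nat \<Rightarrow> real \<Rightarrow> real \<Rightarrow> real" and \<tau> :: "nat \<Rightarrow> real"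
  assumes k_ge_2: "2 \<le> k"
    and samples: "functional_samples (M \<nu>) a b C k (n \<nu>) (v \<nu>) (\<gamma>s \<nu>)"
    and total_size: "filterlim (\<lambda>\<nu>. \<Sum>i<k. n \<nu> i) at_top sequentially"
    and ratio: "i < k \<Longrightarrow> (\<lambda>\<nu>. real (n \<nu> i) / real (\<Sum>i'<k. n \<nu> i')) \<longlonglongrightarrow> \<tau> i"
    and \<tau>_pos: "i < k \<Longrightarrow> 0 < \<tau> i"
    and alternative: "i < k \<Longrightarrow> s \<in> {a..b} \<Longrightarrow> t \<in> {a..b} \<Longrightarrow>
        \<gamma>s \<nu> i s t = \<gamma> s t + d i s t / sqrt (real (n \<nu> i) - 1)"
begin

sublocale fs: functional_samples "M \<nu>" a b C k "n \<nu>" "v \<nu>" "\<gamma>s \<nu>" for \<nu>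
  by (rule samples)

abbreviation "Q \<equiv> square_measure a b"

section \<open>Asymptotics of the sample sizes and weights\<close>

definition \<epsilon> where "\<epsilon> \<nu> i = 1 / sqrt (real (n \<nu> i) - 1)"

lemma \<epsilon>_bounds: "i < k \<Longrightarrow> 0 < \<epsilon> \<nu> i" "i < k \<Longrightarrow> \<epsilon> \<nu> i \<le> 1"
  using fs.n_ge_2[of i \<nu>] by (simp_all add: \<epsilon>_def)

lemma \<epsilon>_power2: "i < k \<Longrightarrow> (\<epsilon> \<nu> i)\<^sup>2 = 1 / (real (n \<nu> i) - 1)"
  using fs.n_pos[of i \<nu>] by (simp add: \<epsilon>_def power_divide)

lemma size_ratio: "i < k \<Longrightarrow> real (n \<nu> i) / (real (n \<nu> i) - 1) = 1 + (\<epsilon> \<nu> i)\<^sup>2"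
  using fs.n_pos[of i \<nu>] by (simp add: \<epsilon>_power2 field_simps)

lemma total_pos: "0 < real (\<Sum>i<k. n \<nu> i)"
proof -
  have "n \<nu> 0 \<le> (\<Sum>i<k. n \<nu> i)" using k_ge_2 by (intro member_le_sum) auto
  moreover have "2 \<le> n \<nu> 0" using k_ge_2 by (intro fs.n_ge_2) auto
  ultimately show ?thesis by linarith
qed

lemma total_at_top: "filterlim (\<lambda>\<nu>. real (\<Sum>i<k. n \<nu> i)) at_top sequentially"
  by (rule filterlim_compose[OF filterlim_real_sequentially total_size])

lemma n_at_top:
  assumes i: "i < k" shows "filterlim (\<lambda>\<nu>. real (n \<nu> i)) at_top sequentially"
proof -
  have "filterlim (\<lambda>\<nu>. real (n \<nu> i) / real (\<Sum>i<k. n \<nu> i) * real (\<Sum>i<k. n \<nu> i)) at_top sequentially"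
    by (rule filterlim_tendsto_pos_mult_at_top[OF ratio[OF i] \<tau>_pos[OF i] total_at_top])
  moreover have "real (n \<nu> i) / real (\<Sum>i<k. n \<nu> i) * real (\<Sum>i<k. n \<nu> i) = real (n \<nu> i)" for \<nu>
    using total_pos[of \<nu>] by simp
  ultimately show ?thesis by simp
qed

lemma \<epsilon>_tendsto: assumes i: "i < k" shows "(\<lambda>\<nu>. \<epsilon> \<nu> i) \<longlonglongrightarrow> 0"
proof -
  have "filterlim (\<lambda>\<nu>. - 1 + real (n \<nu> i)) at_top sequentially"
    by (rule filterlim_tendsto_add_at_top[OF tendsto_const n_at_top[OF i]])
  then have "filterlim (\<lambda>\<nu>. sqrt (real (n \<nu> i) - 1)) at_top sequentially"
    by (intro filterlim_compose[OF sqrt_at_top]) (simp add: add.commute)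
  then show ?thesis
    unfolding \<epsilon>_def by (intro tendsto_divide_0[OF tendsto_const] filterlim_at_top_imp_at_infinity)
qed

text \<open>The sample proportions add up to 1 for every \<open>\<nu>\<close>. In consequence the
  numbers \<open>sqrt (\<tau> i)\<close> form a unit vector.\<close>

lemma \<tau>_sum: "(\<Sum>i<k. \<tau> i) = 1"
proof -
  have "(\<lambda>\<nu>. \<Sum>i<k. real (n \<nu> i) / real (\<Sum>i<k. n \<nu> i)) \<longlonglongrightarrow> (\<Sum>i<k. \<tau> i)"
    by (intro tendsto_sum ratio) auto
  moreover have "(\<Sum>i<k. real (n \<nu> i) / real (\<Sum>i<k. n \<nu> i)) = 1" for \<nu>
  proof -
    have "(\<Sum>i<k. real (n \<nu> i) / real (\<Sum>i<k. n \<nu> i)) = real (\<Sum>i<k. n \<nu> i) / real (\<Sum>i<k. n \<nu> i)"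
      unfolding of_nat_sum by (rule sum_divide_distrib[symmetric])
    then show ?thesis using total_pos[of \<nu>] by simp
  qed
  ultimately show ?thesis by (simp add: LIMSEQ_const_iff)
qed

lemma weight_tendsto: assumes i: "i < k" shows "(\<lambda>\<nu>. fs.weight \<nu> i) \<longlonglongrightarrow> sqrt (\<tau> i)"
proof -
  define N where "N \<nu> = real (\<Sum>i<k. n \<nu> i)" for \<nu>
  have N: "0 < N \<nu>" for \<nu> using total_pos by (simp add: N_def)
  have inv: "(\<lambda>\<nu>. x / N \<nu>) \<longlonglongrightarrow> 0" for x
    using total_at_top unfolding N_def
    by (intro tendsto_divide_0[OF tendsto_const] filterlim_at_top_imp_at_infinity)
  have "(\<lambda>\<nu>. (real (n \<nu> i) / N \<nu> - 1 / N \<nu>) / (1 - real k / N \<nu>)) \<longlonglongrightarrow> (\<tau> i - 0) / (1 - 0)"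
    by (intro tendsto_intros inv ratio[OF i, folded N_def]) simp
  \<comment> \<open>Dividing numerator and denominator by the total size expresses the squared
    weight through quantities with known limits; the losses of 1 and \<open>k\<close> become
    negligible.\<close>
  moreover have "(real (n \<nu> i) / N \<nu> - 1 / N \<nu>) / (1 - real k / N \<nu>) = (real (n \<nu> i) - 1) / (\<Sum>i<k. real (n \<nu> i) - 1)" for \<nu>
  proof -
    have "(\<Sum>i<k. real (n \<nu> i) - 1) = N \<nu> * (1 - real k / N \<nu>)"
      using N[of \<nu>] by (simp add: N_def sum_subtractf right_diff_distrib)
    moreover have "real (n \<nu> i) - 1 = N \<nu> * (real (n \<nu> i) / N \<nu> - 1 / N \<nu>)"
      using N[of \<nu>] by (simp add: right_diff_distrib)
    ultimately show ?thesis using N[of \<nu>] by simp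
  qed
  ultimately have "(\<lambda>\<nu>. (real (n \<nu> i) - 1) / (\<Sum>i<k. real (n \<nu> i) - 1)) \<longlonglongrightarrow> \<tau> i" by simp
  then show ?thesis unfolding fs.weight_def by (rule tendsto_real_sqrt)
qed

lemma smaller_\<epsilon>: assumes i: "i < k" and x: "0 < x" shows "\<exists>\<nu>. \<epsilon> \<nu> i < x"
  using order_tendstoD(2)[OF \<epsilon>_tendsto[OF i] x] by (auto simp: eventually_sequentially)

section \<open>Regularity and summability forced by the alternative\<close>

lemma alternative': "i < k \<Longrightarrow> s \<in> {a..b} \<Longrightarrow> t \<in> {a..b} \<Longrightarrow> \<gamma>s \<nu> i s t = \<gamma> s t + d i s t * \<epsilon> \<nu> i"
  using alternative by (simp add: \<epsilon>_def)

lemma bounded_\<gamma>s: "i < k \<Longrightarrow> bounded_bivariate a b (\<gamma>s \<nu> i)"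
  unfolding bounded_bivariate_def using fs.c_measurable fs.c_bound by blast

lemma bounded_bivariate_combination:
  assumes "bounded_bivariate a b c1" "bounded_bivariate a b c2"
    and "\<And>s t. s \<in> {a..b} \<Longrightarrow> t \<in> {a..b} \<Longrightarrow> c s t = p * c1 s t + q * c2 s t"
  shows "bounded_bivariate a b c"
proof -
  obtain C1 where C1: "\<And>s t. s \<in> {a..b} \<Longrightarrow> t \<in> {a..b} \<Longrightarrow> \<bar>c1 s t\<bar> \<le> C1"
    using assms(1) unfolding bounded_bivariate_def by blast
  obtain C2 where C2: "\<And>s t. s \<in> {a..b} \<Longrightarrow> t \<in> {a..b} \<Longrightarrow> \<bar>c2 s t\<bar> \<le> C2"
    using assms(2) unfolding bounded_bivariate_def by blast
  have "\<bar>c s t\<bar> \<le> \<bar>p\<bar> * C1 + \<bar>q\<bar> * C2" if "s \<in> {a..b}" "t \<in> {a..b}" for s t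
    unfolding assms(3)[OF that]
    using mult_left_mono[OF C1[OF that], of "\<bar>p\<bar>"] mult_left_mono[OF C2[OF that], of "\<bar>q\<bar>"]
      abs_triangle_ineq[of "p * c1 s t" "q * c2 s t"] by (simp add: abs_mult)
  moreover have "(\<lambda>x. c (fst x) (snd x)) \<in> borel_measurable Q"
  proof (rule measurable_cong[THEN iffD2])
    show "(\<lambda>x. p * c1 (fst x) (snd x) + q * c2 (fst x) (snd x)) \<in> borel_measurable Q"
      using assms(1,2) unfolding bounded_bivariate_def
      by (intro borel_measurable_add borel_measurable_times borel_measurable_const) blast+
  qed (use assms(3) mem_space_square in blast)
  ultimately show ?thesis unfolding bounded_bivariate_def by blast
qed

text \<open>Neither measurability nor boundedness of \<open>d i\<close> is assumed. Since
  \<open>\<epsilon>\<close> is positive and tends to 0, it takes two different values, and the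
  alternative can be solved for \<open>d i\<close> as a difference quotient of two covariance
  functions.\<close>

lemma bounded_d: assumes i: "i < k" shows "bounded_bivariate a b (d i)"
proof -
  obtain \<nu>' where \<nu>': "\<epsilon> \<nu>' i < \<epsilon> 0 i" using smaller_\<epsilon>[OF i \<epsilon>_bounds(1)[OF i]] by blast
  define z where "z = 1 / (\<epsilon> 0 i - \<epsilon> \<nu>' i)"
  have z: "z * (\<epsilon> 0 i - \<epsilon> \<nu>' i) = 1" using \<nu>' by (simp add: z_def)
  show ?thesis
  proof (rule bounded_bivariate_combination[OF bounded_\<gamma>s[OF i] bounded_\<gamma>s[OF i]])
    fix s t assume st: "s \<in> {a..b}" "t \<in> {a..b}"
    have "z * \<gamma>s 0 i s t + (- z) * \<gamma>s \<nu>' i s t = d i s t * (z * (\<epsilon> 0 i - \<epsilon> \<nu>' i))"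
      unfolding alternative'[OF i st] by (simp add: algebra_simps)
    then show "d i s t = z * \<gamma>s 0 i s t + (- z) * \<gamma>s \<nu>' i s t" by (simp add: z)
  qed
qed

lemma bounded_\<gamma>: "bounded_bivariate a b \<gamma>"
proof -
  have i: "0 < k" using k_ge_2 by simp
  show ?thesis
    by (rule bounded_bivariate_combination[OF bounded_\<gamma>s[OF i, of 0] bounded_d[OF i], of _ 1 "- \<epsilon> 0 0"])
      (simp add: alternative'[OF i])
qed

lemma d_L2: "i < k \<Longrightarrow> L2 Q (\<lambda>x. d i (fst x) (snd x))"
  by (rule bounded_bivariate_L2[OF bounded_d])

lemma B_quadratic:
  assumes i: "i < k" and f: "L2 Q f"
  shows "fs.B \<nu> i f = kernel_form Q (varpi \<gamma>) f + \<epsilon> \<nu> i * kernel_form Q (varpi_mixed \<gamma> (d i)) f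
    + (\<epsilon> \<nu> i)\<^sup>2 * kernel_form Q (varpi (d i)) f"
proof -
  have "fs.B \<nu> i f = kernel_form Q (varpi (\<gamma>s \<nu> i)) f" by (simp add: fs.B_def kernel_form_def)
  also have "\<dots> = kernel_form Q (varpi \<gamma>) f + \<epsilon> \<nu> i * kernel_form Q (varpi_mixed \<gamma> (d i)) f
    + (\<epsilon> \<nu> i)\<^sup>2 * kernel_form Q (varpi (d i)) f"
    by (rule finite_measure.kernel_form_quadratic[OF finite_square_measure bounded_kernel_varpi[OF bounded_\<gamma>]
      bounded_kernel_varpi_mixed[OF bounded_\<gamma> bounded_d[OF i]] bounded_kernel_varpi[OF bounded_d[OF i]] f])
      (rule varpi_perturbation[OF alternative'[OF i]])
  finally show ?thesis .
qed

definition trace_bound where "trace_bound = measure Q (space Q) * sqrt (848 * C ^ 4)"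

lemma B_summable:
  assumes e: "orthonormal_basis Q I e" and i: "i < k"
  shows "(\<lambda>r. fs.B \<nu> i (e r)) summable_on I"
proof (rule nonneg_bdd_above_summable_on)
  show "0 \<le> fs.B \<nu> i (e r)" if "r \<in> I" for r by (rule fs.B_nonneg[OF i orthonormal_basisD(1)[OF e that]])
  show "bdd_above (sum (\<lambda>r. fs.B \<nu> i (e r)) ` {F. F \<subseteq> I \<and> finite F})"
    using fs.B_Bessel[OF e _ _ i, of _ \<nu>] by (intro bdd_aboveI[of _ trace_bound]) (auto simp: trace_bound_def)
qed

text \<open>Bessel on the fields makes the nonnegative diagonal terms of
  \<open>varpi (\<gamma>s \<nu> i)\<close> summable. The mixed kernel has no definite sign and
  \<open>d i\<close> need not be a covariance function, so their terms are reached through three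
  values of \<open>\<epsilon>\<close>, which are distinct by choice along the limit 0.\<close>

lemma coefficients_summable:
  assumes e: "orthonormal_basis Q I e" and i: "i < k"
  shows "(\<lambda>r. kernel_form Q (varpi \<gamma>) (e r)) summable_on I"
    and "(\<lambda>r. kernel_form Q (varpi_mixed \<gamma> (d i)) (e r)) summable_on I"
    and "(\<lambda>r. kernel_form Q (varpi (d i)) (e r)) summable_on I"
proof -
  obtain \<nu>1 where 1: "\<epsilon> \<nu>1 i < \<epsilon> 0 i" using smaller_\<epsilon>[OF i \<epsilon>_bounds(1)[OF i]] by blast
  obtain \<nu>2 where 2: "\<epsilon> \<nu>2 i < \<epsilon> \<nu>1 i" using smaller_\<epsilon>[OF i \<epsilon>_bounds(1)[OF i]] by blast
  have sm: "(\<lambda>r. kernel_form Q (varpi \<gamma>) (e r) + \<epsilon> \<nu> i * kernel_form Q (varpi_mixed \<gamma> (d i)) (e r)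
    + (\<epsilon> \<nu> i)\<^sup>2 * kernel_form Q (varpi (d i)) (e r)) summable_on I" for \<nu>
    using B_summable[OF e i, of \<nu>]
    by (rule summable_on_cong[THEN iffD1, rotated]) (rule B_quadratic[OF i orthonormal_basisD(1)[OF e]])
  have sm3: "(\<lambda>r. kernel_form Q (varpi \<gamma>) (e r) + x * kernel_form Q (varpi_mixed \<gamma> (d i)) (e r)
    + x\<^sup>2 * kernel_form Q (varpi (d i)) (e r)) summable_on I" if "x \<in> {\<epsilon> 0 i, \<epsilon> \<nu>1 i, \<epsilon> \<nu>2 i}" for x
    using that sm by blast
  note all = summable_on_quadratic_coefficients[of "\<epsilon> 0 i" "\<epsilon> \<nu>1 i" "\<epsilon> \<nu>2 i" _ _ _ I, OF sm3]
  show "(\<lambda>r. kernel_form Q (varpi \<gamma>) (e r)) summable_on I"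
    "(\<lambda>r. kernel_form Q (varpi_mixed \<gamma> (d i)) (e r)) summable_on I"
    "(\<lambda>r. kernel_form Q (varpi (d i)) (e r)) summable_on I"
    using 1 2 by (auto intro: all)
qed

lemma d_coefficients_summable:
  assumes e: "orthonormal_basis Q I e" and i: "i < k"
  shows "(\<lambda>r. (\<integral>x. d i (fst x) (snd x) * e r x \<partial>Q)\<^sup>2) summable_on I"
proof (rule nonneg_bdd_above_summable_on)
  show "bdd_above (sum (\<lambda>r. (\<integral>x. d i (fst x) (snd x) * e r x \<partial>Q)\<^sup>2) ` {F. F \<subseteq> I \<and> finite F})"
    using orthonormal_Bessel[OF e _ _ d_L2[OF i]] by (intro bdd_aboveI[of _ "\<integral>x. (d i (fst x) (snd x))\<^sup>2 \<partial>Q"]) auto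
qed simp

end

locale eigenbasis_samples = local_alternative_samples a b C k n M v \<gamma>s \<gamma> d \<tau>
  for a b C :: real and k :: nat and n :: "nat \<Rightarrow> nat \<Rightarrow> nat" and M :: "nat \<Rightarrow> 'w measure"
    and v :: "nat \<Rightarrow> nat \<Rightarrow> nat \<Rightarrow> real \<Rightarrow> 'w \<Rightarrow> real" and \<gamma>s :: "nat \<Rightarrow> nat \<Rightarrow> real \<Rightarrow> real \<Rightarrow> real"
    and \<gamma> :: "real \<Rightarrow> real \<Rightarrow> real" and d :: "nat \<Rightarrow> real \<Rightarrow> real \<Rightarrow> real" and \<tau> :: "nat \<Rightarrow> real" +
  fixes m :: enat and lam :: "nat \<Rightarrow> real" and \<phi> \<psi> :: "nat \<Rightarrow> real \<times> real \<Rightarrow> real" and U :: "real mat"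
  assumes eigenbasis: "varpi_eigenbasis a b \<gamma> m lam \<phi> \<psi>" and W_dec: "W_decomposition k \<tau> U"
begin

section \<open>Indexing of the eigenbasis\<close>

definition I :: "(nat + nat) set" where "I = pos_indices m <+> UNIV"
definition e where "e = case_sum \<phi> \<psi>"
definition Lam where "Lam = case_sum lam (\<lambda>_. 0)"
text \<open>Both halves are exhausted simultaneously, since \<open>m\<close> may be infinite.
  Positive eigenvalues are numbered from 1 and cut off by \<open>r \<le> R\<close>, the kernel is
  numbered from 0 and cut off below \<open>R\<close>.\<close>

definition J where "J R = Inl ` {r \<in> pos_indices m. r \<le> R} \<union> Inr ` {..<R}" for R :: nat
definition D where "D i r = (\<integral>x. d i (fst x) (snd x) * e r x \<partial>Q)"
definition \<delta>2 where "\<delta>2 r = delta_sq a b k U d (e r)"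

lemma e_basis: "orthonormal_basis Q I e"
  using eigenbasis by (simp add: varpi_eigenbasis_def I_def e_def)

lemma e_L2: "r \<in> I \<Longrightarrow> L2 Q (e r)"
  by (rule orthonormal_basisD(1)[OF e_basis])

lemma e_eigen: "r \<in> I \<Longrightarrow> eigenfunction Q (varpi \<gamma>) (Lam r) (e r)"
  using eigenbasis by (auto simp: varpi_eigenbasis_def I_def e_def Lam_def)

lemma lam_pos: "r \<in> pos_indices m \<Longrightarrow> 0 < lam r"
  using eigenbasis by (simp add: varpi_eigenbasis_def)

lemma Lam_nonneg: "r \<in> I \<Longrightarrow> 0 \<le> Lam r"
  using lam_pos by (auto simp: I_def Lam_def less_imp_le)

lemma J_props: "J R \<subseteq> I" "finite (J R)" "incseq J" "(\<Union>R. J R) = I"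
proof -
  show "J R \<subseteq> I" by (auto simp: J_def I_def)
  have "finite {r \<in> pos_indices m. r \<le> R}" by (rule finite_subset[of _ "{..R}"]) auto
  then show "finite (J R)" by (simp add: J_def)
  show "incseq J" by (auto simp: incseq_def J_def)
  show "(\<Union>R. J R) = I"
  proof
    show "I \<subseteq> (\<Union>R. J R)"
    proof
      fix r assume "r \<in> I"
      then consider r' where "r = Inl r'" "r' \<in> pos_indices m" | q where "r = Inr q" by (auto simp: I_def)
      then show "r \<in> (\<Union>R. J R)"
      proof cases
        case 1
        then have "r \<in> J r'" by (simp add: J_def)
        then show ?thesis by blast
      next
        case 2
        then have "r \<in> J (Suc q)" by (simp add: J_def)
        then show ?thesis by blast
      qed
    qed
  qed (auto simp: J_def I_def)
qed

lemma kernel_form_combination: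
  assumes "F \<subseteq> I" "finite F"
  shows "kernel_form Q (varpi \<gamma>) (\<lambda>x. \<Sum>r\<in>F. w r * e r x) = (\<Sum>r\<in>F. (w r)\<^sup>2 * Lam r)"
  by (rule finite_measure.kernel_form_eigen[OF finite_square_measure bounded_kernel_varpi[OF bounded_\<gamma>] e_basis assms e_eigen])

lemma kernel_form_e: "r \<in> I \<Longrightarrow> kernel_form Q (varpi \<gamma>) (e r) = Lam r"
  using kernel_form_combination[of "{r}" "\<lambda>_. 1"] by simp

text \<open>The eigenvalues are the diagonal terms of the unperturbed kernel, the constant
  coefficient of the quadratic expansion; any sample yields their summability, here sample
  0.\<close>

lemma Lam_summable: "Lam summable_on I"
  using coefficients_summable(1)[OF e_basis, of 0] k_ge_2
  by (subst summable_on_cong[of I Lam]) (auto simp: kernel_form_e)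

text \<open>A majorant of the coordinate energies that does not involve \<open>\<nu>\<close>: powers
  of \<open>\<epsilon>\<close> are at most 1, and the factor 2 bounds the ratio of
  \<open>n i\<close> to \<open>n i - 1\<close>.\<close>

definition G where
  "G r = (\<Sum>i<k. 2 * (\<bar>kernel_form Q (varpi \<gamma>) (e r)\<bar> + \<bar>kernel_form Q (varpi_mixed \<gamma> (d i)) (e r)\<bar>
    + \<bar>kernel_form Q (varpi (d i)) (e r)\<bar>) + (D i r)\<^sup>2)"

lemma summable_on_finite_sum:
  fixes f :: "'x \<Rightarrow> 'y \<Rightarrow> real"
  shows "(\<And>i. i \<in> A \<Longrightarrow> f i summable_on S) \<Longrightarrow> (\<lambda>r. \<Sum>i\<in>A. f i r) summable_on S"
  by (induction A rule: infinite_finite_induct) (auto intro: summable_on_add)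

lemma G_summable: "G summable_on I"
proof -
  have "(\<lambda>r. \<Sum>i<k. 2 * (\<bar>kernel_form Q (varpi \<gamma>) (e r)\<bar> + \<bar>kernel_form Q (varpi_mixed \<gamma> (d i)) (e r)\<bar>
    + \<bar>kernel_form Q (varpi (d i)) (e r)\<bar>) + (D i r)\<^sup>2) summable_on I"
  proof (intro summable_on_finite_sum summable_on_add summable_on_cmult_right)
    fix i assume "i \<in> {..<k}"
    then have i: "i < k" by simp
    have abs: "(\<lambda>r. \<bar>f r\<bar>) summable_on I" if "f summable_on I" for f :: "nat + nat \<Rightarrow> real"
      using that summable_on_iff_abs_summable_on_real[of f I] by simp
    show "(\<lambda>r. \<bar>kernel_form Q (varpi \<gamma>) (e r)\<bar>) summable_on I"
      "(\<lambda>r. \<bar>kernel_form Q (varpi_mixed \<gamma> (d i)) (e r)\<bar>) summable_on I"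
      "(\<lambda>r. \<bar>kernel_form Q (varpi (d i)) (e r)\<bar>) summable_on I"
      by (intro abs coefficients_summable[OF e_basis i])+
    show "(\<lambda>r. (D i r)\<^sup>2) summable_on I"
      unfolding D_def by (rule d_coefficients_summable[OF e_basis i])
  qed
  then show ?thesis by (simp add: G_def[abs_def])
qed

section \<open>Variance bounds uniform in the sample sizes\<close>

lemma S_variance_le:
  assumes i: "i < k" and r: "r \<in> I"
  shows "(\<integral>\<omega>. (fs.S \<nu> i (e r) \<omega>)\<^sup>2 \<partial>M \<nu>) \<le> 2 * fs.B \<nu> i (e r)"
proof -
  have "(\<epsilon> \<nu> i)\<^sup>2 \<le> 1" using \<epsilon>_bounds[OF i, of \<nu>] by (simp add: power_le_one)
  then show ?thesis
    unfolding fs.expectation_S_power2[OF i e_L2[OF r]] size_ratio[OF i]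
    using fs.B_nonneg[OF i e_L2[OF r], of \<nu>] by (intro mult_right_mono) auto
qed

lemma B_le:
  assumes i: "i < k" and r: "r \<in> I"
  shows "fs.B \<nu> i (e r) \<le> \<bar>kernel_form Q (varpi \<gamma>) (e r)\<bar> + \<bar>kernel_form Q (varpi_mixed \<gamma> (d i)) (e r)\<bar>
    + \<bar>kernel_form Q (varpi (d i)) (e r)\<bar>"
proof -
  have le: "x * y \<le> \<bar>y\<bar>" if "0 < x" "x \<le> 1" for x y :: real
  proof -
    have "x * y \<le> x * \<bar>y\<bar>" using that by (intro mult_left_mono) auto
    also have "\<dots> \<le> 1 * \<bar>y\<bar>" using that by (intro mult_right_mono) auto
    finally show ?thesis by simp
  qed
  have "0 < \<epsilon> \<nu> i" "\<epsilon> \<nu> i \<le> 1" "0 < (\<epsilon> \<nu> i)\<^sup>2" "(\<epsilon> \<nu> i)\<^sup>2 \<le> 1"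
    using \<epsilon>_bounds[OF i, of \<nu>] by (auto simp: power_le_one)
  then show ?thesis
    unfolding B_quadratic[OF i e_L2[OF r]] by (intro add_mono le) auto
qed

definition tl where "tl R = (\<Sum>\<^sub>\<infinity>r\<in>I. G r) - (\<Sum>r\<in>J R. G r)"

lemma G_nonneg: "0 \<le> G r"
  unfolding G_def by (intro sum_nonneg add_nonneg_nonneg mult_nonneg_nonneg) auto

lemma tl_tendsto: "tl \<longlonglongrightarrow> 0"
proof -
  have "(\<lambda>R. (\<Sum>\<^sub>\<infinity>r\<in>I. G r) - (\<Sum>r\<in>J R. G r)) \<longlonglongrightarrow> (\<Sum>\<^sub>\<infinity>r\<in>I. G r) - (\<Sum>\<^sub>\<infinity>r\<in>I. G r)"
    by (intro tendsto_diff tendsto_const exhaustion_sum_tendsto[OF J_props G_summable])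
  then show ?thesis by (simp add: tl_def[abs_def])
qed

lemma sum_tail_le:
  assumes "R \<le> R'"
  shows "(\<Sum>r\<in>J R' - J R. \<Sum>i<k. (\<integral>\<omega>. (fs.S \<nu> i (e r) \<omega>)\<^sup>2 \<partial>M \<nu>) + (D i r)\<^sup>2) \<le> tl R"
proof -
  have sub: "J R \<subseteq> J R'" using J_props(3) assms by (auto simp: incseq_def)
  have "(\<Sum>r\<in>J R' - J R. \<Sum>i<k. (\<integral>\<omega>. (fs.S \<nu> i (e r) \<omega>)\<^sup>2 \<partial>M \<nu>) + (D i r)\<^sup>2) \<le> (\<Sum>r\<in>J R' - J R. G r)"
    unfolding G_def
  proof (intro sum_mono add_right_mono)
    fix r i assume "r \<in> J R' - J R" "i \<in> {..<k}"
    then have r: "r \<in> I" and i: "i < k" using J_props(1)[of R'] by auto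
    show "(\<integral>\<omega>. (fs.S \<nu> i (e r) \<omega>)\<^sup>2 \<partial>M \<nu>) \<le> 2 * (\<bar>kernel_form Q (varpi \<gamma>) (e r)\<bar>
      + \<bar>kernel_form Q (varpi_mixed \<gamma> (d i)) (e r)\<bar> + \<bar>kernel_form Q (varpi (d i)) (e r)\<bar>)"
      by (rule order_trans[OF S_variance_le[OF i r] mult_left_mono[OF B_le[OF i r]]]) simp
  qed
  also have "\<dots> = (\<Sum>r\<in>J R'. G r) - (\<Sum>r\<in>J R. G r)"
    using sub J_props(2) by (simp add: sum_diff)
  also have "\<dots> \<le> tl R"
    unfolding tl_def using finite_sum_le_infsum[OF G_summable J_props(2,1)] G_nonneg by simp
  finally show ?thesis .
qed

lemma combination_L2: "L2 Q (\<lambda>x. \<Sum>r\<in>J R. w r * e r x)"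
  using J_props(1)[of R] by (intro L2_sum L2_cmult e_L2) auto

text \<open>The linear form within sample \<open>i\<close> is a single coordinate along
  \<open>f i\<close>, so the quantitative central limit theorem applies with one test function per
  sample. The variances are quadratic polynomials in \<open>\<epsilon>\<close>, up to the factor
  \<open>1 + \<epsilon>\<^sup>2\<close>, and converge to the form of \<open>varpi \<gamma>\<close>,
  which the eigenbasis diagonalizes.\<close>

lemma char_tendsto:
  "(\<lambda>\<nu>. \<integral>\<omega>. iexp (\<Sum>i<k. \<Sum>r\<in>J R. w i r * fs.S \<nu> i (e r) \<omega>) \<partial>M \<nu>)
    \<longlonglongrightarrow> complex_of_real (exp (- ((\<Sum>i<k. \<Sum>r\<in>J R. (w i r)\<^sup>2 * Lam r) / 2)))"
proof -
  define f where "f i x = (\<Sum>r\<in>J R. w i r * e r x)" for i x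
  have fL: "L2 Q (f i)" for i unfolding f_def[abs_def] by (rule combination_L2)
  define L where "L = (\<Sum>i<k. ((\<integral>x. (f i x)\<^sup>2 \<partial>Q) * measure Q (space Q))\<^sup>2 * (848 * C ^ 4))"
  have L: "((\<integral>x. (f i x)\<^sup>2 \<partial>Q) * measure Q (space Q))\<^sup>2 * (848 * C ^ 4) \<le> L" if "i < k" for i
    unfolding L_def using that by (intro member_le_sum) auto
  have S_eq: "(\<integral>\<omega>. iexp (\<Sum>i<k. \<Sum>r\<in>J R. w i r * fs.S \<nu> i (e r) \<omega>) \<partial>M \<nu>)
    = (\<integral>\<omega>. iexp (\<Sum>i<k. fs.S \<nu> i (f i) \<omega>) \<partial>M \<nu>)" for \<nu>
  proof (rule integral_cong_AE)
    have "AE \<omega> in M \<nu>. \<forall>i\<in>{..<k}. fs.S \<nu> i (f i) \<omega> = (\<Sum>r\<in>J R. w i r * fs.S \<nu> i (e r) \<omega>)"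
      unfolding f_def[abs_def] using J_props(1)[of R]
      by (intro AE_finite_allI fs.S_linear e_L2) auto
    then show "AE \<omega> in M \<nu>. iexp (\<Sum>i<k. \<Sum>r\<in>J R. w i r * fs.S \<nu> i (e r) \<omega>) = iexp (\<Sum>i<k. fs.S \<nu> i (f i) \<omega>)"
      by eventually_elim simp
    have "fs.S \<nu> i (e r) \<in> borel_measurable (M \<nu>)" if "i < k" "r \<in> J R" for i r
      using J_props(1)[of R] that by (intro L2_measurable[OF fs.S_L2] e_L2) auto
    then have [measurable]: "(\<lambda>\<omega>. \<Sum>i<k. \<Sum>r\<in>J R. w i r * fs.S \<nu> i (e r) \<omega>) \<in> borel_measurable (M \<nu>)"
      by (intro borel_measurable_sum borel_measurable_times borel_measurable_const) auto
    show "(\<lambda>\<omega>. iexp (\<Sum>i<k. \<Sum>r\<in>J R. w i r * fs.S \<nu> i (e r) \<omega>)) \<in> borel_measurable (M \<nu>)"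
      by measurable
    have [measurable]: "(\<lambda>\<omega>. \<Sum>i<k. fs.S \<nu> i (f i) \<omega>) \<in> borel_measurable (M \<nu>)"
      by (intro borel_measurable_sum L2_measurable[OF fs.S_L2] fL) auto
    show "(\<lambda>\<omega>. iexp (\<Sum>i<k. fs.S \<nu> i (f i) \<omega>)) \<in> borel_measurable (M \<nu>)"
      by measurable
  qed
  define err where "err \<nu> = (\<Sum>i<k. (1 + (\<epsilon> \<nu> i)\<^sup>2) * (\<epsilon> \<nu> i * (1 + L) + (\<epsilon> \<nu> i)\<^sup>2 * L))" for \<nu>
  define V where "V \<nu> = (\<Sum>i<k. (1 + (\<epsilon> \<nu> i)\<^sup>2) * fs.B \<nu> i (f i))" for \<nu>
  have bound: "cmod ((\<integral>\<omega>. iexp (\<Sum>i<k. fs.S \<nu> i (f i) \<omega>) \<partial>M \<nu>) - complex_of_real (exp (- V \<nu> / 2))) \<le> err \<nu>" for \<nu>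
  proof -
    have "(\<Sum>i<k. real (n \<nu> i) * ((1 / sqrt (real (n \<nu> i) - 1)) ^ 3 * (1 + L) + (1 / sqrt (real (n \<nu> i) - 1)) ^ 4 * L)) = err \<nu>"
      unfolding err_def
    proof (intro sum.cong refl)
      fix i assume "i \<in> {..<k}"
      then have i: "i < k" by simp
      \<comment> \<open>Two of the at least three powers of \<open>\<epsilon>\<close> compensate the
        number of summands; what remains makes the error vanish.\<close>
      have "real (n \<nu> i) * (\<epsilon> \<nu> i)\<^sup>2 = 1 + (\<epsilon> \<nu> i)\<^sup>2"
      proof -
        have "real (n \<nu> i) * (\<epsilon> \<nu> i)\<^sup>2 = real (n \<nu> i) / (real (n \<nu> i) - 1)" by (simp add: \<epsilon>_power2[OF i])
        then show ?thesis by (simp only: size_ratio[OF i])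
      qed
      moreover have "real (n \<nu> i) * (\<epsilon> \<nu> i ^ 3 * (1 + L) + \<epsilon> \<nu> i ^ 4 * L)
        = real (n \<nu> i) * (\<epsilon> \<nu> i)\<^sup>2 * (\<epsilon> \<nu> i * (1 + L) + (\<epsilon> \<nu> i)\<^sup>2 * L)"
      proof -
        have "N * (x ^ 3 * y + x ^ 4 * z) = N * x\<^sup>2 * (x * y + x\<^sup>2 * z)" for N x y z :: real
          by (simp add: power2_eq_square power3_eq_cube power4_eq_xxxx distrib_left)
        then show ?thesis .
      qed
      ultimately have "real (n \<nu> i) * (\<epsilon> \<nu> i ^ 3 * (1 + L) + \<epsilon> \<nu> i ^ 4 * L)
        = (1 + (\<epsilon> \<nu> i)\<^sup>2) * (\<epsilon> \<nu> i * (1 + L) + (\<epsilon> \<nu> i)\<^sup>2 * L)"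
        by (simp only:)
      then show "real (n \<nu> i) * ((1 / sqrt (real (n \<nu> i) - 1)) ^ 3 * (1 + L) + (1 / sqrt (real (n \<nu> i) - 1)) ^ 4 * L)
        = (1 + (\<epsilon> \<nu> i)\<^sup>2) * (\<epsilon> \<nu> i * (1 + L) + (\<epsilon> \<nu> i)\<^sup>2 * L)"
        unfolding \<epsilon>_def .
    qed
    moreover have "(\<Sum>i<k. real (n \<nu> i) / (real (n \<nu> i) - 1) * fs.B \<nu> i (f i)) = V \<nu>"
      unfolding V_def by (intro sum.cong refl) (simp add: size_ratio)
    ultimately show ?thesis
      using fs.char_S_approx[of f L \<nu>, OF fL L] by (simp only:)
  qed
  have err_lim: "err \<longlonglongrightarrow> 0"
  proof -
    have "err \<longlonglongrightarrow> (\<Sum>i<k. (1 + 0\<^sup>2) * (0 * (1 + L) + 0\<^sup>2 * L))"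
      unfolding err_def by (intro tendsto_intros \<epsilon>_tendsto) auto
    then show ?thesis by simp
  qed
  have diff: "(\<lambda>\<nu>. (\<integral>\<omega>. iexp (\<Sum>i<k. fs.S \<nu> i (f i) \<omega>) \<partial>M \<nu>) - complex_of_real (exp (- V \<nu> / 2))) \<longlonglongrightarrow> 0"
    by (rule Lim_null_comparison[OF always_eventually err_lim]) (use bound in blast)
  have "V \<longlonglongrightarrow> (\<Sum>i<k. (1 + 0\<^sup>2) * (kernel_form Q (varpi \<gamma>) (f i) + 0 * kernel_form Q (varpi_mixed \<gamma> (d i)) (f i)
      + 0\<^sup>2 * kernel_form Q (varpi (d i)) (f i)))"
    unfolding V_def
  proof (rule tendsto_sum)
    fix i assume "i \<in> {..<k}"
    then have i: "i < k" by simp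
    show "(\<lambda>\<nu>. (1 + (\<epsilon> \<nu> i)\<^sup>2) * fs.B \<nu> i (f i)) \<longlonglongrightarrow> (1 + 0\<^sup>2) * (kernel_form Q (varpi \<gamma>) (f i)
      + 0 * kernel_form Q (varpi_mixed \<gamma> (d i)) (f i) + 0\<^sup>2 * kernel_form Q (varpi (d i)) (f i))"
      unfolding B_quadratic[OF i fL] by (intro tendsto_intros \<epsilon>_tendsto i)
  qed
  then have "V \<longlonglongrightarrow> (\<Sum>i<k. kernel_form Q (varpi \<gamma>) (f i))" by simp
  also have "(\<Sum>i<k. kernel_form Q (varpi \<gamma>) (f i)) = (\<Sum>i<k. \<Sum>r\<in>J R. (w i r)\<^sup>2 * Lam r)"
    unfolding f_def[abs_def] by (simp add: kernel_form_combination[OF J_props(1,2)])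
  finally have V_lim: "V \<longlonglongrightarrow> (\<Sum>i<k. \<Sum>r\<in>J R. (w i r)\<^sup>2 * Lam r)" .
  have main: "(\<lambda>\<nu>. complex_of_real (exp (- V \<nu> / 2)))
      \<longlonglongrightarrow> complex_of_real (exp (- (\<Sum>i<k. \<Sum>r\<in>J R. (w i r)\<^sup>2 * Lam r) / 2))"
    by (intro tendsto_of_real tendsto_exp tendsto_divide tendsto_minus tendsto_const V_lim) simp
  from tendsto_add[OF diff main] have
    "(\<lambda>\<nu>. \<integral>\<omega>. iexp (\<Sum>i<k. fs.S \<nu> i (f i) \<omega>) \<partial>M \<nu>)
      \<longlonglongrightarrow> complex_of_real (exp (- (\<Sum>i<k. \<Sum>r\<in>J R. (w i r)\<^sup>2 * Lam r) / 2))"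
    by (simp only: diff_add_cancel add_0_left)
  then show ?thesis unfolding S_eq minus_divide_left .
qed

definition c0 where "c0 = 2 * trace_bound"

lemma S_variance_bounded:
  assumes i: "i < k" and r: "r \<in> I"
  shows "(\<integral>\<omega>. (fs.S \<nu> i (e r) \<omega>)\<^sup>2 \<partial>M \<nu>) \<le> c0"
  using S_variance_le[OF i r, of \<nu>] fs.B_Bessel[OF e_basis _ _ i, of "{r}" \<nu>] r
  unfolding c0_def trace_bound_def by simp

sublocale quadratic_limit M k J "\<lambda>\<nu> i r. fs.S \<nu> i (e r)" "\<lambda>\<nu> i r. fs.E \<nu> i (e r)" "\<lambda>\<nu>. fs.\<rho> \<nu>" D
  "\<lambda>\<nu>. fs.weight \<nu>" "\<lambda>i. sqrt (\<tau> i)" "\<lambda>\<nu>. fs.T \<nu>" Lam tl c0 "\<lambda>l i. U $$ (i, l)"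
proof (rule quadratic_limit.intro)
  have k0: "0 < k" using k_ge_2 by simp
  show "prob_space (M \<nu>)" for \<nu> by (rule fs.prob_space_axioms)
  show "finite (J R)" for R by (rule J_props)
  show "incseq J" by (rule J_props)
  show "L2 (M \<nu>) (fs.S \<nu> i (e r))" if "i < k" "r \<in> (\<Union>R. J R)" for \<nu> i r
    using that unfolding J_props(4) by (intro fs.S_L2 e_L2)
  show "fs.E \<nu> i (e r) \<in> borel_measurable (M \<nu>)" if "i < k" "r \<in> (\<Union>R. J R)" for \<nu> i r
    using that unfolding J_props(4) by (intro fs.E_measurable e_L2)
  show "integrable (M \<nu>) (fs.\<rho> \<nu> i)" if "i < k" for \<nu> i by (rule fs.\<rho>_integrable[OF that])
  show "0 \<le> fs.\<rho> \<nu> i \<omega>" if "i < k" for \<nu> i \<omega> by (rule fs.\<rho>_nonneg[OF that])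
  show "fs.T \<nu> \<in> borel_measurable (M \<nu>)" for \<nu> by (rule fs.T_measurable)
  show "AE \<omega> in M \<nu>. (\<lambda>R. \<Sum>r\<in>J R. \<Sum>i<k. (fs.S \<nu> i (e r) \<omega> + D i r + fs.E \<nu> i (e r) \<omega>
    - fs.weight \<nu> i * (\<Sum>j<k. fs.weight \<nu> j * (fs.S \<nu> j (e r) \<omega> + D j r + fs.E \<nu> j (e r) \<omega>)))\<^sup>2) \<longlonglongrightarrow> fs.T \<nu> \<omega>" for \<nu>
    using fs.T_Parseval[OF e_basis J_props alternative d_L2, of \<nu>] unfolding D_def .
  show "AE \<omega> in M \<nu>. \<forall>R. (\<Sum>r\<in>J R. (fs.E \<nu> i (e r) \<omega>)\<^sup>2) \<le> 2 * (fs.\<rho> \<nu> i \<omega>)\<^sup>2" if "i < k" for \<nu> i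
    by (rule fs.E_Bessel[OF e_basis J_props(1,2) that])
  show "(\<lambda>\<nu>. \<integral>\<omega>. fs.\<rho> \<nu> i \<omega> \<partial>M \<nu>) \<longlonglongrightarrow> 0" if i: "i < k" for i
  proof (rule tendsto_sandwich[of "\<lambda>_. 0"])
    show "\<forall>\<^sub>F \<nu> in sequentially. 0 \<le> (\<integral>\<omega>. fs.\<rho> \<nu> i \<omega> \<partial>M \<nu>)"
      by (intro always_eventually allI Bochner_Integration.integral_nonneg fs.\<rho>_nonneg i)
    show "\<forall>\<^sub>F \<nu> in sequentially. (\<integral>\<omega>. fs.\<rho> \<nu> i \<omega> \<partial>M \<nu>) \<le> 2 * (C * (b - a)) * \<epsilon> \<nu> i"
      by (intro always_eventually allI) (use fs.expectation_\<rho>[OF i] in \<open>simp add: \<epsilon>_def\<close>)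
    have "(\<lambda>\<nu>. 2 * (C * (b - a)) * \<epsilon> \<nu> i) \<longlonglongrightarrow> 2 * (C * (b - a)) * 0"
      by (intro tendsto_intros \<epsilon>_tendsto i)
    then show "(\<lambda>\<nu>. 2 * (C * (b - a)) * \<epsilon> \<nu> i) \<longlonglongrightarrow> 0" by simp
  qed simp
  show "(\<Sum>r\<in>J R' - J R. \<Sum>i<k. (\<integral>\<omega>. (fs.S \<nu> i (e r) \<omega>)\<^sup>2 \<partial>M \<nu>) + (D i r)\<^sup>2) \<le> tl R" if "R \<le> R'" for R R' \<nu>
    by (rule sum_tail_le[OF that])
  show "tl \<longlonglongrightarrow> 0" by (rule tl_tendsto)
  show "(\<integral>\<omega>. (fs.S \<nu> i (e r) \<omega>)\<^sup>2 \<partial>M \<nu>) \<le> c0" if "i < k" "r \<in> (\<Union>R. J R)" for \<nu> i r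
    using that unfolding J_props(4) by (intro S_variance_bounded)
  show "(\<lambda>\<nu>. \<integral>\<omega>. iexp (\<Sum>i<k. \<Sum>r\<in>J R. w i r * fs.S \<nu> i (e r) \<omega>) \<partial>M \<nu>)
    \<longlonglongrightarrow> complex_of_real (exp (- ((\<Sum>i<k. \<Sum>r\<in>J R. (w i r)\<^sup>2 * Lam r) / 2)))" for R w
    by (rule char_tendsto)
  show "(\<Sum>i<k. (fs.weight \<nu> i)\<^sup>2) = 1" for \<nu> by (rule fs.weight_norm[OF k0])
  show "(\<lambda>\<nu>. fs.weight \<nu> i) \<longlonglongrightarrow> sqrt (\<tau> i)" if "i < k" for i by (rule weight_tendsto[OF that])
  show "(\<Sum>i<k. (x i - sqrt (\<tau> i) * (\<Sum>j<k. sqrt (\<tau> j) * x j))\<^sup>2) = (\<Sum>l<k - 1. (\<Sum>i<k. U $$ (i, l) * x i)\<^sup>2)" for x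
  proof -
    have "0 \<le> \<tau> i" if "i < k" for i using \<tau>_pos[OF that] by simp
    from W_decomposition_projection[where x = x, OF W_dec this \<tau>_sum] show ?thesis .
  qed
  show "(\<Sum>i<k. U $$ (i, l) * U $$ (i, l')) = (if l = l' then 1 else 0)" if "l < k - 1" "l' < k - 1" for l l'
    using that by (intro W_decomposition_orthonormal[OF W_dec]) auto
  show "0 \<le> Lam r" if "r \<in> (\<Union>R. J R)" for r using that unfolding J_props(4) by (rule Lam_nonneg)
qed

section \<open>Identification of the limit\<close>

lemma \<delta>2_eq: "r \<in> I \<Longrightarrow> \<delta>2 r = (\<Sum>l<k - 1. (\<Sum>i<k. U $$ (i, l) * D i r)\<^sup>2)"
  using delta_sq_eq[where d = d and f = "e r", OF W_dec d_L2 e_L2] unfolding \<delta>2_def D_def .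

lemma \<delta>2_nonneg: "r \<in> I \<Longrightarrow> 0 \<le> \<delta>2 r"
  by (simp add: \<delta>2_eq sum_nonneg)

text \<open>The rows taken from \<open>U\<close> describe a projection, which does not increase
  norms, so Bessel's inequality for the \<open>d i\<close> dominates.\<close>

lemma \<delta>2_summable: "\<delta>2 summable_on I"
proof (rule summable_on_comparison_test[of "\<lambda>r. \<Sum>i<k. (D i r)\<^sup>2"])
  show "(\<lambda>r. \<Sum>i<k. (D i r)\<^sup>2) summable_on I"
    unfolding D_def by (intro summable_on_finite_sum d_coefficients_summable[OF e_basis]) auto
  fix r assume r: "r \<in> I"
  have "(\<Sum>i<k. (sqrt (\<tau> i))\<^sup>2) = 1" using \<tau>_pos \<tau>_sum by (simp add: less_imp_le)
  note sum_squares_residual[OF this, of "\<lambda>i. D i r"]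
  then show "\<delta>2 r \<le> (\<Sum>i<k. (D i r)\<^sup>2)"
    unfolding \<delta>2_eq[OF r] projection[symmetric] by simp
  show "0 \<le> \<delta>2 r" by (rule \<delta>2_nonneg[OF r])
qed

text \<open>On the kernel \<open>Lam\<close> is 0 and the factor degenerates to
  \<open>exp (- (\<theta> * \<delta>2 r))\<close>, the Laplace transform of a constant: this is the
  origin of the deterministic series in the limit. The other factors belong to noncentral
  chi-squared variables scaled by \<open>lam r\<close>.\<close>

lemma truncated_limit_eq:
  assumes \<theta>: "0 \<le> \<theta>"
  shows "(\<Prod>r\<in>J R. \<Prod>l<k - 1. exp (- (\<theta> * (\<Sum>i<k. U $$ (i, l) * D i r)\<^sup>2 / (1 + 2 * \<theta> * Lam r))) / sqrt (1 + 2 * \<theta> * Lam r))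
    = (\<Prod>r\<in>{r \<in> pos_indices m. r \<le> R}. exp (- (\<theta> * \<delta>2 (Inl r) / (1 + 2 * \<theta> * lam r))) / sqrt (1 + 2 * \<theta> * lam r) ^ (k - 1))
      * exp (- (\<theta> * (\<Sum>q<R. \<delta>2 (Inr q))))"
proof -
  define h where "h r = exp (- (\<theta> * \<delta>2 r / (1 + 2 * \<theta> * Lam r))) / sqrt (1 + 2 * \<theta> * Lam r) ^ (k - 1)" for r
  have "(\<Prod>l<k - 1. exp (- (\<theta> * (\<Sum>i<k. U $$ (i, l) * D i r)\<^sup>2 / (1 + 2 * \<theta> * Lam r))) / sqrt (1 + 2 * \<theta> * Lam r)) = h r"
    if "r \<in> J R" for r
  proof -
    have r: "r \<in> I" using that J_props(1) by auto
    have "- (\<theta> * \<delta>2 r / (1 + 2 * \<theta> * Lam r)) = (\<Sum>l<k - 1. - (\<theta> * (\<Sum>i<k. U $$ (i, l) * D i r)\<^sup>2 / (1 + 2 * \<theta> * Lam r)))"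
      unfolding \<delta>2_eq[OF r] by (simp only: sum_negf sum_divide_distrib sum_distrib_left)
    then have "exp (- (\<theta> * \<delta>2 r / (1 + 2 * \<theta> * Lam r))) = (\<Prod>l<k - 1. exp (- (\<theta> * (\<Sum>i<k. U $$ (i, l) * D i r)\<^sup>2 / (1 + 2 * \<theta> * Lam r))))"
      by (simp only: exp_sum[OF finite_lessThan])
    then show ?thesis by (simp add: h_def prod_dividef)
  qed
  then have "(\<Prod>r\<in>J R. \<Prod>l<k - 1. exp (- (\<theta> * (\<Sum>i<k. U $$ (i, l) * D i r)\<^sup>2 / (1 + 2 * \<theta> * Lam r))) / sqrt (1 + 2 * \<theta> * Lam r))
    = (\<Prod>r\<in>J R. h r)" by (intro prod.cong refl)
  also have "\<dots> = (\<Prod>r\<in>Inl ` {r \<in> pos_indices m. r \<le> R}. h r) * (\<Prod>r\<in>Inr ` {..<R}. h r)"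
    unfolding J_def using J_props(2)[of R] by (intro prod.union_disjoint) (auto simp: J_def)
  also have "(\<Prod>r\<in>Inl ` {r \<in> pos_indices m. r \<le> R}. h r) = (\<Prod>r\<in>{r \<in> pos_indices m. r \<le> R}. h (Inl r))"
    by (subst prod.reindex) auto
  also have "(\<Prod>r\<in>Inr ` {..<R}. h r) = (\<Prod>q<R. exp (- (\<theta> * \<delta>2 (Inr q))))"
    by (subst prod.reindex) (auto simp: h_def Lam_def)
  also have "\<dots> = exp (- (\<theta> * (\<Sum>q<R. \<delta>2 (Inr q))))"
    by (simp only: exp_sum[OF finite_lessThan, symmetric] sum_negf sum_distrib_left)
  finally show ?thesis by (simp add: h_def Lam_def)
qed

end

section \<open>Invariance under shifts by the mean functions\<close>

lemma sample_cov_shift: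
  assumes "\<And>j. j < n \<Longrightarrow> y j s = p + v j s" "\<And>j. j < n \<Longrightarrow> y j t = q + v j t" and n: "0 < n"
  shows "sample_cov n y s t = sample_cov n v s t"
proof -
  have m: "sample_mean n y r = x + sample_mean n v r" if "\<And>j. j < n \<Longrightarrow> y j r = x + v j r" for r x
    using that n by (simp add: sample_mean_def sum.distrib add_divide_distrib)
  show ?thesis
    unfolding sample_cov_def m[OF assms(1), simplified] m[OF assms(2), simplified]
    by (intro arg_cong2[where f = "(/)"] sum.cong refl) (simp add: assms(1,2))
qed

lemma T_statistic_shift:
  assumes y: "\<And>i j t. i < k \<Longrightarrow> j < n i \<Longrightarrow> t \<in> {a..b} \<Longrightarrow> y i j t = \<eta> i t + v i j t"
    and n: "\<And>i. i < k \<Longrightarrow> 0 < n i"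
  shows "T_statistic a b k n y = T_statistic a b k n v"
proof -
  have sc: "sample_cov (n i) (y i) s t = sample_cov (n i) (v i) s t"
    if "i < k" "s \<in> {a..b}" "t \<in> {a..b}" for i s t
    by (rule sample_cov_shift[where p = "\<eta> i s" and q = "\<eta> i t"]) (use y n that in auto)
  then have "pooled_cov k n y s t = pooled_cov k n v s t" if "s \<in> {a..b}" "t \<in> {a..b}" for s t
    unfolding pooled_cov_def using that by simp
  with sc show ?thesis
    unfolding T_statistic_def
    by (intro sum.cong refl arg_cong2[where f = "(*)"] Bochner_Integration.integral_cong) auto
qed

theorem theorem3:
  fixes a b :: real
    and k :: nat
    and n :: "nat \<Rightarrow> nat \<Rightarrow> nat"
    and M :: "nat \<Rightarrow> 'w measure"
    and \<eta> :: "nat \<Rightarrow> real \<Rightarrow> real"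
    and y v :: "nat \<Rightarrow> nat \<Rightarrow> nat \<Rightarrow> real \<Rightarrow> 'w \<Rightarrow> real"
    and \<gamma>s :: "nat \<Rightarrow> nat \<Rightarrow> real \<Rightarrow> real \<Rightarrow> real"
    and \<gamma> :: "real \<Rightarrow> real \<Rightarrow> real"
    and d :: "nat \<Rightarrow> real \<Rightarrow> real \<Rightarrow> real"
    and \<tau> :: "nat \<Rightarrow> real"
    and m :: enat
    and lam :: "nat \<Rightarrow> real"
    and \<phi> \<psi> :: "nat \<Rightarrow> real \<times> real \<Rightarrow> real"
    and U :: "real mat"
    and N :: "'p measure"
    and A :: "nat \<Rightarrow> 'p \<Rightarrow> real"
  assumes "a < b" and "k \<ge> 2"
    and prob: "\<And>\<nu>. prob_space (M \<nu>)"
    and size_ge_2: "\<And>\<nu> i. i < k \<Longrightarrow> n \<nu> i \<ge> 2"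
    \<comment> \<open>the model\<close>
    and \<eta>_L2: "\<And>i. i < k \<Longrightarrow> L2 (interval_measure_on a b) (\<eta> i)"
    and y_eq: "\<And>\<nu> i j t \<omega>. i < k \<Longrightarrow> j < n \<nu> i \<Longrightarrow> t \<in> {a..b} \<Longrightarrow> \<omega> \<in> space (M \<nu>) \<Longrightarrow>
        y \<nu> i j t \<omega> = \<eta> i t + v \<nu> i j t \<omega>"
    and v_measurable: "\<And>\<nu> i j. i < k \<Longrightarrow> j < n \<nu> i \<Longrightarrow>
        (\<lambda>(t, \<omega>). v \<nu> i j t \<omega>) \<in> borel_measurable (interval_measure_on a b \<Otimes>\<^sub>M M \<nu>)"
    and v_indep: "\<And>\<nu>. prob_space.indep_vars (M \<nu>) (\<lambda>_. PiM {a..b} (\<lambda>_. borel))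
        (\<lambda>(i, j). sample_path {a..b} (v \<nu> i j)) (SIGMA i:{..<k}. {..<n \<nu> i})"
    and v_identically_distributed: "\<And>\<nu> i j j'. i < k \<Longrightarrow> j < n \<nu> i \<Longrightarrow> j' < n \<nu> i \<Longrightarrow>
        process_law (M \<nu>) {a..b} (v \<nu> i j) = process_law (M \<nu>) {a..b} (v \<nu> i j')"
    and v_mean_cov: "\<And>\<nu> i j. i < k \<Longrightarrow> j < n \<nu> i \<Longrightarrow>
        has_mean_cov (M \<nu>) {a..b} (v \<nu> i j) (\<lambda>_. 0) (\<gamma>s \<nu> i)"
    and trace_finite: "\<And>\<nu> i. i < k \<Longrightarrow>
        integrable (interval_measure_on a b) (\<lambda>t. \<gamma>s \<nu> i t t)"
    \<comment> \<open>(A1), (A2), (A3)\<close>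
    and A1: "\<And>\<nu> i j. i < k \<Longrightarrow> j < n \<nu> i \<Longrightarrow> gaussian_process (M \<nu>) {a..b} (v \<nu> i j)"
    and A2_size: "filterlim (\<lambda>\<nu>. \<Sum>i<k. n \<nu> i) at_top sequentially"
    and A2_ratio: "\<And>i. i < k \<Longrightarrow>
        (\<lambda>\<nu>. real (n \<nu> i) / real (\<Sum>i'<k. n \<nu> i')) \<longlonglongrightarrow> \<tau> i"
    and A2_range: "\<And>i. i < k \<Longrightarrow> 0 < \<tau> i \<and> \<tau> i < 1"
    and A3: "\<exists>C. \<forall>\<nu>. \<forall>i<k. \<forall>s\<in>{a..b}. \<forall>t\<in>{a..b}. \<bar>\<gamma>s \<nu> i s t\<bar> \<le> C"
    \<comment> \<open>the local alternative\<close>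
    and \<gamma>_cov: "covariance_function {a..b} \<gamma>"
    and local_alternative: "\<And>\<nu> i s t. i < k \<Longrightarrow> s \<in> {a..b} \<Longrightarrow> t \<in> {a..b} \<Longrightarrow>
        \<gamma>s \<nu> i s t = \<gamma> s t + d i s t / sqrt (real (n \<nu> i) - 1)"
    \<comment> \<open>spectral quantities and the limiting variables\<close>
    and eigenbasis: "varpi_eigenbasis a b \<gamma> m lam \<phi> \<psi>"
    and W_dec: "W_decomposition k \<tau> U"
    and prob_N: "prob_space N"
    and A_indep: "prob_space.indep_vars N (\<lambda>_. borel) A (pos_indices m)"
    and A_distr: "\<And>r. r \<in> pos_indices m \<Longrightarrow>
        distr N borel (A r) = noncentral_chi_square (k - 1) (delta_sq a b k U d (\<phi> r) / lam r)"
  shows "(AE x in N. (\<lambda>r. lam r * A r x) summable_on pos_indices m) \<and>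
    (\<lambda>q. delta_sq a b k U d (\<psi> q)) summable_on UNIV \<and>
    weak_conv_m
      (\<lambda>\<nu>. distr (M \<nu>) borel (\<lambda>\<omega>. T_statistic a b k (n \<nu>) (\<lambda>i j t. y \<nu> i j t \<omega>)))
      (distr N borel (\<lambda>x. (\<Sum>\<^sub>\<infinity>r\<in>pos_indices m. lam r * A r x)
                        + (\<Sum>\<^sub>\<infinity>q. delta_sq a b k U d (\<psi> q))))"
proof -
  obtain C where C: "\<And>\<nu> i s t. i < k \<Longrightarrow> s \<in> {a..b} \<Longrightarrow> t \<in> {a..b} \<Longrightarrow> \<bar>\<gamma>s \<nu> i s t\<bar> \<le> C"
    using A3 by blast
  interpret es: eigenbasis_samples a b C k n M v \<gamma>s \<gamma> d \<tau> m lam \<phi> \<psi> U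
  proof (rule eigenbasis_samples.intro[OF local_alternative_samples.intro eigenbasis_samples_axioms.intro])
    show "functional_samples (M \<nu>) a b C k (n \<nu>) (v \<nu>) (\<gamma>s \<nu>)" for \<nu>
      by (rule functional_samples.intro[OF prob functional_samples_axioms.intro])
        (fact \<open>a < b\<close> size_ge_2 v_measurable v_indep v_mean_cov A1 C)+
    show "0 < \<tau> i" if "i < k" for i using A2_range[OF that] by simp
  qed (fact \<open>2 \<le> k\<close> A2_size A2_ratio local_alternative eigenbasis W_dec)+
  define T where "T \<nu> \<omega> = T_statistic a b k (n \<nu>) (\<lambda>i j t. y \<nu> i j t \<omega>)" for \<nu> \<omega>
  \<comment> \<open>The observations are shifted noise only on the sample space, so measurability
    and integrals are transferred by congruence there.\<close>
  have T_eq: "T \<nu> \<omega> = es.fs.T \<nu> \<omega>" if "\<omega> \<in> space (M \<nu>)" for \<nu> \<omega>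
    unfolding T_def
  proof (rule T_statistic_shift[where \<eta> = \<eta>])
    show "y \<nu> i j t \<omega> = \<eta> i t + v \<nu> i j t \<omega>" if "i < k" "j < n \<nu> i" "t \<in> {a..b}" for i j t
      by (rule y_eq[OF that \<open>\<omega> \<in> space (M \<nu>)\<close>])
    show "0 < n \<nu> i" if "i < k" for i using size_ge_2[OF that, of \<nu>] by simp
  qed
  have T_meas: "T \<nu> \<in> borel_measurable (M \<nu>)" for \<nu>
    using measurable_cong[of "M \<nu>" "T \<nu>" "es.fs.T \<nu>" borel, OF T_eq] es.fs.T_measurable by blast
  have T_nonneg: "0 \<le> T \<nu> \<omega>" if "\<omega> \<in> space (M \<nu>)" for \<nu> \<omega>
    unfolding T_eq[OF that] by (rule es.fs.T_nonneg)
  have \<delta>2_Inl: "es.\<delta>2 (Inl r) = delta_sq a b k U d (\<phi> r)" and \<delta>2_Inr: "es.\<delta>2 (Inr r) = delta_sq a b k U d (\<psi> r)" for r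
    by (simp_all add: es.\<delta>2_def es.e_def)
  have sum_Inl: "(\<lambda>r. f (Inl r)) summable_on pos_indices m" and sum_Inr: "(\<lambda>q. f (Inr q)) summable_on UNIV"
    if "f summable_on es.I" for f :: "nat + nat \<Rightarrow> real"
  proof -
    have "f summable_on (Inl ` pos_indices m)" "f summable_on range Inr"
      by (rule summable_on_subset_banach[OF that]; auto simp: es.I_def)+
    then show "(\<lambda>r. f (Inl r)) summable_on pos_indices m" "(\<lambda>q. f (Inr q)) summable_on UNIV"
      by (simp_all add: summable_on_reindex comp_def)
  qed
  interpret lv: limit_variable N A "pos_indices m" lam "\<lambda>r. delta_sq a b k U d (\<phi> r)" "k - 1"
  proof (rule limit_variable.intro[OF prob_N limit_variable_axioms.intro])
    show "0 \<le> delta_sq a b k U d (\<phi> r)" if "r \<in> pos_indices m" for r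
      using es.\<delta>2_nonneg[of "Inl r"] that by (simp add: \<delta>2_Inl es.I_def InlI)
    show "0 < k - 1" using \<open>2 \<le> k\<close> by simp
    show "lam summable_on pos_indices m"
      using sum_Inl[OF es.Lam_summable] by (simp add: es.Lam_def)
    show "(\<lambda>r. delta_sq a b k U d (\<phi> r)) summable_on pos_indices m"
      using sum_Inl[OF es.\<delta>2_summable] by (simp add: \<delta>2_Inl)
  qed (fact A_indep A_distr es.lam_pos)+
  define c where "c = (\<Sum>\<^sub>\<infinity>q. delta_sq a b k U d (\<psi> q))"
  have c_summable: "(\<lambda>q. delta_sq a b k U d (\<psi> q)) summable_on UNIV"
    using sum_Inr[OF es.\<delta>2_summable] by (simp add: \<delta>2_Inr)
  have \<psi>_nonneg: "0 \<le> delta_sq a b k U d (\<psi> q)" for q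
    using es.\<delta>2_nonneg[of "Inr q"] by (simp add: \<delta>2_Inr es.I_def InrI)
  have c_nonneg: "0 \<le> c" unfolding c_def by (rule infsum_nonneg) (rule \<psi>_nonneg)
  define X where "X x = (\<Sum>\<^sub>\<infinity>r\<in>pos_indices m. lam r * A r x) + c" for x
  have X_meas: "X \<in> borel_measurable N"
    unfolding X_def[abs_def] by (intro borel_measurable_add borel_measurable_const lv.series_measurable)
  define P where "P R = {r \<in> pos_indices m. r \<le> R}" for R
  have P: "P R \<subseteq> pos_indices m" "finite (P R)" "incseq P" "(\<Union>R. P R) = pos_indices m" for R
  proof -
    show "finite (P R)" by (rule finite_subset[of _ "{..R}"]) (auto simp: P_def)
  qed (auto simp: P_def incseq_def)
  have c_lim: "(\<lambda>R. \<Sum>q<R. delta_sq a b k U d (\<psi> q)) \<longlonglongrightarrow> c"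
    unfolding c_def by (rule exhaustion_sum_tendsto[OF _ _ _ _ c_summable]) (auto simp: incseq_def)
  \<comment> \<open>The deterministic series contributes the constant factor
    \<open>exp (- (\<theta> * c))\<close>. The limits of the truncated statistics and the transforms
    of the truncated limit variable are the same finite products, so they have a common
    limit.\<close>
  have laplace: "(\<lambda>\<nu>. \<integral>\<omega>. exp (- (\<theta> * T \<nu> \<omega>)) \<partial>M \<nu>) \<longlonglongrightarrow> (\<integral>x. exp (- (\<theta> * X x)) \<partial>N)" if \<theta>: "0 \<le> \<theta>" for \<theta>
  proof -
    have "(\<lambda>R. (\<Prod>r\<in>P R. exp (- (\<theta> * delta_sq a b k U d (\<phi> r) / (1 + 2 * \<theta> * lam r))) / sqrt (1 + 2 * \<theta> * lam r) ^ (k - 1))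
        * exp (- (\<theta> * (\<Sum>q<R. delta_sq a b k U d (\<psi> q)))))
      \<longlonglongrightarrow> (\<integral>x. exp (- (\<theta> * (\<Sum>\<^sub>\<infinity>r\<in>pos_indices m. lam r * A r x))) \<partial>N) * exp (- (\<theta> * c))"
      by (intro tendsto_mult lv.series_laplace[OF P \<theta>] tendsto_exp tendsto_minus tendsto_const c_lim)
    also have "(\<integral>x. exp (- (\<theta> * (\<Sum>\<^sub>\<infinity>r\<in>pos_indices m. lam r * A r x))) \<partial>N) * exp (- (\<theta> * c))
      = (\<integral>x. exp (- (\<theta> * X x)) \<partial>N)"
    proof -
      have "exp (- (\<theta> * X x)) = exp (- (\<theta> * (\<Sum>\<^sub>\<infinity>r\<in>pos_indices m. lam r * A r x))) * exp (- (\<theta> * c))" for x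
        by (simp add: X_def distrib_left flip: exp_add)
      then show ?thesis by simp
    qed
    finally have "(\<lambda>\<nu>. \<integral>\<omega>. exp (- (\<theta> * es.fs.T \<nu> \<omega>)) \<partial>M \<nu>) \<longlonglongrightarrow> (\<integral>x. exp (- (\<theta> * X x)) \<partial>N)"
      by (intro es.laplace_tendsto[OF \<theta>]) (simp only: es.truncated_limit_eq[OF \<theta>] \<delta>2_Inl \<delta>2_Inr P_def)
    moreover have "(\<integral>\<omega>. exp (- (\<theta> * T \<nu> \<omega>)) \<partial>M \<nu>) = (\<integral>\<omega>. exp (- (\<theta> * es.fs.T \<nu> \<omega>)) \<partial>M \<nu>)" for \<nu>
      by (intro Bochner_Integration.integral_cong refl) (simp only: T_eq)
    ultimately show ?thesis by (simp only:)
  qed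
  have "weak_conv_m (\<lambda>\<nu>. distr (M \<nu>) borel (T \<nu>)) (distr N borel X)"
  proof (rule weak_conv_m_if_laplace_converges)
    show "real_distribution (distr (M \<nu>) borel (T \<nu>))" for \<nu>
      by (rule prob_space.real_distribution_distr[OF prob T_meas])
    show "real_distribution (distr N borel X)"
      by (rule lv.real_distribution_distr[OF X_meas])
    show "AE x in distr (M \<nu>) borel (T \<nu>). 0 \<le> x" for \<nu>
      using T_nonneg T_meas[of \<nu>] by (subst AE_distr_iff) auto
    show "AE x in distr N borel X. 0 \<le> x"
    proof (subst AE_distr_iff)
      show "AE x in N. 0 \<le> X x"
        using lv.series_nonneg by eventually_elim (simp add: X_def c_nonneg)
    qed (use X_meas in auto)
    fix p :: nat
    show "(\<lambda>\<nu>. \<integral>x. exp (- (real p * x)) \<partial>distr (M \<nu>) borel (T \<nu>)) \<longlonglongrightarrow> (\<integral>x. exp (- (real p * x)) \<partial>distr N borel X)"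
      using laplace[of "real p"] T_meas X_meas by (simp add: integral_distr)
  qed
  then show ?thesis
    using lv.AE_summable c_summable unfolding T_def[abs_def] X_def[abs_def] c_def by blast
qed

end
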